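(* Let $1\le\gamma\le p_0<\infty$ and let $\{T_j\}$ be a sequence of operators, each acting from $\bigcup_{w\in A_{p_0/\gamma}}L_{p_0,w}(\mathbb R^n)$ into the space of measurable functions and satisfying $$\|T_jf|L_{p_0,w}(\mathbb R^n)\|\le c_1\|f|L_{p_0,w}(\mathbb R^n)\|$$ for all $f\in L_{p_0,w}(\mathbb R^n)$ and all $w\in A_{p_0/\gamma}$, with a constant $c_1$ independent of $j$ and $f$ and depending on $w$ only through $[w]_{A_{p_0/\gamma}}$. Let $\gamma<q,p<\infty$. (i) If $w\in A_{p/\gamma}$ and $-n/p\le r<0$, then there is a constant $c_4$ such that for all sequences $(f_j)$ of functions in $L^r_p(w,\mathbb R^n)$ $$\Big\|\big(\sum_j|T_jf_j|^q\big)^{1/q}\Big|L^r_p(w,\mathbb R^n)\Big\|\le c_4\Big\|\big(\sum_j|f_j|^q\big)^{1/q}\Big|L^r_p(w,\mathbb R^n)\Big\|.$$ (ii) If $w\in A_{p/\gamma}\cap RH_\sigma$ (with $1<\sigma<\infty$) and $-n/p\le r\le -n/(p\sigma)$, then there is a constant $c_5$ such that for all sequences $(f_j)$ of functions in $L^r_p(\lambda,w,\mathbb R^n)$ $$\Big\|\big(\sum_j|T_jf_j|^q\big)^{1/q}\Big|L^r_p(\lambda,w,\mathbb R^n)\Big\|\le c_5\Big\|\big(\sum_j|f_j|^q\big)^{1/q}\Big|L^r_p(\lambda,w,\mathbb R^n)\Big\|.$$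
   Context: Norm inequalities are understood in $[0,\infty]$. Under the stated hypotheses the Morrey spaces in (i) and (ii) are contained in the domain $\bigcup_{u\in A_{p_0/\gamma}}L_{p_0,u}(\mathbb R^n)$, and $T_j$ is defined on them by restriction. Cubes in $\mathbb R^n$ have sides parallel to the axes. A weight is a nonnegative locally integrable function; $w(E)=\int_E w$, $|E|$ is Lebesgue measure, $p'$ is the conjugate exponent. For $0<p<\infty$, $\|f|L_{p,w}(E)\|=(\int_E|f|^pw)^{1/p}$. Muckenhoupt classes: for $1<p<\infty$ and $w>0$ a.e. locally integrable, $w\in A_p$ iff $[w]_{A_p}=\sup_Q\frac{w(Q)}{|Q|}\big(\frac{w^{1-p'}(Q)}{|Q|}\big)^{p-1}<\infty$; $w\in A_1$ iff there is $c$ with $w(Q)/|Q|\le c\,w(x)$ for a.e. $x\in Q$ and every cube $Q$ ($[w]_{A_1}$ is the least such $c$). Reverse Hölder class: for $1<\sigma<\infty$, $w\in RH_\sigma$ iff there is $c$ with $\big(|Q|^{-1}\int_Q w^\sigma\big)^{1/\sigma}\le c\,|Q|^{-1}\int_Q w$ for all cubes $Q$. Morrey spaces: for $0<p<\infty$, $-n/p\le r<0$ and a weight $w$, the spaces $L^r_p(w,\mathbb R^n)$ and $L^r_p(\lambda,w,\mathbb R^n)$ consist of the (classes of) measurable complex functions $f$ on $\mathbb R^n$ for which, respectively, the following quasinorms are finite (suprema over all cubes; here $\lambda$ is just a label for the second type of space): $$\|f|L^r_p(w,\mathbb R^n)\|=\sup_Q w(Q)^{-(1/p+r/n)}\|f|L_{p,w}(Q)\|,\qquad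 \|f|L^r_p(\lambda,w,\mathbb R^n)\|=\sup_Q |Q|^{-(1/p+r/n)}\|f|L_{p,w}(Q)\|.$$ *)

theory Defs
  imports "HOL-Analysis.Analysis"
begin

text \<open>
  Norms take values in \<open>[0,\<infinity>]\<close>, i.e. in \<^typ>\<open>ennreal\<close>. The space \<open>\<real>\<^sup>n\<close> is \<open>real ^ 'n\<close> with
  \<open>n = CARD('n)\<close>; measurability, integrals and null sets refer to \<^term>\<open>lebesgue\<close>.
\<close>

subsection \<open>Powers in \<open>[0,\<infinity>]\<close>\<close>

text \<open>
  Conventions at the endpoints: \<open>x\<^sup>0 = 1\<close>; for \<open>a > 0\<close>, \<open>0\<^sup>a = 0\<close> and \<open>\<infinity>\<^sup>a = \<infinity>\<close>;
  for \<open>a < 0\<close>, \<open>0\<^sup>a = \<infinity>\<close> and \<open>\<infinity>\<^sup>a = 0\<close>.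
\<close>

definition epow :: "ennreal \<Rightarrow> real \<Rightarrow> ennreal" where
  "epow x a =
     (if a = 0 then 1
      else if x = \<infinity> then (if a > 0 then \<infinity> else 0)
      else if x = 0 then (if a > 0 then 0 else \<infinity>)
      else ennreal (enn2real x powr a))"

subsection \<open>Cubes and weights\<close>

definition cubes :: "(real ^ 'n) set set" where
  "cubes = {cbox a (\<chi> i. a $ i + l) | a l. 0 < l}"

definition weight :: "(real ^ 'n \<Rightarrow> real) \<Rightarrow> bool" where
  "weight w \<longleftrightarrow> w \<in> borel_measurable lebesgue \<and> (\<forall>x. 0 \<le> w x) \<and>
     (\<forall>K. compact K \<longrightarrow> set_integrable lebesgue K w)"

definition mass :: "(real ^ 'n \<Rightarrow> ennreal) \<Rightarrow> (real ^ 'n) set \<Rightarrow> ennreal" where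
  "mass g E = (\<integral>\<^sup>+x\<in>E. g x \<partial>lebesgue)"

definition avg :: "(real ^ 'n \<Rightarrow> ennreal) \<Rightarrow> (real ^ 'n) set \<Rightarrow> ennreal" where
  "avg g Q = mass g Q / emeasure lebesgue Q"

definition conj_exponent :: "real \<Rightarrow> real" where
  "conj_exponent p = p / (p - 1)"

text \<open>
  The constant \<open>[w]\<close> of the Muckenhoupt class with exponent \<open>p \<ge> 1\<close>. For \<open>p = 1\<close> it is the
  infimum of all admissible finite constants, hence \<open>\<infinity>\<close> if there is none.
\<close>

definition Ap_const :: "real \<Rightarrow> (real ^ 'n \<Rightarrow> real) \<Rightarrow> ennreal" where
  "Ap_const p w =
     (if p = 1 then
        Inf {ennreal c | c. 0 \<le> c \<and>
          (\<forall>Q\<in>cubes. AE x in lebesgue. x \<in> Q \<longrightarrow> avg w Q \<le> ennreal c * ennreal (w x))}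
      else
        (SUP Q\<in>cubes. avg w Q * epow (avg (\<lambda>x. epow (w x) (1 - conj_exponent p)) Q) (p - 1)))"

text \<open>Positivity a.e. is also required for \<open>p = 1\<close>; this only excludes the zero weight.\<close>

definition muckenhoupt :: "real \<Rightarrow> (real ^ 'n \<Rightarrow> real) set" where
  "muckenhoupt p = {w. weight w \<and> (AE x in lebesgue. 0 < w x) \<and> Ap_const p w < \<infinity>}"

definition reverse_hoelder :: "real \<Rightarrow> (real ^ 'n \<Rightarrow> real) set" where
  "reverse_hoelder \<sigma> = {w. weight w \<and>
     (\<exists>c::real. 0 \<le> c \<and>
        (\<forall>Q\<in>cubes. epow (avg (\<lambda>x. epow (w x) \<sigma>) Q) (1 / \<sigma>) \<le> ennreal c * avg w Q))}"

subsection \<open>Weighted Lebesgue and Morrey spaces\<close>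

text \<open>
  The quasinorms are defined for \<open>[0,\<infinity>]\<close>-valued functions, so that they apply to
  \<open>(\<Sum>\<^sub>j |f\<^sub>j|\<^sup>q)\<^sup>1\<^sup>/\<^sup>q\<close>, which may be infinite; a complex function \<open>f\<close> enters through \<open>|f|\<close>.
\<close>

definition Lp_norm ::
  "real \<Rightarrow> (real ^ 'n \<Rightarrow> real) \<Rightarrow> (real ^ 'n) set \<Rightarrow> (real ^ 'n \<Rightarrow> ennreal) \<Rightarrow> ennreal" where
  "Lp_norm p w E g = epow (\<integral>\<^sup>+x\<in>E. epow (g x) p * ennreal (w x) \<partial>lebesgue) (1 / p)"

definition Lp_space :: "real \<Rightarrow> (real ^ 'n \<Rightarrow> real) \<Rightarrow> (real ^ 'n \<Rightarrow> complex) set" where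
  "Lp_space p w = {f \<in> borel_measurable lebesgue. Lp_norm p w UNIV (\<lambda>x. cmod (f x)) < \<infinity>}"

definition morrey_norm ::
  "real \<Rightarrow> real \<Rightarrow> (real ^ 'n \<Rightarrow> real) \<Rightarrow> (real ^ 'n \<Rightarrow> ennreal) \<Rightarrow> ennreal" where
  "morrey_norm p r w g =
     (SUP Q\<in>cubes. epow (mass w Q) (- (1 / p + r / CARD('n))) * Lp_norm p w Q g)"

definition morrey_space ::
  "real \<Rightarrow> real \<Rightarrow> (real ^ 'n \<Rightarrow> real) \<Rightarrow> (real ^ 'n \<Rightarrow> complex) set" where
  "morrey_space p r w =
     {f \<in> borel_measurable lebesgue. morrey_norm p r w (\<lambda>x. cmod (f x)) < \<infinity>}"

definition lmorrey_norm ::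
  "real \<Rightarrow> real \<Rightarrow> (real ^ 'n \<Rightarrow> real) \<Rightarrow> (real ^ 'n \<Rightarrow> ennreal) \<Rightarrow> ennreal" where
  "lmorrey_norm p r w g =
     (SUP Q\<in>cubes. epow (emeasure lebesgue Q) (- (1 / p + r / CARD('n))) * Lp_norm p w Q g)"

definition lmorrey_space ::
  "real \<Rightarrow> real \<Rightarrow> (real ^ 'n \<Rightarrow> real) \<Rightarrow> (real ^ 'n \<Rightarrow> complex) set" where
  "lmorrey_space p r w =
     {f \<in> borel_measurable lebesgue. lmorrey_norm p r w (\<lambda>x. cmod (f x)) < \<infinity>}"

definition lq_sum :: "real \<Rightarrow> (nat \<Rightarrow> real ^ 'n \<Rightarrow> complex) \<Rightarrow> real ^ 'n \<Rightarrow> ennreal" where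
  "lq_sum q f x = epow (\<Sum>j. epow (cmod (f j x)) q) (1 / q)"

subsection \<open>Operators\<close>

text \<open>
  An operator on a space \<open>D\<close> of a.e.-classes of measurable functions is represented by a map on
  representatives that respects equality a.e. on \<open>D\<close>. It need not be linear or sublinear, and its
  values outside \<open>D\<close> are irrelevant.
\<close>

definition operator_on ::
  "(real ^ 'n \<Rightarrow> complex) set \<Rightarrow> ((real ^ 'n \<Rightarrow> complex) \<Rightarrow> (real ^ 'n \<Rightarrow> complex)) \<Rightarrow> bool" where
  "operator_on D T \<longleftrightarrow>
     (\<forall>f\<in>D. T f \<in> borel_measurable lebesgue) \<and>
     (\<forall>f\<in>D. \<forall>g\<in>D. (AE x in lebesgue. f x = g x) \<longrightarrow> (AE x in lebesgue. T f x = T g x))"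

end

theory Submission
  imports Defs
begin

text \<open>
  Rubio de Francia extrapolation passes from \<open>L\<^bsub>p\<^sub>0\<^esub>\<close> to \<open>L\<^sub>q\<close>, where the bounds can be summed
  over \<open>j\<close>, and from \<open>L\<^sub>q\<close> to \<open>L\<^sub>p\<close>, with constants depending only on the Muckenhoupt constant of the
  weight. For a cube \<open>Q\<close> and its dilates \<open>Q\<^sub>k = 3\<^sup>k Q\<close>, the \<open>L\<^sub>p\<close> bound is then applied with a weight
  \<open>W = w (\<Sum>\<^sub>k \<phi>\<^sub>k 1\<^bsub>Q\<^sub>k\<^esub>)\<close> that dominates \<open>w\<close> on \<open>Q\<close>. If \<open>\<phi>\<^sub>k\<close> decays slowly enough, \<open>W\<close> is a
  Muckenhoupt weight uniformly in \<open>Q\<close>; if it decays fast enough, the norm of a Morrey function in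
  \<open>L\<^sub>p(W)\<close> is controlled by summing its Morrey bounds on the \<open>Q\<^sub>k\<close>. Powers of \<open>w(Q)/w(Q\<^sub>k)\<close> do both in
  case (i). In case (ii) a geometric sequence does, since the reverse Hoelder inequality limits how much
  mass \<open>w\<close> puts on \<open>Q\<^sub>j\<close> relative to \<open>Q\<^sub>k\<close> for \<open>j < k\<close>.
\<close>

subsection \<open>Powers\<close>

text \<open>The operators need not be sublinear, so \<open>f j\<close> cannot be split into a part
  near a cube and a part far from it; locality has to sit entirely in the weight, and each estimate
  on a cube is the restriction of a global one. Since the weight changes with the cube, every bound
  must be uniform over all weights with a given Muckenhoupt bound \<open>K\<close>. Put \<kappa> = 1
  + r p / n. The integral of the p-th power of a Morrey function over a cube is controlled by the
  power \<kappa> of the gauge of the cube, w(Q) or |Q|. Negative r means \<kappa> < 1, and r \<le> -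
  n / (p \<sigma>) means \<kappa> \<le> 1 - 1 / \<sigma>; these bounds reconcile the two opposite
  demands on the decay of the multiplier. The exponent \<gamma> is absorbed by extrapolating for
  pairs of \<gamma>-th powers, with exponents divided by \<gamma>. The weight construction behind
  extrapolation also shows that Morrey functions lie in the domain of the operators.\<close>

lemma ennreal_pos_cases:
  fixes x :: ennreal
  obtains "x = 0" | "x = top" | r where "0 < r" "x = ennreal r"
  by (metis ennreal_cases ennreal_0 less_eq_real_def)

lemma epow_ennreal [simp]: "0 < x \<Longrightarrow> epow (ennreal x) a = ennreal (x powr a)"
  by (auto simp: epow_def ennreal_eq_0_iff)

lemma epow_0 [simp]: "epow 0 a = (if a = 0 then 1 else if a > 0 then 0 else top)"
  by (auto simp: epow_def)

lemma epow_top [simp]: "epow top a = (if a = 0 then 1 else if a > 0 then top else 0)"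
  by (auto simp: epow_def)

lemma epow_exp_0 [simp]: "epow x 0 = 1"
  by (auto simp: epow_def)

lemma epow_exp_1 [simp]: "epow x 1 = x"
  by (cases x rule: ennreal_pos_cases) auto

lemma epow_one [simp]: "epow 1 a = 1"
  using epow_ennreal[of 1 a] by simp

lemma epow_epow: "epow (epow x a) b = epow x (a * b)"
proof (cases x rule: ennreal_pos_cases)
  case (3 r)
  then show ?thesis by (simp add: powr_powr)
qed (auto simp: zero_less_mult_iff mult_less_0_iff not_less)

lemma epow_mult: "0 \<le> a \<Longrightarrow> epow (x * y) a = epow x a * epow y a"
proof (cases x rule: ennreal_pos_cases; cases y rule: ennreal_pos_cases)
  fix r s :: real
  assume "0 < r" "x = ennreal r" "0 < s" "y = ennreal s"
  then show ?thesis
    by (simp add: ennreal_mult[symmetric] powr_mult)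
qed (auto simp: ennreal_mult_top ennreal_top_mult)

lemma epow_mult_pos:
  "0 < x \<Longrightarrow> x < top \<Longrightarrow> epow (x * y) a = epow x a * epow y a"
proof (cases x rule: ennreal_pos_cases; cases y rule: ennreal_pos_cases)
  fix r s :: real
  assume "0 < r" "x = ennreal r" "0 < s" "y = ennreal s"
  then show ?thesis
    by (simp add: ennreal_mult[symmetric] powr_mult)
qed (auto simp: ennreal_mult_top ennreal_top_mult)

lemma epow_add: "0 \<le> a \<Longrightarrow> 0 \<le> b \<Longrightarrow> epow x (a + b) = epow x a * epow x b"
  by (cases x rule: ennreal_pos_cases) (auto simp: powr_add ennreal_mult[symmetric])

lemma epow_add_pos: "0 < x \<Longrightarrow> x < top \<Longrightarrow> epow x (a + b) = epow x a * epow x b"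
  by (cases x rule: ennreal_pos_cases) (auto simp: powr_add ennreal_mult[symmetric])

lemma epow_mono: "0 \<le> a \<Longrightarrow> x \<le> y \<Longrightarrow> epow x a \<le> epow y a"
proof (cases x rule: ennreal_pos_cases; cases y rule: ennreal_pos_cases)
  fix r s :: real
  assume "0 < r" "x = ennreal r" "0 < s" "y = ennreal s" "0 \<le> a" "x \<le> y"
  then show ?thesis by (auto intro!: ennreal_leI powr_mono2)
qed (auto simp: top_unique ennreal_eq_0_iff)

lemma epow_antimono: "a \<le> 0 \<Longrightarrow> x \<le> y \<Longrightarrow> epow y a \<le> epow x a"
proof (cases x rule: ennreal_pos_cases; cases y rule: ennreal_pos_cases)
  fix r s :: real
  assume "0 < r" "x = ennreal r" "0 < s" "y = ennreal s" "a \<le> 0" "x \<le> y"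
  then show ?thesis by (auto intro!: ennreal_leI powr_mono2')
qed (auto simp: top_unique ennreal_eq_0_iff)

lemma epow_le_iff: "0 < a \<Longrightarrow> epow x a \<le> y \<longleftrightarrow> x \<le> epow y (1 / a)"
  using epow_mono[of a x "epow y (1/a)"] epow_mono[of "1/a" "epow x a" y]
  by (auto simp: epow_epow)

lemma epow_eq_0_iff: "epow x a = 0 \<longleftrightarrow> (x = 0 \<and> 0 < a) \<or> (x = top \<and> a < 0)"
  by (cases x rule: ennreal_pos_cases) auto

lemma epow_eq_top_iff: "epow x a = top \<longleftrightarrow> (x = top \<and> 0 < a) \<or> (x = 0 \<and> a < 0)"
  by (cases x rule: ennreal_pos_cases) auto

lemma epow_pos: "0 < x \<Longrightarrow> x < top \<Longrightarrow> 0 < epow x a"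
  by (cases x rule: ennreal_pos_cases) auto

lemma epow_finite: "0 < x \<Longrightarrow> x < top \<Longrightarrow> epow x a < top"
  by (cases x rule: ennreal_pos_cases) auto

lemma epow_less_top: "0 \<le> a \<Longrightarrow> x < top \<Longrightarrow> epow x a < top"
  by (cases x rule: ennreal_pos_cases) auto

lemma epow_minus: "epow x (- a) = inverse (epow x a)"
  by (cases x rule: ennreal_pos_cases) (auto simp: powr_minus inverse_ennreal)

lemma epow_minus_mult: "0 < x \<Longrightarrow> x < top \<Longrightarrow> epow x (- a) * epow x a = 1"
  by (simp add: epow_add_pos[symmetric])

lemma epow_divide: "0 < y \<Longrightarrow> y < top \<Longrightarrow> epow (x / y) a = epow x a / epow y a"
  by (cases x rule: ennreal_pos_cases; cases y rule: ennreal_pos_cases)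
     (auto simp: powr_divide divide_ennreal ennreal_top_divide)

lemma epow_measurable [measurable]: "(\<lambda>x. epow x a) \<in> borel_measurable borel"
  unfolding epow_def by measurable

lemma epow_measurable_comp [measurable (raw)]:
  "f \<in> borel_measurable M \<Longrightarrow> (\<lambda>x. epow (f x) a) \<in> borel_measurable M"
  using measurable_compose[OF _ epow_measurable] .

text \<open>Weighted AM-GM inequality. At the endpoints a factor 0 wins against an infinite one, in
  agreement with 0 * top = 0.\<close>

lemma epow_convex_ineq:
  assumes a: "0 < a" "a < 1"
  shows "epow x a * epow y (1 - a) \<le> ennreal a * x + ennreal (1 - a) * y"
proof (cases x rule: ennreal_pos_cases; cases y rule: ennreal_pos_cases)
  fix r s :: real
  assume rs: "0 < r" "x = ennreal r" "0 < s" "y = ennreal s"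
  then have "r powr a * s powr (1 - a) \<le> a * r + (1 - a) * s"
    using Youngs_inequality_0[of a "1 - a" r s] a by (simp add: algebra_simps)
  then show ?thesis
    using rs a by (simp add: ennreal_mult[symmetric] ennreal_plus[symmetric] del: ennreal_plus)
qed (use a in \<open>auto simp: ennreal_mult_top ennreal_top_mult ennreal_eq_0_iff\<close>)

section \<open>Integral inequalities for extended-valued functions\<close>

abbreviation pint :: "real \<Rightarrow> (real ^ 'n \<Rightarrow> ennreal) \<Rightarrow> (real ^ 'n \<Rightarrow> ennreal) \<Rightarrow> ennreal" where
  "pint p w f \<equiv> \<integral>\<^sup>+x. epow (f x) p * w x \<partial>lebesgue"

lemma Hoelder_nn_integral:
  assumes [measurable]: "f \<in> borel_measurable M" "g \<in> borel_measurable M"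
    and a: "0 < a" "a < 1"
  shows "(\<integral>\<^sup>+x. epow (f x) a * epow (g x) (1 - a) \<partial>M)
           \<le> epow (\<integral>\<^sup>+x. f x \<partial>M) a * epow (\<integral>\<^sup>+x. g x \<partial>M) (1 - a)"
proof -
  let ?A = "\<integral>\<^sup>+x. f x \<partial>M" and ?B = "\<integral>\<^sup>+x. g x \<partial>M"
  consider "?A = 0" | "?B = 0" | "?A > 0" "?B > 0" "?A = top \<or> ?B = top"
    | "?A > 0" "?B > 0" "?A < top" "?B < top"
    by (metis not_gr_zero top.not_eq_extremum)
  then show ?thesis
  proof cases
    case 1
    then have "AE x in M. f x = 0" by (simp add: nn_integral_0_iff_AE)
    then have "(\<integral>\<^sup>+x. epow (f x) a * epow (g x) (1 - a) \<partial>M) = (\<integral>\<^sup>+x. 0 \<partial>M)"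
      using a by (intro nn_integral_cong_AE) auto
    then show ?thesis by simp
  next
    case 2
    then have "AE x in M. g x = 0" by (simp add: nn_integral_0_iff_AE)
    then have "(\<integral>\<^sup>+x. epow (f x) a * epow (g x) (1 - a) \<partial>M) = (\<integral>\<^sup>+x. 0 \<partial>M)"
      using a by (intro nn_integral_cong_AE) auto
    then show ?thesis by simp
  next
    case 3
    then have "epow ?A a * epow ?B (1 - a) = top"
      using a by (auto simp: ennreal_mult_eq_top_iff epow_eq_top_iff epow_eq_0_iff)
    then show ?thesis by simp
  next
    case 4
    \<comment> \<open>After normalising both functions to integral one, the pointwise AM-GM bound
      integrates to a + (1 - a) = 1.\<close>
    have *: "epow (f x) a * epow (g x) (1 - a) \<le>
        epow ?A a * epow ?B (1 - a) * (ennreal a * (f x / ?A) + ennreal (1 - a) * (g x / ?B))" for x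
    proof -
      have "f x = ?A * (f x / ?A)" "g x = ?B * (g x / ?B)"
        using 4 by (auto simp: ennreal_times_divide mult.commute[of ?A] mult.commute[of ?B]
            ennreal_mult_divide_eq)
      then have "epow (f x) a * epow (g x) (1 - a) =
          epow ?A a * epow (f x / ?A) a * (epow ?B (1 - a) * epow (g x / ?B) (1 - a))"
        using 4 by (metis epow_mult_pos)
      also have "\<dots> = epow ?A a * epow ?B (1 - a) * (epow (f x / ?A) a * epow (g x / ?B) (1 - a))"
        by (simp add: mult_ac)
      also have "\<dots> \<le> epow ?A a * epow ?B (1 - a) * (ennreal a * (f x / ?A) + ennreal (1 - a) * (g x / ?B))"
        by (intro mult_left_mono epow_convex_ineq a) auto
      finally show ?thesis .
    qed
    have "(\<integral>\<^sup>+x. epow (f x) a * epow (g x) (1 - a) \<partial>M) \<le>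
       (\<integral>\<^sup>+x. epow ?A a * epow ?B (1 - a) * (ennreal a * (f x / ?A) + ennreal (1 - a) * (g x / ?B)) \<partial>M)"
      by (intro nn_integral_mono *)
    also have "\<dots> = epow ?A a * epow ?B (1 - a) * (ennreal a * (?A / ?A) + ennreal (1 - a) * (?B / ?B))"
      by (simp add: nn_integral_cmult nn_integral_add nn_integral_divide)
    also have "\<dots> = epow ?A a * epow ?B (1 - a)"
      using 4 a by (simp add: ennreal_plus[symmetric] del: ennreal_plus)
    finally show ?thesis .
  qed
qed

text \<open>Jensen's inequality for weights of total mass at most one, obtained from Hoelder on the
  counting measure by splitting c into c^(1/s) * c^(1 - 1/s).\<close>

lemma epow_suminf_le:
  fixes f :: "nat \<Rightarrow> ennreal"
  assumes s: "1 < s" and c: "(\<Sum>k. c k) \<le> 1"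
  shows "epow (\<Sum>k. c k * f k) s \<le> (\<Sum>k. c k * epow (f k) s)"
proof -
  have "(\<Sum>k. c k * f k) = (\<integral>\<^sup>+k. epow (c k * epow (f k) s) (1/s) * epow (c k) (1 - 1/s) \<partial>count_space UNIV)"
  proof -
    have "c k * f k = epow (c k * epow (f k) s) (1/s) * epow (c k) (1 - 1/s)" for k
    proof -
      have "c k * f k = epow (c k) (1/s + (1 - 1/s)) * f k" by simp
      also have "\<dots> = epow (c k) (1/s) * epow (c k) (1 - 1/s) * f k"
        using s by (subst epow_add) (auto simp: field_simps)
      finally show ?thesis using s by (simp add: epow_mult epow_epow mult_ac)
    qed
    then show ?thesis by (simp add: nn_integral_count_space_nat)
  qed
  also have "\<dots> \<le> epow (\<Sum>k. c k * epow (f k) s) (1/s) * epow (\<Sum>k. c k) (1 - 1/s)"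
    using Hoelder_nn_integral[of "\<lambda>k. c k * epow (f k) s" "count_space UNIV" c "1/s"] s
    by (simp add: nn_integral_count_space_nat)
  also have "\<dots> \<le> epow (\<Sum>k. c k * epow (f k) s) (1/s) * epow 1 (1 - 1/s)"
    using s c by (intro mult_left_mono epow_mono) auto
  finally show ?thesis using s by (simp add: epow_le_iff)
qed

text \<open>\<open>lebesgue\<close> abbreviates the completion of \<open>lborel\<close>; this rule
  would turn its values into values of the uncompleted measure.\<close>

declare emeasure_completion [simp del]

subsection \<open>Cubes\<close>

definition cube :: "real ^ 'n \<Rightarrow> real \<Rightarrow> (real ^ 'n) set" where
  "cube a l = cbox a (\<chi> i. a $ i + l)"

definition ocube :: "real ^ 'n \<Rightarrow> real \<Rightarrow> (real ^ 'n) set" where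
  "ocube a l = box a (\<chi> i. a $ i + l)"

lemma mem_cube: "x \<in> cube a l \<longleftrightarrow> (\<forall>i. a $ i \<le> x $ i \<and> x $ i \<le> a $ i + l)"
  by (simp add: cube_def mem_box_cart)

lemma mem_ocube: "x \<in> ocube a l \<longleftrightarrow> (\<forall>i. a $ i < x $ i \<and> x $ i < a $ i + l)"
  by (simp add: ocube_def mem_box_cart)

lemma ocube_subset_cube: "ocube a l \<subseteq> cube a l"
  by (auto simp: mem_cube mem_ocube less_imp_le)

lemma open_ocube: "open (ocube a l)"
  by (simp add: ocube_def open_box)

lemma cubes_eq: "cubes = {cube a l | a l. 0 < l}"
  by (simp add: cubes_def cube_def)

lemma cube_in_cubes [simp, intro]: "0 < l \<Longrightarrow> cube a l \<in> cubes"
  by (auto simp: cubes_eq)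

lemma cubesE:
  assumes "Q \<in> cubes"
  obtains a l where "0 < l" "Q = cube a l"
  using assms by (auto simp: cubes_eq)

lemma cube_measurable [measurable, simp]: "cube a l \<in> sets lebesgue"
  by (simp add: cube_def)

lemma ocube_measurable [measurable, simp]: "ocube a l \<in> sets lebesgue"
  by (simp add: ocube_def)

lemma cubes_measurable [measurable_dest, simp]: "Q \<in> cubes \<Longrightarrow> Q \<in> sets lebesgue"
  by (auto elim: cubesE)

lemma emeasure_cube:
  fixes a :: "real ^ 'n"
  assumes "0 \<le> l"
  shows "emeasure lebesgue (cube a l) = ennreal (l ^ CARD('n))"
proof -
  have "emeasure lebesgue (cube a l) = emeasure lborel (cbox a (\<chi> i. a $ i + l))"
    by (simp add: cube_def emeasure_completion)
  also have "\<dots> = ennreal (\<Prod>b\<in>Basis. ((\<chi> i. a $ i + l) - a) \<bullet> b)"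
    using assms by (subst emeasure_lborel_cbox) (auto simp: Basis_vec_def cart_eq_inner_axis[symmetric] inner_axis')
  also have "(\<Prod>b\<in>Basis. ((\<chi> i. a $ i + l) - a) \<bullet> b) = (\<Prod>b\<in>(Basis::(real^'n) set). l)"
    by (intro prod.cong) (auto simp: Basis_vec_def inner_axis)
  finally show ?thesis by simp
qed

lemma emeasure_cubes_pos: "Q \<in> cubes \<Longrightarrow> 0 < emeasure lebesgue Q"
  by (auto elim!: cubesE simp: emeasure_cube)

lemma emeasure_cubes_finite: "Q \<in> cubes \<Longrightarrow> emeasure lebesgue Q < top"
  by (auto elim!: cubesE simp: emeasure_cube)

lemma AE_cube_ocube: "AE x in lebesgue. x \<in> cube a l \<longrightarrow> x \<in> ocube a l"
proof -
  have "negligible (cube a l - ocube a l)"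
    unfolding cube_def ocube_def by (rule negligible_frontier_interval)
  then have "cube a l - ocube a l \<in> null_sets lebesgue"
    by (simp add: negligible_iff_null_sets)
  then show ?thesis
    by (rule AE_I') auto
qed

definition triple :: "real ^ 'n \<Rightarrow> real \<Rightarrow> (real ^ 'n) set" where
  "triple a l = cube (\<chi> i. a $ i - l) (3 * l)"

lemma triple_in_cubes [simp, intro]: "0 < l \<Longrightarrow> triple a l \<in> cubes"
  by (auto simp: triple_def)

lemma triple_measurable [measurable, simp]: "triple a l \<in> sets lebesgue"
  by (simp add: triple_def)

lemma emeasure_triple:
  fixes a :: "real ^ 'n"
  shows "0 \<le> l \<Longrightarrow> emeasure lebesgue (triple a l) = ennreal ((3 * l) ^ CARD('n))"
  by (simp add: triple_def emeasure_cube)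

lemma mem_triple: "x \<in> triple a l \<longleftrightarrow> (\<forall>i. a $ i - l \<le> x $ i \<and> x $ i \<le> a $ i + 2 * l)"
  by (simp add: triple_def mem_cube algebra_simps)

lemma cube_subset_triple: "0 \<le> l \<Longrightarrow> cube a l \<subseteq> triple a l"
proof
  fix x assume "0 \<le> l" "x \<in> cube a l"
  then show "x \<in> triple a l"
    unfolding mem_triple mem_cube by (metis add_increasing2 diff_le_eq le_add_same_cancel1 mult_2 order_trans add.assoc)
qed

lemma bounded_subset_cube:
  fixes S :: "(real ^ 'n) set"
  assumes "bounded S"
  shows "\<exists>a l. 0 < l \<and> S \<subseteq> cube a l"
proof -
  obtain B where B: "0 < B" "\<And>x. x \<in> S \<Longrightarrow> norm x \<le> B"
    using assms by (auto simp: bounded_pos)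
  have "S \<subseteq> cube (\<chi> i. - B) (2 * B)"
  proof
    fix x assume "x \<in> S"
    then have "\<bar>x $ i\<bar> \<le> B" for i
      using B(2) component_le_norm_cart order_trans by blast
    then show "x \<in> cube (\<chi> i. - B) (2 * B)"
      by (auto simp: mem_cube abs_le_iff) (metis minus_le_iff)
  qed
  then show ?thesis using B by (intro exI[of _ "\<chi> i. - B"] exI[of _ "2 * B"]) auto
qed

subsection \<open>Masses\<close>

lemma mass_mono_set: "A \<subseteq> B \<Longrightarrow> mass g A \<le> mass g B"
  unfolding mass_def by (intro nn_integral_mono) (auto simp: indicator_def)

lemma mass_mono: "(\<And>x. x \<in> A \<Longrightarrow> f x \<le> g x) \<Longrightarrow> mass f A \<le> mass g A"
  unfolding mass_def by (intro nn_integral_mono) (auto simp: indicator_def)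

lemma mass_mono_AE:
  "(AE x in lebesgue. x \<in> A \<longrightarrow> f x \<le> g x) \<Longrightarrow> mass f A \<le> mass g A"
  unfolding mass_def by (intro nn_integral_mono_AE) (auto simp: indicator_def)

lemma mass_cong_AE:
  "(AE x in lebesgue. x \<in> A \<longrightarrow> f x = g x) \<Longrightarrow> mass f A = mass g A"
  unfolding mass_def by (intro nn_integral_cong_AE) (auto simp: indicator_def)

lemma mass_cmult:
  "f \<in> borel_measurable lebesgue \<Longrightarrow> A \<in> sets lebesgue \<Longrightarrow> mass (\<lambda>x. c * f x) A = c * mass f A"
  unfolding mass_def by (simp add: mult.assoc nn_integral_cmult)

lemma mass_const: "A \<in> sets lebesgue \<Longrightarrow> mass (\<lambda>x. c) A = c * emeasure lebesgue A"
  unfolding mass_def by (simp add: nn_integral_cmult_indicator)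

lemma mass_add:
  "f \<in> borel_measurable lebesgue \<Longrightarrow> g \<in> borel_measurable lebesgue \<Longrightarrow> A \<in> sets lebesgue \<Longrightarrow>
     mass (\<lambda>x. f x + g x) A = mass f A + mass g A"
  unfolding mass_def by (simp add: distrib_right nn_integral_add)

lemma mass_suminf:
  "(\<And>k. f k \<in> borel_measurable lebesgue) \<Longrightarrow> A \<in> sets lebesgue \<Longrightarrow>
     mass (\<lambda>x. \<Sum>k. f k x) A = (\<Sum>k. mass (f k) A)"
  unfolding mass_def by (simp add: ennreal_suminf_multc[symmetric] nn_integral_suminf del: ennreal_suminf_multc)

lemma mass_Un:
  "f \<in> borel_measurable lebesgue \<Longrightarrow> A \<in> sets lebesgue \<Longrightarrow> B \<in> sets lebesgue \<Longrightarrow> A \<inter> B = {} \<Longrightarrow>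
    mass f (A \<union> B) = mass f A + mass f B"
  unfolding mass_def by (subst nn_integral_add[symmetric]) (auto intro!: nn_integral_cong simp: indicator_def)

lemma mass_pos:
  assumes [measurable]: "f \<in> borel_measurable lebesgue" and "Q \<in> cubes"
    and "AE x in lebesgue. 0 < f x"
  shows "0 < mass f Q"
proof (rule ccontr)
  assume "\<not> 0 < mass f Q"
  then have "AE x in lebesgue. f x * indicator Q x = 0"
    using assms(2) unfolding mass_def by (subst (asm) not_gr_zero) (simp add: nn_integral_0_iff_AE)
  with assms(3) have "AE x in lebesgue. x \<notin> Q"
    by eventually_elim (auto simp: indicator_def split: if_splits)
  then have "Q \<in> null_sets lebesgue"
    using assms(2) by (simp add: AE_iff_null_sets)
  then show False using emeasure_cubes_pos[OF assms(2)] by auto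
qed

lemma mass_eq_density:
  "f \<in> borel_measurable lebesgue \<Longrightarrow> A \<in> sets lebesgue \<Longrightarrow> mass f A = emeasure (density lebesgue f) A"
  by (simp add: mass_def emeasure_density)

subsection \<open>The Muckenhoupt condition for extended weights\<close>

text \<open>The exponent equals 1 - p', so this is the companion weight of the A_p
  condition.\<close>

definition dual_weight :: "real \<Rightarrow> (real ^ 'n \<Rightarrow> ennreal) \<Rightarrow> real ^ 'n \<Rightarrow> ennreal" where
  "dual_weight p w x = epow (w x) (- 1 / (p - 1))"

text \<open>The A_p inequality is multiplied by |Q|^p, so that no quotient occurs, and the bound
  \<open>K\<close> is a parameter for uniform estimates. Weights may be 0 or \<infinity> on null
  sets; for p > 1 local integrability follows from the inequality.\<close>

definition apw :: "real \<Rightarrow> real \<Rightarrow> (real ^ 'n \<Rightarrow> ennreal) \<Rightarrow> bool" where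
  "apw p K w \<longleftrightarrow> w \<in> borel_measurable lebesgue \<and> (AE x in lebesgue. 0 < w x \<and> w x < top) \<and>
     (\<forall>Q\<in>cubes. mass w Q * epow (mass (dual_weight p w) Q) (p - 1)
        \<le> ennreal K * epow (emeasure lebesgue Q) p)"

lemma dual_weight_measurable [measurable (raw)]:
  "w \<in> borel_measurable lebesgue \<Longrightarrow> dual_weight p w \<in> borel_measurable lebesgue"
  unfolding dual_weight_def by measurable

lemma apw_measurable [measurable_dest]: "apw p K w \<Longrightarrow> w \<in> borel_measurable lebesgue"
  by (simp add: apw_def)

lemma apw_AE: "apw p K w \<Longrightarrow> AE x in lebesgue. 0 < w x \<and> w x < top"
  by (simp add: apw_def)

lemma apwD:
  "apw p K w \<Longrightarrow> Q \<in> cubes \<Longrightarrow>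
    mass w Q * epow (mass (dual_weight p w) Q) (p - 1) \<le> ennreal K * epow (emeasure lebesgue Q) p"
  by (simp add: apw_def)

lemma dual_weight_AE:
  "AE x in lebesgue. 0 < w x \<and> w x < top \<Longrightarrow> AE x in lebesgue. 0 < dual_weight p w x \<and> dual_weight p w x < top"
  unfolding dual_weight_def by (erule eventually_mono) (simp add: epow_pos epow_finite)

lemma dual_exponent_mult: "1 < p \<Longrightarrow> (p - 1) * (conj_exponent p - 1) = 1"
  by (simp add: conj_exponent_def field_simps)

lemma conj_exponent_gt_1: "1 < p \<Longrightarrow> 1 < conj_exponent p"
  by (simp add: conj_exponent_def field_simps)

lemma dual_dual_weight: "1 < p \<Longrightarrow> dual_weight (conj_exponent p) (dual_weight p w) = w"
  using dual_exponent_mult[of p] by (intro ext) (simp add: dual_weight_def epow_epow)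

text \<open>Raising the A_p inequality to the power p' - 1 = 1 / (p - 1) exchanges a weight and its
  dual.\<close>

lemma apw_dual:
  assumes p: "1 < p" and w: "apw p K w"
  shows "apw (conj_exponent p) (K powr (conj_exponent p - 1)) (dual_weight p w)"
proof -
  let ?p' = "conj_exponent p"
  have p': "1 < ?p'" using p by (rule conj_exponent_gt_1)
  have [measurable]: "w \<in> borel_measurable lebesgue" using w by measurable
  have "mass (dual_weight p w) Q * epow (mass w Q) (?p' - 1)
     \<le> ennreal (K powr (?p' - 1)) * epow (emeasure lebesgue Q) ?p'" if Q: "Q \<in> cubes" for Q
  proof -
    have "mass (dual_weight p w) Q * epow (mass w Q) (?p' - 1)
      = epow (mass w Q * epow (mass (dual_weight p w) Q) (p - 1)) (?p' - 1)"
      using p' dual_exponent_mult[OF p] by (simp add: epow_mult epow_epow mult.commute)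
    also have "\<dots> \<le> epow (ennreal K * epow (emeasure lebesgue Q) p) (?p' - 1)"
      using p' by (intro epow_mono apwD w Q) auto
    also have "\<dots> = epow (ennreal K) (?p' - 1) * epow (emeasure lebesgue Q) ?p'"
    proof -
      have "p * (?p' - 1) = ?p'" using p by (simp add: conj_exponent_def field_simps)
      then show ?thesis using p' by (simp add: epow_mult epow_epow)
    qed
    also have "epow (ennreal K) (?p' - 1) \<le> ennreal (K powr (?p' - 1))"
      using p' by (cases "0 < K") (auto simp: ennreal_neg)
    finally show ?thesis by (simp add: mult_right_mono)
  qed
  then show ?thesis
    using w dual_weight_AE[OF apw_AE[OF w], of p] p
    by (auto simp: apw_def dual_dual_weight)
qed

lemma apw_mass_pos: "apw p K w \<Longrightarrow> Q \<in> cubes \<Longrightarrow> 0 < mass w Q"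
  by (rule mass_pos) (auto dest: apw_measurable apw_AE elim!: eventually_mono)

text \<open>The dual weight has positive mass, so an infinite mass of w would make the left side of
  the A_p inequality infinite.\<close>

lemma apw_mass_finite:
  assumes "1 < p" "apw p K w" "Q \<in> cubes"
  shows "mass w Q < top"
proof (rule ccontr)
  assume "\<not> mass w Q < top"
  then have *: "mass w Q = top" by (simp add: less_top[symmetric])
  have "0 < mass (dual_weight p w) Q"
    using assms by (intro apw_mass_pos[OF apw_dual])
  then have "epow (mass (dual_weight p w) Q) (p - 1) \<noteq> 0"
    using assms(1) by (auto simp: epow_eq_0_iff)
  then have "mass w Q * epow (mass (dual_weight p w) Q) (p - 1) = top"
    by (simp add: *)
  moreover have "ennreal K * epow (emeasure lebesgue Q) p < top"
    using assms emeasure_cubes_finite[OF assms(3)] by (simp add: ennreal_mult_less_top epow_less_top)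
  ultimately show False using apwD[OF assms(2,3)] by simp
qed

lemma dual_weight_cancel:
  assumes p: "1 < p" and w: "0 < w x" "w x < top"
  shows "epow (w x) (1/p) * epow (dual_weight p w x) (1 - 1/p) = 1"
proof -
  have "- 1 / (p - 1) * (1 - 1/p) = - (1/p)" using p by (simp add: field_simps)
  then have "epow (dual_weight p w x) (1 - 1/p) = epow (w x) (- (1/p))"
    by (simp only: dual_weight_def epow_epow)
  then show ?thesis
    using epow_minus_mult[of "w x" "1/p"] w by (simp add: mult.commute)
qed

text \<open>Hoelder applied to 1 = w^(1/p) * dual^(1 - 1/p): the inequality opposite to A_p,
  available on every measurable set.\<close>

lemma measure_le_mass_dual:
  assumes p: "1 < p" and [measurable]: "w \<in> borel_measurable lebesgue" "E \<in> sets lebesgue"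
    and w: "AE x in lebesgue. 0 < w x \<and> w x < top"
  shows "epow (emeasure lebesgue E) p \<le> mass w E * epow (mass (dual_weight p w) E) (p - 1)"
proof -
  let ?\<sigma> = "dual_weight p w"
  have "emeasure lebesgue E = (\<integral>\<^sup>+x. indicator E x \<partial>lebesgue)" by simp
  also have "\<dots> = (\<integral>\<^sup>+x. epow (w x * indicator E x) (1/p) * epow (?\<sigma> x * indicator E x) (1 - 1/p) \<partial>lebesgue)"
  proof (rule nn_integral_cong_AE)
    show "AE x in lebesgue. indicator E x = epow (w x * indicator E x) (1/p) * epow (?\<sigma> x * indicator E x) (1 - 1/p)"
      using w
    proof eventually_elim
      case (elim x)
      then show ?case using p dual_weight_cancel[OF p, of w x] by (auto simp: indicator_def)
    qed
  qed
  also have "\<dots> \<le> epow (mass w E) (1/p) * epow (mass ?\<sigma> E) (1 - 1/p)"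
    unfolding mass_def using p by (intro Hoelder_nn_integral) auto
  finally have "epow (emeasure lebesgue E) p \<le> epow (epow (mass w E) (1/p) * epow (mass ?\<sigma> E) (1 - 1/p)) p"
    using p by (intro epow_mono) auto
  also have "\<dots> = mass w E * epow (mass ?\<sigma> E) (p - 1)"
  proof -
    have "(1 - 1/p) * p = p - 1" using p by (simp add: field_simps)
    then show ?thesis using p by (simp add: epow_mult epow_epow)
  qed
  finally show ?thesis .
qed

text \<open>Hoelder on E meets the A_p inequality on Q. A fixed share of the volume therefore
  carries a fixed share of the mass, which yields doubling and reverse doubling.\<close>

lemma apw_subset:
  assumes p: "1 < p" and w: "apw p K w" and Q: "Q \<in> cubes"
    and E [measurable]: "E \<in> sets lebesgue" and "E \<subseteq> Q"
  shows "epow (emeasure lebesgue E) p * mass w Q \<le> ennreal K * epow (emeasure lebesgue Q) p * mass w E"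
proof -
  let ?\<sigma> = "dual_weight p w"
  have "epow (emeasure lebesgue E) p \<le> mass w E * epow (mass ?\<sigma> E) (p - 1)"
    by (rule measure_le_mass_dual[OF p apw_measurable[OF w] E apw_AE[OF w]])
  also have "\<dots> \<le> mass w E * epow (mass ?\<sigma> Q) (p - 1)"
    using p \<open>E \<subseteq> Q\<close> by (intro mult_left_mono epow_mono mass_mono_set) auto
  finally have "epow (emeasure lebesgue E) p * mass w Q \<le> mass w E * epow (mass ?\<sigma> Q) (p - 1) * mass w Q"
    by (rule mult_right_mono) auto
  also have "\<dots> = mass w E * (mass w Q * epow (mass ?\<sigma> Q) (p - 1))"
    by (simp add: mult_ac)
  also have "\<dots> \<le> mass w E * (ennreal K * epow (emeasure lebesgue Q) p)"
    by (intro mult_left_mono apwD w Q) auto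
  finally show ?thesis by (simp add: mult_ac)
qed

section \<open>Doubling and reverse doubling of Muckenhoupt weights\<close>

definition doubling :: "real \<Rightarrow> (real ^ 'n \<Rightarrow> ennreal) \<Rightarrow> bool" where
  "doubling D w \<longleftrightarrow> w \<in> borel_measurable lebesgue \<and> 0 \<le> D \<and>
     (\<forall>Q\<in>cubes. 0 < mass w Q \<and> mass w Q < top) \<and>
     (\<forall>a l. 0 < l \<longrightarrow> mass w (triple a l) \<le> ennreal D * mass w (cube a l))"

lemma apw_doubling:
  fixes w :: "real ^ 'n \<Rightarrow> ennreal"
  assumes p: "1 < p" and K: "0 \<le> K" and w: "apw p K w"
  shows "doubling (K * (3 ^ CARD('n)) powr p) w"
  unfolding doubling_def
proof (intro conjI ballI allI impI)
  fix a :: "real ^ 'n" and l :: real assume l: "0 < l"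
  let ?n = "CARD('n)"
  let ?e = "ennreal ((l ^ ?n) powr p)"
  have "?e * mass w (triple a l) \<le> ennreal K * ennreal (((3 * l) ^ ?n) powr p) * mass w (cube a l)"
    using apw_subset[OF p w, of "triple a l" "cube a l"] l cube_subset_triple[of l a]
    by (simp add: triple_def emeasure_cube)
  also have "\<dots> = ?e * (ennreal (K * (3 ^ ?n) powr p) * mass w (cube a l))"
    using l K by (simp add: power_mult_distrib powr_mult ennreal_mult mult_ac)
  finally show "mass w (triple a l) \<le> ennreal (K * (3 ^ ?n) powr p) * mass w (cube a l)"
    using l by (subst (asm) ennreal_mult_le_mult_iff) auto
qed (use assms apw_mass_pos apw_mass_finite in \<open>auto intro: apw_measurable\<close>)

text \<open>Here the subset is the ring between a cube and its triple. It has a fixed share of the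
  volume, hence of the mass, so the inner cube misses that share.\<close>

lemma apw_reverse_doubling:
  assumes p: "1 < p" and K: "0 \<le> K"
  shows "\<exists>\<rho>. 0 < \<rho> \<and> \<rho> < 1 \<and> (\<forall>(w :: real ^ 'n \<Rightarrow> ennreal) a l. apw p K w \<longrightarrow> 0 < l \<longrightarrow>
           mass w (cube a l) \<le> ennreal \<rho> * mass w (triple a l))"
proof -
  let ?n = "CARD('n)"
  define d :: real where "d = (3 ^ ?n - 1) powr p"
  define e :: real where "e = (3 ^ ?n) powr p"
  \<comment> \<open>The value that turns d * (q + e') \<le> K * e * e', with q the mass of the cube
    and e' that of the ring, into q \<le> \<rho> * (q + e').\<close>
  define \<rho> where "\<rho> = (K * e) / (K * e + d)"
  have "(1::real) < 3 ^ ?n" by (rule one_less_power) auto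
  then have "(3::real) ^ ?n \<noteq> 1" by linarith
  then have de: "0 < d" "0 < e" by (auto simp: d_def e_def)
  \<comment> \<open>For \<open>K = 0\<close> the ratio \<rho> is 0; the maximum keeps the final
    ratio positive.\<close>
  define \<rho>' where "\<rho>' = max (1/2) \<rho>"
  have Ke: "0 < K * e + d" using de K by (simp add: add_nonneg_pos)
  have \<rho>: "\<rho> < 1" using de Ke by (simp add: \<rho>_def)
  have main: "mass w (cube a l) \<le> ennreal \<rho> * mass w (triple a l)"
    if w: "apw p K w" and l: "0 < l" for w :: "real ^ 'n \<Rightarrow> ennreal" and a l
  proof -
    let ?Q = "cube a l" and ?T = "triple a l"
    let ?E = "?T - ?Q"
    have [measurable]: "w \<in> borel_measurable lebesgue" using w by measurable
    have T: "mass w ?T = mass w ?Q + mass w ?E"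
      using mass_Un[of w ?Q ?E] cube_subset_triple[of l a] l
      by (simp add: Un_absorb1 triple_in_cubes)
    have fin: "mass w ?T < top" using p w l by (intro apw_mass_finite) auto
    obtain q e' where q: "mass w ?Q = ennreal q" "mass w ?E = ennreal e'" "0 \<le> q" "0 \<le> e'"
      using fin unfolding T by (cases "mass w ?Q"; cases "mass w ?E") auto
    have "emeasure lebesgue ?E = emeasure lebesgue ?T - emeasure lebesgue ?Q"
      using l cube_subset_triple[of l a] by (intro emeasure_Diff) (auto simp: emeasure_cube triple_def)
    also have "\<dots> = ennreal ((3 ^ ?n - 1) * l ^ ?n)"
      using l by (simp add: triple_def emeasure_cube ennreal_minus power_mult_distrib algebra_simps)
    finally have E: "emeasure lebesgue ?E = ennreal ((3 ^ ?n - 1) * l ^ ?n)" .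
    have "epow (emeasure lebesgue ?E) p * mass w ?T \<le> ennreal K * epow (emeasure lebesgue ?T) p * mass w ?E"
      using l by (intro apw_subset p w) (auto simp: triple_in_cubes)
    then have "ennreal (((3 ^ ?n - 1) * l ^ ?n) powr p) * (ennreal q + ennreal e')
          \<le> ennreal K * ennreal (((3 * l) ^ ?n) powr p) * ennreal e'"
      using l by (simp add: E T q emeasure_triple)
    then have "((3 ^ ?n - 1) * l ^ ?n) powr p * (q + e') \<le> K * ((3 * l) ^ ?n) powr p * e'"
      using q K by (simp add: ennreal_mult[symmetric] ennreal_plus[symmetric] del: ennreal_plus)
    then have "(l ^ ?n) powr p * (d * (q + e')) \<le> (l ^ ?n) powr p * (K * e * e')"
      using l by (simp add: d_def e_def power_mult_distrib powr_mult mult_ac)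
    then have "d * (q + e') \<le> K * e * e'" using l by simp
    moreover have "0 \<le> d * e'" using de q by simp
    ultimately have "q * (K * e + d) \<le> K * e * (q + e')" by (simp add: algebra_simps)
    then have "q \<le> \<rho> * (q + e')" using Ke by (simp add: \<rho>_def field_simps)
    then show ?thesis
      using q Ke de K by (auto simp: T ennreal_mult[symmetric] ennreal_plus[symmetric] \<rho>_def simp del: ennreal_plus)
  qed
  have "mass w (cube a l) \<le> ennreal \<rho>' * mass w (triple a l)"
    if "apw p K w" "0 < l" for w :: "real ^ 'n \<Rightarrow> ennreal" and a l
    using main[OF that] by (rule order_trans) (auto intro!: mult_right_mono ennreal_leI simp: \<rho>'_def)
  then show ?thesis using \<rho> by (intro exI[of _ \<rho>']) (auto simp: \<rho>'_def)
qed

lemma apw_of_muckenhoupt: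
  fixes w :: "real ^ 'n \<Rightarrow> real"
  assumes p: "1 < p" and w: "w \<in> muckenhoupt p" and K: "Ap_const p w \<le> ennreal K"
  shows "apw p K (\<lambda>x. ennreal (w x))"
  unfolding apw_def
proof (intro conjI ballI)
  show "(\<lambda>x. ennreal (w x)) \<in> borel_measurable lebesgue"
    using w by (auto simp: muckenhoupt_def weight_def)
  show "AE x in lebesgue. 0 < ennreal (w x) \<and> ennreal (w x) < top"
    using w by (auto simp: muckenhoupt_def)
  fix Q :: "(real ^ 'n) set" assume Q: "Q \<in> cubes"
  let ?m = "emeasure lebesgue Q" and ?\<sigma> = "dual_weight p (\<lambda>x. ennreal (w x))"
  have m: "0 < ?m" "?m < top" using Q by (auto simp: emeasure_cubes_pos emeasure_cubes_finite)
  have \<sigma>: "(\<lambda>x. epow (ennreal (w x)) (1 - conj_exponent p)) = ?\<sigma>"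
  proof -
    have "1 - conj_exponent p = - 1 / (p - 1)" using p by (simp add: conj_exponent_def field_simps)
    then show ?thesis by (simp add: dual_weight_def fun_eq_iff)
  qed
  have "avg w Q * epow (avg ?\<sigma> Q) (p - 1) \<le> ennreal K"
    using K p Q unfolding Ap_const_def \<sigma> by (auto simp: SUP_le_iff)
  then have "mass w Q * epow (mass ?\<sigma> Q) (p - 1) / (?m * epow ?m (p - 1)) \<le> ennreal K"
    using m p unfolding avg_def epow_divide[OF m]
    by (simp add: divide_ennreal_def ennreal_inverse_mult epow_less_top mult_ac)
  moreover have "?m * epow ?m (p - 1) = epow ?m p"
    using epow_add[of 1 "p - 1" ?m] p by simp
  ultimately have "mass w Q * epow (mass ?\<sigma> Q) (p - 1) / epow ?m p \<le> ennreal K" by simp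
  then have "mass w Q * epow (mass ?\<sigma> Q) (p - 1) / epow ?m p * epow ?m p \<le> ennreal K * epow ?m p"
    by (rule mult_right_mono) auto
  then show "mass w Q * epow (mass ?\<sigma> Q) (p - 1) \<le> ennreal K * epow ?m p"
    using epow_pos[OF m, of p] epow_finite[OF m, of p]
    by (simp add: ennreal_divide_times)
qed

subsection \<open>Weighted maximal functions\<close>

lemma cube_meets_subset_triple:
  assumes "m \<le> l" and "x \<in> cube a l" "x \<in> cube b m"
  shows "cube b m \<subseteq> triple a l"
proof
  fix y assume y: "y \<in> cube b m"
  show "y \<in> triple a l"
    unfolding mem_triple
  proof
    fix i
    have "a $ i \<le> x $ i" "x $ i \<le> a $ i + l" "b $ i \<le> x $ i" "x $ i \<le> b $ i + m"
        "b $ i \<le> y $ i" "y $ i \<le> b $ i + m"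
      using assms y by (auto simp: mem_cube)
    with assms(1) show "a $ i - l \<le> y $ i \<and> y $ i \<le> a $ i + 2 * l" by linarith
  qed
qed

text \<open>Pick a cube of largest side, discard all cubes meeting it, which lie in its triple, and
  recurse on the rest.\<close>

lemma Vitali_finite_cubes:
  fixes I :: "((real ^ 'n) \<times> real) set"
  assumes "finite I" "\<And>a l. (a, l) \<in> I \<Longrightarrow> 0 < l"
  shows "\<exists>S\<subseteq>I. disjoint_family_on (\<lambda>(a, l). cube a l) S \<and>
           (\<Union>(a, l)\<in>I. cube a l) \<subseteq> (\<Union>(a, l)\<in>S. triple a l)"
  using assms
proof (induction I rule: finite_psubset_induct)
  case (psubset I)
  show ?case
  proof (cases "I = {}")
    case True
    then show ?thesis by (auto simp: disjoint_family_on_def)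
  next
    case False
    then have "Max (snd ` I) \<in> snd ` I" using psubset(1) by (intro Max_in) auto
    then obtain a l where al: "(a, l) \<in> I" "l = Max (snd ` I)" by auto
    have l: "0 < l" using al psubset(3) by auto
    define J where "J = {(b, m)\<in>I. cube b m \<inter> cube a l = {}}"
    have "a \<in> cube a l" using l by (simp add: mem_cube)
    then have "J \<subset> I" using al by (auto simp: J_def)
    then obtain S where S: "S \<subseteq> J" "disjoint_family_on (\<lambda>(a, l). cube a l) S"
        "(\<Union>(a, l)\<in>J. cube a l) \<subseteq> (\<Union>(a, l)\<in>S. triple a l)"
      using psubset(2)[of J] psubset(3) by blast
    have "(\<Union>(b, m)\<in>I. cube b m) \<subseteq> (\<Union>(b, m)\<in>insert (a, l) S. triple b m)"
    proof clarify
      fix x b m assume bm: "(b, m) \<in> I" and x: "x \<in> cube b m"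
      show "x \<in> (\<Union>(b, m)\<in>insert (a, l) S. triple b m)"
      proof (cases "(b, m) \<in> J")
        case True
        with x S(3) show ?thesis by auto
      next
        case False
        then obtain z where "z \<in> cube b m" "z \<in> cube a l" using bm by (auto simp: J_def)
        moreover have "m \<le> l" using bm psubset(1) al(2) by (metis Max_ge finite_imageI imageI snd_conv)
        ultimately have "cube b m \<subseteq> triple a l" by (intro cube_meets_subset_triple) auto
        with x show ?thesis by auto
      qed
    qed
    moreover have "disjoint_family_on (\<lambda>(a, l). cube a l) (insert (a, l) S)"
      unfolding disjoint_family_on_def
    proof (intro ballI impI)
      fix c d assume cd: "c \<in> insert (a, l) S" "d \<in> insert (a, l) S" "c \<noteq> d"
      have J: "(case e of (b, m) \<Rightarrow> cube b m) \<inter> cube a l = {}" if "e \<in> S" for e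
        using that S(1) by (cases e) (auto simp: J_def)
      consider "c \<in> S" "d \<in> S" | "c = (a, l)" "d \<in> S" | "c \<in> S" "d = (a, l)"
        using cd by blast
      then show "(case c of (b, m) \<Rightarrow> cube b m) \<inter> (case d of (b, m) \<Rightarrow> cube b m) = {}"
      proof cases
        case 1
        then show ?thesis using S(2) cd(3) unfolding disjoint_family_on_def by blast
      next
        case 2
        then show ?thesis using J[of d] by (simp add: Int_commute)
      next
        case 3
        then show ?thesis using J[of c] by simp
      qed
    qed
    moreover have "insert (a, l) S \<subseteq> I" using al S(1) by (auto simp: J_def)
    ultimately show ?thesis by blast
  qed
qed

text \<open>Averages are taken in the measure w dx. Admitting only cubes with x in the interior
  makes superlevel sets unions of open cubes, hence measurable. For w = 1 this is the uncentred
  Hardy-Littlewood maximal function.\<close>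

definition maxfun :: "(real ^ 'n \<Rightarrow> ennreal) \<Rightarrow> (real ^ 'n \<Rightarrow> ennreal) \<Rightarrow> real ^ 'n \<Rightarrow> ennreal" where
  "maxfun w f x = Sup {mass (\<lambda>y. f y * w y) (cube a l) / mass w (cube a l) | a l. 0 < l \<and> x \<in> ocube a l}"

lemma maxfun_ge:
  "0 < l \<Longrightarrow> x \<in> ocube a l \<Longrightarrow> mass (\<lambda>y. f y * w y) (cube a l) / mass w (cube a l) \<le> maxfun w f x"
  unfolding maxfun_def by (rule Sup_upper) auto

lemma maxfun_le:
  "(\<And>a l. 0 < l \<Longrightarrow> x \<in> ocube a l \<Longrightarrow> mass (\<lambda>y. f y * w y) (cube a l) / mass w (cube a l) \<le> c)
     \<Longrightarrow> maxfun w f x \<le> c"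
  unfolding maxfun_def by (rule Sup_least) auto

lemma maxfun_superlevel:
  "{x. t < maxfun w f x} =
     (\<Union>(a, l)\<in>{(a, l). 0 < l \<and> t < mass (\<lambda>y. f y * w y) (cube a l) / mass w (cube a l)}. ocube a l)"
  unfolding maxfun_def less_Sup_iff by auto

lemma maxfun_measurable [measurable (raw)]: "maxfun w f \<in> borel_measurable lebesgue"
proof (rule borel_measurableI_greater)
  fix t
  have "open {x. t < maxfun w f x}"
    unfolding maxfun_superlevel by (intro open_UN) (auto simp: open_ocube)
  then show "{x \<in> space lebesgue. t < maxfun w f x} \<in> sets lebesgue" by simp
qed

section \<open>The weak type (1,1) bound for doubling measures\<close>

lemma doublingD:
  assumes "doubling D w"
  shows "w \<in> borel_measurable lebesgue" "0 \<le> D" "Q \<in> cubes \<Longrightarrow> 0 < mass w Q" "Q \<in> cubes \<Longrightarrow> mass w Q < top"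
    "0 < l \<Longrightarrow> mass w (triple a l) \<le> ennreal D * mass w (cube a l)"
  using assms by (auto simp: doubling_def)

text \<open>The selected cubes are disjoint, so the integrals of f over them add up to at most the
  whole integral; doubling pays for passing from the triples to the cubes.\<close>

lemma weak_type_finite:
  fixes I :: "((real ^ 'n) \<times> real) set"
  assumes D: "doubling D w" and [measurable]: "f \<in> borel_measurable lebesgue"
    and I: "finite I" "\<And>a l. (a, l) \<in> I \<Longrightarrow> 0 < l \<and> t * mass w (cube a l) \<le> mass (\<lambda>y. f y * w y) (cube a l)"
  shows "t * mass w (\<Union>(a, l)\<in>I. cube a l) \<le> ennreal D * (\<integral>\<^sup>+x. f x * w x \<partial>lebesgue)"
proof -
  note [measurable] = doublingD(1)[OF D]
  obtain S where S: "S \<subseteq> I" "disjoint_family_on (\<lambda>(a, l). cube a l) S"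
      "(\<Union>(a, l)\<in>I. cube a l) \<subseteq> (\<Union>(a, l)\<in>S. triple a l)"
    using Vitali_finite_cubes[of I] I by blast
  have fS: "finite S" using S(1) I(1) by (rule finite_subset)
  have "mass w (\<Union>(a, l)\<in>I. cube a l) \<le> mass w (\<Union>(a, l)\<in>S. triple a l)"
    by (rule mass_mono_set[OF S(3)])
  also have "\<dots> = emeasure (density lebesgue w) (\<Union>(a, l)\<in>S. triple a l)"
    using fS by (intro mass_eq_density) (auto intro!: sets.finite_UN)
  also have "\<dots> \<le> (\<Sum>(a, l)\<in>S. emeasure (density lebesgue w) (triple a l))"
    unfolding case_prod_beta by (rule emeasure_subadditive_finite[OF fS]) auto
  also have "\<dots> = (\<Sum>(a, l)\<in>S. mass w (triple a l))"
    by (intro sum.cong) (auto simp: mass_eq_density)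
  finally have "t * mass w (\<Union>(a, l)\<in>I. cube a l) \<le> t * (\<Sum>(a, l)\<in>S. mass w (triple a l))"
    by (intro mult_left_mono) auto
  also have "\<dots> \<le> (\<Sum>(a, l)\<in>S. ennreal D * mass (\<lambda>y. f y * w y) (cube a l))"
    unfolding sum_distrib_left
  proof (rule sum_mono, clarify)
    fix a l assume "(a, l) \<in> S"
    then have *: "0 < l" "t * mass w (cube a l) \<le> mass (\<lambda>y. f y * w y) (cube a l)"
      using S(1) I(2) by auto
    have "t * mass w (triple a l) \<le> t * (ennreal D * mass w (cube a l))"
      by (intro mult_left_mono doublingD(5)[OF D] *) auto
    also have "\<dots> = ennreal D * (t * mass w (cube a l))" by (simp add: mult_ac)
    also have "\<dots> \<le> ennreal D * mass (\<lambda>y. f y * w y) (cube a l)"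
      by (intro mult_left_mono *) auto
    finally show "t * mass w (triple a l) \<le> ennreal D * mass (\<lambda>y. f y * w y) (cube a l)" .
  qed
  also have "\<dots> = ennreal D * (\<Sum>(a, l)\<in>S. emeasure (density lebesgue (\<lambda>y. f y * w y)) (cube a l))"
    unfolding case_prod_beta sum_distrib_left[symmetric]
    by (intro arg_cong[where f="\<lambda>x. _ * x"] sum.cong) (auto simp: mass_eq_density)
  also have "\<dots> = ennreal D * emeasure (density lebesgue (\<lambda>y. f y * w y)) (\<Union>(a, l)\<in>S. cube a l)"
    using sum_emeasure[of "\<lambda>(a, l). cube a l" S "density lebesgue (\<lambda>y. f y * w y)"] fS S(2)
    by (simp add: case_prod_beta image_subset_iff)
  also have "\<dots> \<le> ennreal D * emeasure (density lebesgue (\<lambda>y. f y * w y)) (space lebesgue)"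
    by (intro mult_left_mono emeasure_mono) auto
  also have "\<dots> = ennreal D * (\<integral>\<^sup>+x. f x * w x \<partial>lebesgue)"
    by (subst emeasure_density) auto
  finally show ?thesis .
qed

lemma weak_type:
  fixes w f :: "real ^ 'n \<Rightarrow> ennreal"
  assumes D: "doubling D w" and [measurable]: "f \<in> borel_measurable lebesgue"
  shows "t * mass w {x. t < maxfun w f x} \<le> ennreal D * (\<integral>\<^sup>+x. f x * w x \<partial>lebesgue)"
proof -
  note [measurable] = doublingD(1)[OF D]
  let ?q = "\<lambda>(a, l). mass (\<lambda>y. f y * w y) (cube a l) / mass w (cube a l)"
  define C where "C = {(a, l). 0 < l \<and> t < mass (\<lambda>y. f y * w y) (cube a l) / mass w (cube a l)}"
  have C: "0 < l \<and> t * mass w (cube a l) \<le> mass (\<lambda>y. f y * w y) (cube a l)" if "(a, l) \<in> C" for a l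
  proof -
    have *: "0 < l" "t \<le> mass (\<lambda>y. f y * w y) (cube a l) / mass w (cube a l)"
      using that by (auto simp: C_def)
    have "t * mass w (cube a l) \<le> mass (\<lambda>y. f y * w y) (cube a l) / mass w (cube a l) * mass w (cube a l)"
      by (intro mult_right_mono *) auto
    also have "\<dots> = mass (\<lambda>y. f y * w y) (cube a l)"
      using *(1) doublingD(3,4)[OF D, of "cube a l"] by (simp add: ennreal_divide_times)
    finally show ?thesis using * by auto
  qed
  \<comment> \<open>The superlevel set is a possibly uncountable union of open cubes; a countable
    subfamily covers it, and finite unions then exhaust it from below.\<close>
  obtain F where F: "F \<subseteq> (\<lambda>(a, l). ocube a l) ` C" "countable F" "\<Union>F = (\<Union>(a, l)\<in>C. ocube a l)"
  proof (rule Lindelof)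
    show "open S" if "S \<in> (\<lambda>(a, l). ocube a l) ` C" for S
      using that by (auto simp: open_ocube)
  qed
  obtain C' where C': "C' \<subseteq> C" "countable C'" "F = (\<lambda>(a, l). ocube a l) ` C'"
    using F(1,2) countable_subset_image[of F "\<lambda>(a, l). ocube a l" C] by blast
  have C'_eq: "(\<Union>(a, l)\<in>C'. ocube a l) = (\<Union>(a, l)\<in>C. ocube a l)"
    using F(3) unfolding C'(3) .
  have U: "{x. t < maxfun w f x} = (\<Union>(a, l)\<in>C'. ocube a l)"
    unfolding maxfun_superlevel C'_eq C_def ..
  show ?thesis
  proof (cases "C' = {}")
    case True
    then show ?thesis unfolding U by (simp add: mass_def)
  next
    case False
    define c where "c = from_nat_into C'"
    have c: "range c = C'" unfolding c_def using range_from_nat_into[OF False C'(2)] .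
    define A where "A n = (\<Union>(a, l)\<in>c ` {..n}. cube a l)" for n :: nat
    have A [measurable]: "A n \<in> sets lebesgue" for n
      unfolding A_def by (intro sets.finite_UN) auto
    have "{x. t < maxfun w f x} \<subseteq> (\<Union>n. A n)"
    proof
      fix x assume "x \<in> {x. t < maxfun w f x}"
      then obtain b m where "(b, m) \<in> range c" "x \<in> ocube b m"
        unfolding U c by auto
      then obtain n where "c n = (b, m)" "x \<in> cube b m"
        using ocube_subset_cube by (metis imageE subsetD)
      then have "x \<in> A n" by (force simp: A_def)
      then show "x \<in> (\<Union>n. A n)" by blast
    qed
    then have "t * mass w {x. t < maxfun w f x} \<le> t * mass w (\<Union>n. A n)"
      by (intro mult_left_mono mass_mono_set) auto
    also have "mass w (\<Union>n. A n) = emeasure (density lebesgue w) (\<Union>n. A n)"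
      by (intro mass_eq_density) auto
    also have "\<dots> = (SUP n. emeasure (density lebesgue w) (A n))"
    proof (rule SUP_emeasure_incseq[symmetric])
      show "range A \<subseteq> sets (density lebesgue w)" using A by auto
      show "incseq A" unfolding incseq_def A_def by (intro allI impI UN_mono image_mono) auto
    qed
    also have "\<dots> = (SUP n. mass w (A n))"
      by (simp add: mass_eq_density)
    also have "t * \<dots> = (SUP n. t * mass w (A n))"
      by (rule SUP_mult_left_ennreal)
    also have "\<dots> \<le> ennreal D * (\<integral>\<^sup>+x. f x * w x \<partial>lebesgue)"
    proof (rule SUP_least)
      fix n
      show "t * mass w (A n) \<le> ennreal D * (\<integral>\<^sup>+x. f x * w x \<partial>lebesgue)"
        unfolding A_def
      proof (rule weak_type_finite[OF D])
        fix a l assume "(a, l) \<in> c ` {..n}"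
        then have "(a, l) \<in> C" using c C'(1) by auto
        then show "0 < l \<and> t * mass w (cube a l) \<le> mass (\<lambda>y. f y * w y) (cube a l)" by (rule C)
      qed auto
    qed
    finally show ?thesis .
  qed
qed

section \<open>From weak type to strong type\<close>

lemma sigma_finite_lebesgue: "sigma_finite_measure (lebesgue :: 'a :: euclidean_space measure)"
proof
  obtain A :: "'a set set" where A: "countable A" "A \<subseteq> sets lborel" "\<Union>A = space lborel" "\<forall>a\<in>A. emeasure lborel a \<noteq> \<infinity>"
    using sigma_finite_lborel unfolding sigma_finite_measure_def by blast
  show "\<exists>A::'a set set. countable A \<and> A \<subseteq> sets lebesgue \<and> \<Union>A = space lebesgue \<and> (\<forall>a\<in>A. emeasure lebesgue a \<noteq> \<infinity>)"
    using A by (intro exI[of _ A]) (auto simp: subset_eq emeasure_completion)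
qed

lemma nn_integral_powr:
  fixes b c :: real
  assumes b: "0 < b" and c: "0 \<le> c"
  shows "(\<integral>\<^sup>+t. ennreal (t powr (b - 1)) * indicator {0..c} t \<partial>lborel) = ennreal (c powr b / b)"
  using nn_integral_has_integral_lebesgue'[OF _ has_integral_powr_from_0[of "b - 1" c]] b c by simp

lemma layer_cake:
  assumes b: "0 < b"
  shows "epow y b = ennreal b * (\<integral>\<^sup>+t. ennreal (t powr (b - 1)) * indicator {t. 0 < t \<and> ennreal t < y} t \<partial>lborel)"
proof (cases y rule: ennreal_pos_cases)
  case 1
  then show ?thesis using b by simp
next
  case (3 r)
  \<comment> \<open>The two integrands can differ only at the endpoints of the interval.\<close>
  have "AE t in lborel. t \<noteq> 0 \<and> t \<noteq> r"
    using AE_lborel_singleton[of 0] AE_lborel_singleton[of r] by auto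
  then have "(\<integral>\<^sup>+t. ennreal (t powr (b - 1)) * indicator {t. 0 < t \<and> ennreal t < y} t \<partial>lborel)
     = (\<integral>\<^sup>+t. ennreal (t powr (b - 1)) * indicator {0..r} t \<partial>lborel)"
    by (intro nn_integral_cong_AE, eventually_elim)
       (use 3 in \<open>auto simp: indicator_def ennreal_less_iff\<close>)
  then show ?thesis
    using 3 b by (simp add: nn_integral_powr ennreal_mult[symmetric])
next
  case 2
  let ?I = "\<integral>\<^sup>+t. ennreal (t powr (b - 1)) * indicator {t. 0 < t \<and> ennreal t < y} t \<partial>lborel"
  have "ennreal (real k) \<le> ennreal b * ?I" for k
  proof -
    \<comment> \<open>Chosen so that b times the integral over [0, c] is k; as k is arbitrary, the
      full integral is infinite.\<close>
    define c where "c = real k powr (1 / b)"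
    have "c powr b = real k" using b by (cases "k = 0") (auto simp: c_def powr_powr)
    have "ennreal (c powr b / b) = (\<integral>\<^sup>+t. ennreal (t powr (b - 1)) * indicator {0..c} t \<partial>lborel)"
      using b by (intro nn_integral_powr[symmetric]) (auto simp: c_def)
    also have "\<dots> \<le> ?I"
      by (intro nn_integral_mono) (use 2 in \<open>auto simp: indicator_def\<close>)
    finally have "ennreal b * ennreal (c powr b / b) \<le> ennreal b * ?I"
      by (intro mult_left_mono) auto
    then show ?thesis using b \<open>c powr b = real k\<close> by (simp add: ennreal_mult[symmetric])
  qed
  then have "\<not> ennreal b * ?I < of_nat k" for k
    by (simp add: not_less ennreal_of_nat_eq_real_of_nat)
  then have "ennreal b * ?I = top"
    using ennreal_Ex_less_of_nat[of "ennreal b * ?I"] less_top by blast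
  then show ?thesis using 2 b by simp
qed

text \<open>The part of f of height at most t adds at most t to every average.\<close>

lemma maxfun_truncate:
  fixes w f :: "real ^ 'n \<Rightarrow> ennreal"
  assumes D: "doubling D w" and [measurable]: "f \<in> borel_measurable lebesgue"
  shows "maxfun w f x \<le> maxfun w (\<lambda>y. f y * indicator {y. t < f y} y) x + t"
proof (rule maxfun_le)
  fix a :: "real ^ 'n" and l :: real assume l: "0 < l" "x \<in> ocube a l"
  note [measurable] = doublingD(1)[OF D]
  let ?g = "\<lambda>y. f y * indicator {y. t < f y} y" and ?Q = "cube a l"
  have m: "0 < mass w ?Q" "mass w ?Q < top" using doublingD(3,4)[OF D, of ?Q] l by auto
  have "mass (\<lambda>y. f y * w y) ?Q \<le> mass (\<lambda>y. ?g y * w y + t * w y) ?Q"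
    by (intro mass_mono) (auto simp: indicator_def distrib_right[symmetric] intro!: mult_right_mono)
  also have "\<dots> = mass (\<lambda>y. ?g y * w y) ?Q + t * mass w ?Q"
    by (subst mass_add) (auto simp: mass_cmult)
  finally have "mass (\<lambda>y. f y * w y) ?Q / mass w ?Q \<le> (mass (\<lambda>y. ?g y * w y) ?Q + t * mass w ?Q) / mass w ?Q"
    by (rule divide_right_mono_ennreal)
  also have "\<dots> = mass (\<lambda>y. ?g y * w y) ?Q / mass w ?Q + t"
    using m by (simp add: add_divide_distrib_ennreal ennreal_mult_divide_eq)
  also have "\<dots> \<le> maxfun w ?g x + t"
    by (intro add_right_mono maxfun_ge l)
  finally show "mass (\<lambda>y. f y * w y) ?Q / mass w ?Q \<le> maxfun w ?g x + t" .
qed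

text \<open>Marcinkiewicz interpolation between weak type (1,1) and the trivial bound for bounded
  functions: the superlevel set at height t is charged to the part of f above t / 2, and the result
  is integrated against p t^(p-1).\<close>

lemma maxfun_strong_type:
  fixes w f :: "real ^ 'n \<Rightarrow> ennreal"
  assumes p: "1 < p" and D: "doubling D w" and [measurable]: "f \<in> borel_measurable lebesgue"
  shows "pint p w (maxfun w f) \<le> ennreal (2 powr p * D * p / (p - 1)) * pint p w f"
proof -
  note [measurable] = doublingD(1)[OF D] and D0 = doublingD(2)[OF D]
  interpret pair_sigma_finite "lebesgue :: (real ^ 'n) measure" "lborel :: real measure"
    by (intro pair_sigma_finite.intro sigma_finite_lebesgue sigma_finite_lborel)
  let ?M = "maxfun w f"
  have [measurable]: "(\<lambda>x. f (fst x)) \<in> borel_measurable (lebesgue \<Otimes>\<^sub>M N)"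
      "(\<lambda>x. w (fst x)) \<in> borel_measurable (lebesgue \<Otimes>\<^sub>M N)"
      "(\<lambda>x. maxfun w f (fst x)) \<in> borel_measurable (lebesgue \<Otimes>\<^sub>M N)" for N :: "real measure"
    by (rule measurable_compose[OF measurable_fst], measurable)+
  have mw: "mass w {x. ennreal t < ?M x} \<le>
      ennreal (2 * D / t) * (\<integral>\<^sup>+x. f x * indicator {x. ennreal (t / 2) < f x} x * w x \<partial>lebesgue)"
    if t: "0 < t" for t :: real
  proof -
    let ?g = "\<lambda>y. f y * indicator {y. ennreal (t / 2) < f y} y"
    have "{x. ennreal t < ?M x} \<subseteq> {x. ennreal (t / 2) < maxfun w ?g x}"
    proof clarify
      fix x assume x: "ennreal t < ?M x"
      show "ennreal (t / 2) < maxfun w ?g x"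
      proof (rule ccontr)
        assume "\<not> ennreal (t / 2) < maxfun w ?g x"
        then have "maxfun w ?g x + ennreal (t / 2) \<le> ennreal (t / 2) + ennreal (t / 2)"
          by (intro add_right_mono) auto
        then have "?M x \<le> ennreal t"
          using maxfun_truncate[OF D, of f x "ennreal (t / 2)"] t
          by (auto simp flip: ennreal_plus)
        with x show False by simp
      qed
    qed
    then have "ennreal (t / 2) * mass w {x. ennreal t < ?M x} \<le> ennreal (t / 2) * mass w {x. ennreal (t / 2) < maxfun w ?g x}"
      by (intro mult_left_mono mass_mono_set) auto
    also have "\<dots> \<le> ennreal D * (\<integral>\<^sup>+x. ?g x * w x \<partial>lebesgue)"
      by (intro weak_type[OF D]) auto
    finally have "ennreal (2 / t) * (ennreal (t / 2) * mass w {x. ennreal t < ?M x})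
        \<le> ennreal (2 / t) * (ennreal D * (\<integral>\<^sup>+x. ?g x * w x \<partial>lebesgue))"
      by (rule mult_left_mono) auto
    then show ?thesis
      using t D0 by (simp add: mult.assoc[symmetric] ennreal_mult[symmetric])
  qed
  have "pint p w ?M =
     (\<integral>\<^sup>+x. \<integral>\<^sup>+t. ennreal p * (ennreal (t powr (p - 1)) * indicator {t. 0 < t \<and> ennreal t < ?M x} t) * w x \<partial>lborel \<partial>lebesgue)"
    using p by (simp add: layer_cake[of p] nn_integral_multc nn_integral_cmult)
  also have "\<dots> = (\<integral>\<^sup>+t. \<integral>\<^sup>+x. ennreal p * (ennreal (t powr (p - 1)) * indicator {t. 0 < t \<and> ennreal t < ?M x} t) * w x \<partial>lebesgue \<partial>lborel)"
    by (rule Fubini'[symmetric], unfold case_prod_beta indicator_def of_bool_def mem_Collect_eq, measurable)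
  also have "\<dots> = (\<integral>\<^sup>+t. ennreal p * ennreal (t powr (p - 1)) * indicator {0<..} t * mass w {x. ennreal t < ?M x} \<partial>lborel)"
  proof (intro nn_integral_cong)
    fix t :: real
    have "(\<integral>\<^sup>+x. ennreal p * (ennreal (t powr (p - 1)) * indicator {t. 0 < t \<and> ennreal t < ?M x} t) * w x \<partial>lebesgue)
       = (\<integral>\<^sup>+x. ennreal p * ennreal (t powr (p - 1)) * indicator {0<..} t * (w x * indicator {x. ennreal t < ?M x} x) \<partial>lebesgue)"
      by (intro nn_integral_cong) (auto split: split_indicator simp: mult.assoc)
    also have "\<dots> = ennreal p * ennreal (t powr (p - 1)) * indicator {0<..} t * mass w {x. ennreal t < ?M x}"
      unfolding mass_def by (rule nn_integral_cmult) measurable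
    finally show "(\<integral>\<^sup>+x. ennreal p * (ennreal (t powr (p - 1)) * indicator {t. 0 < t \<and> ennreal t < ?M x} t) * w x \<partial>lebesgue)
       = ennreal p * ennreal (t powr (p - 1)) * indicator {0<..} t * mass w {x. ennreal t < ?M x}" .
  qed
  also have "\<dots> \<le> (\<integral>\<^sup>+t. ennreal p * ennreal (t powr (p - 1)) * indicator {0<..} t *
      (ennreal (2 * D / t) * (\<integral>\<^sup>+x. f x * indicator {x. ennreal (t / 2) < f x} x * w x \<partial>lebesgue)) \<partial>lborel)"
    by (intro nn_integral_mono) (auto split: split_indicator intro!: mult_left_mono mw)
  also have "\<dots> = (\<integral>\<^sup>+t. \<integral>\<^sup>+x. ennreal p * ennreal (t powr (p - 1)) * indicator {0<..} t *
      ennreal (2 * D / t) * (f x * indicator {x. ennreal (t / 2) < f x} x * w x) \<partial>lebesgue \<partial>lborel)"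
  proof (intro nn_integral_cong)
    fix t :: real
    let ?c = "ennreal p * ennreal (t powr (p - 1)) * indicator {0<..} t" and ?d = "ennreal (2 * D / t)"
      and ?h = "\<lambda>x. f x * indicator {x. ennreal (t / 2) < f x} x * w x"
    have "(\<integral>\<^sup>+x. ?c * ?d * ?h x \<partial>lebesgue) = ?c * ?d * (\<integral>\<^sup>+x. ?h x \<partial>lebesgue)"
      by (rule nn_integral_cmult) measurable
    then show "?c * (?d * (\<integral>\<^sup>+x. ?h x \<partial>lebesgue)) = (\<integral>\<^sup>+x. ?c * ?d * ?h x \<partial>lebesgue)"
      by (simp only: mult.assoc)
  qed
  also have "\<dots> = (\<integral>\<^sup>+x. \<integral>\<^sup>+t. ennreal p * ennreal (t powr (p - 1)) * indicator {0<..} t *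
      ennreal (2 * D / t) * (f x * indicator {x. ennreal (t / 2) < f x} x * w x) \<partial>lborel \<partial>lebesgue)"
    by (rule Fubini', unfold case_prod_beta indicator_def of_bool_def mem_Collect_eq, measurable)
  \<comment> \<open>With the order of integration exchanged, t / 2 < f x restricts t to t < 2 * f x,
    and the inner integral is the layer cake formula with exponent p - 1.\<close>
  also have "\<dots> = (\<integral>\<^sup>+x. \<integral>\<^sup>+t. ennreal (2 * D * p) * f x * w x * 
      (ennreal (t powr (p - 1 - 1)) * indicator {t. 0 < t \<and> ennreal t < 2 * f x} t) \<partial>lborel \<partial>lebesgue)"
  proof (intro nn_integral_cong)
    fix x and t :: real
    show "ennreal p * ennreal (t powr (p - 1)) * indicator {0<..} t *
      ennreal (2 * D / t) * (f x * indicator {x. ennreal (t / 2) < f x} x * w x) =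
      ennreal (2 * D * p) * f x * w x * (ennreal (t powr (p - 1 - 1)) * indicator {t. 0 < t \<and> ennreal t < 2 * f x} t)"
    proof (cases "0 < t")
      case True
      have "ennreal p * ennreal (t powr (p - 1)) * ennreal (2 * D / t) = ennreal (2 * D * p) * ennreal (t powr (p - 1 - 1))"
        using True p D0 by (simp add: ennreal_mult[symmetric] powr_diff field_simps power2_eq_square)
      moreover have "ennreal (t / 2) < f x \<longleftrightarrow> ennreal t < 2 * f x"
      proof (cases "f x")
        case (real r)
        have "2 * ennreal r = ennreal (2 * r)" using real by (simp add: ennreal_mult')
        then show ?thesis using real True by (simp add: ennreal_less_iff field_simps)
      qed (simp add: ennreal_mult_top)
      ultimately show ?thesis using True by (auto split: split_indicator) (simp only: mult.assoc[symmetric], simp add: mult_ac)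
    qed simp
  qed
  also have "\<dots> = (\<integral>\<^sup>+x. ennreal (2 powr p * D * p / (p - 1)) * (epow (f x) p * w x) \<partial>lebesgue)"
  proof (intro nn_integral_cong)
    fix x
    let ?J = "\<integral>\<^sup>+t. ennreal (t powr (p - 1 - 1)) * indicator {t. 0 < t \<and> ennreal t < 2 * f x} t \<partial>lborel"
    have J: "?J = ennreal (1 / (p - 1)) * (ennreal (2 powr (p - 1)) * epow (f x) (p - 1))"
    proof -
      have "epow (2 * f x) (p - 1) = ennreal (2 powr (p - 1)) * epow (f x) (p - 1)"
        using p epow_ennreal[of 2 "p - 1"] by (simp add: epow_mult)
      moreover have "?J = ennreal (1 / (p - 1)) * epow (2 * f x) (p - 1)"
        using p by (simp add: layer_cake[of "p - 1"] mult.assoc[symmetric] ennreal_mult[symmetric])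
      ultimately show ?thesis by simp
    qed
    have fp: "epow (f x) p = f x * epow (f x) (p - 1)"
      using epow_add[of 1 "p - 1" "f x"] p by simp
    have "(\<integral>\<^sup>+t. ennreal (2 * D * p) * f x * w x * 
      (ennreal (t powr (p - 1 - 1)) * indicator {t. 0 < t \<and> ennreal t < 2 * f x} t) \<partial>lborel)
       = ennreal (2 * D * p) * f x * w x * ?J"
      by (rule nn_integral_cmult) auto
    also have "\<dots> = ennreal (2 * D * p) * ennreal (1 / (p - 1)) * ennreal (2 powr (p - 1)) * (epow (f x) p * w x)"
      unfolding J fp by (simp only: mult_ac)
    also have "ennreal (2 * D * p) * ennreal (1 / (p - 1)) * ennreal (2 powr (p - 1)) = ennreal (2 powr p * D * p / (p - 1))"
      using p D0 by (simp add: ennreal_mult[symmetric] powr_diff divide_simps)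
    finally show "(\<integral>\<^sup>+t. ennreal (2 * D * p) * f x * w x * 
      (ennreal (t powr (p - 1 - 1)) * indicator {t. 0 < t \<and> ennreal t < 2 * f x} t) \<partial>lborel) =
      ennreal (2 powr p * D * p / (p - 1)) * (epow (f x) p * w x)" .
  qed
  also have "\<dots> = ennreal (2 powr p * D * p / (p - 1)) * pint p w f"
    by (rule nn_integral_cmult) auto
  finally show ?thesis .
qed

subsection \<open>The Muckenhoupt theorem\<close>

abbreviation HL :: "(real ^ 'n \<Rightarrow> ennreal) \<Rightarrow> real ^ 'n \<Rightarrow> ennreal" where
  "HL \<equiv> maxfun (\<lambda>_. 1)"

lemma HL_ge:
  assumes l: "0 < l" and x: "x \<in> ocube a l"
  shows "mass f (cube a l) \<le> HL f x * emeasure lebesgue (cube a l)"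
proof -
  have m: "0 < emeasure lebesgue (cube a l)" "emeasure lebesgue (cube a l) < top"
    using l by (auto simp: emeasure_cubes_pos emeasure_cubes_finite)
  have "mass f (cube a l) / emeasure lebesgue (cube a l) * emeasure lebesgue (cube a l)
     \<le> HL f x * emeasure lebesgue (cube a l)"
    using maxfun_ge[OF l x, of f "\<lambda>_. 1"] by (intro mult_right_mono) (auto simp: mass_const)
  then show ?thesis using m by (simp add: ennreal_divide_times)
qed

text \<open>The passage through two weighted maximal functions is due to Lerner.\<close>

lemma HL_le_weighted:
  fixes w f :: "real ^ 'n \<Rightarrow> ennreal"
  assumes p: "1 < p" and w: "apw p K w" and [measurable]: "f \<in> borel_measurable lebesgue"
  defines "g \<equiv> \<lambda>y. epow (maxfun (dual_weight p w) (\<lambda>y. f y / dual_weight p w y) y) (p - 1) / w y"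
  shows "epow (HL f x) (p - 1) \<le> ennreal K * maxfun w g x"
proof -
  note [measurable] = apw_measurable[OF w]
  let ?\<sigma> = "dual_weight p w"
  let ?h = "\<lambda>y. f y / ?\<sigma> y"
  have \<sigma>: "apw (conj_exponent p) (K powr (conj_exponent p - 1)) ?\<sigma>" by (rule apw_dual[OF p w])
  have "mass (\<lambda>y. f y * 1) (cube a l) / mass (\<lambda>_. 1) (cube a l) \<le> epow (ennreal K * maxfun w g x) (1 / (p - 1))"
    if l: "0 < l" and x: "x \<in> ocube a l" for a l
  proof -
    let ?Q = "cube a l"
    define s where "s = mass ?\<sigma> ?Q"
    define W where "W = mass w ?Q"
    define m where "m = emeasure lebesgue ?Q"
    define F where "F = mass f ?Q"
    define G where "G = mass (\<lambda>y. g y * w y) ?Q"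
    have Q: "?Q \<in> cubes" using l by simp
    have m: "0 < m" "m < top" using Q by (auto simp: m_def emeasure_cubes_pos emeasure_cubes_finite)
    have s: "0 < s" "s < top"
      unfolding s_def using apw_mass_pos[OF \<sigma> Q] apw_mass_finite[OF conj_exponent_gt_1[OF p] \<sigma> Q] by auto
    have W: "0 < W" "W < top"
      unfolding W_def using apw_mass_pos[OF w Q] apw_mass_finite[OF p w Q] by auto
    have F: "mass (\<lambda>y. ?h y * ?\<sigma> y) ?Q = F"
      unfolding F_def
    proof (rule mass_cong_AE)
      show "AE y in lebesgue. y \<in> ?Q \<longrightarrow> ?h y * ?\<sigma> y = f y"
        using apw_AE[OF \<sigma>] by eventually_elim (auto simp: ennreal_divide_times)
    qed
    \<comment> \<open>The average F / s of h in the dual measure is at most the dual maximal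
      function at almost every point of the cube. The Lebesgue integral of its power p - 1 over the
      cube is G, because g was divided by w.\<close>
    have "epow (F / s) (p - 1) * m = mass (\<lambda>_. epow (F / s) (p - 1)) ?Q"
      by (simp add: mass_const m_def)
    also have "\<dots> \<le> G"
      unfolding G_def
    proof (rule mass_mono_AE)
      show "AE y in lebesgue. y \<in> ?Q \<longrightarrow> epow (F / s) (p - 1) \<le> g y * w y"
        using apw_AE[OF w] AE_cube_ocube[of a l]
      proof eventually_elim
        case (elim y)
        show ?case
        proof
          assume "y \<in> ?Q"
          then have "y \<in> ocube a l" using elim by simp
          then have "F / s \<le> maxfun ?\<sigma> ?h y"
            using maxfun_ge[OF l, of y a ?h ?\<sigma>] by (simp add: F s_def)
          then have "epow (F / s) (p - 1) \<le> epow (maxfun ?\<sigma> ?h y) (p - 1)"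
            using p by (intro epow_mono) auto
          also have "\<dots> = g y * w y" using elim by (auto simp: g_def ennreal_divide_times)
          finally show "epow (F / s) (p - 1) \<le> g y * w y" .
        qed
      qed
    qed
    finally have 1: "epow (F / s) (p - 1) * m \<le> G" .
    have mp: "m * epow m (p - 1) = epow m p" using epow_add[of 1 "p - 1" m] p by simp
    have mp0: "0 < epow m p" "epow m p < top" using m by (auto simp: epow_pos epow_finite)
    \<comment> \<open>The Lebesgue average F / m is traded for F / s; the released factor s^(p-1)
      joins W, and A_p bounds W * s^(p-1) by K * m^p.\<close>
    have "epow (F / m) (p - 1) * (epow m p * W) = epow F (p - 1) * m * W"
    proof -
      have "epow (F / m) (p - 1) * epow m (p - 1) = epow (F / m * m) (p - 1)"
        using p by (simp add: epow_mult)
      also have "F / m * m = F" using m by (simp add: ennreal_divide_times)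
      finally have e: "epow (F / m) (p - 1) * epow m (p - 1) = epow F (p - 1)" .
      have "epow (F / m) (p - 1) * (m * epow m (p - 1) * W) = epow (F / m) (p - 1) * epow m (p - 1) * m * W"
        by (simp only: mult_ac)
      then show ?thesis unfolding mp e .
    qed
    also have "epow F (p - 1) = epow (F / s) (p - 1) * epow s (p - 1)"
    proof -
      have "F / s * s = F" using s by (simp add: ennreal_divide_times)
      moreover have "epow (F / s * s) (p - 1) = epow (F / s) (p - 1) * epow s (p - 1)"
        using p by (intro epow_mult) auto
      ultimately show ?thesis by simp
    qed
    also have "epow (F / s) (p - 1) * epow s (p - 1) * m * W = epow (F / s) (p - 1) * m * (W * epow s (p - 1))"
      by (simp only: mult_ac)
    also have "\<dots> \<le> G * (ennreal K * epow m p)"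
      by (rule mult_mono[OF 1]) (use apwD[OF w Q] in \<open>auto simp: W_def s_def m_def\<close>)
    also have "\<dots> = ennreal K * (G / W) * (epow m p * W)"
    proof -
      have "G / W * W = G" using W by (simp add: ennreal_divide_times)
      moreover have "ennreal K * (G / W) * (epow m p * W) = G / W * W * (ennreal K * epow m p)"
        by (simp only: mult_ac)
      ultimately show ?thesis by simp
    qed
    finally have "epow (F / m) (p - 1) * (epow m p * W) \<le> ennreal K * (G / W) * (epow m p * W)" .
    then have "epow m p * W * epow (F / m) (p - 1) \<le> epow m p * W * (ennreal K * (G / W))"
      by (simp only: mult.commute)
    moreover have "epow m p * W \<noteq> 0" "epow m p * W \<noteq> top"
      using mp0 W by (auto simp: ennreal_mult_eq_top_iff)
    ultimately have "epow (F / m) (p - 1) \<le> ennreal K * (G / W)"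
      by (simp only: ennreal_mult_le_mult_iff not_False_eq_True)
    also have "\<dots> \<le> ennreal K * maxfun w g x"
      using maxfun_ge[OF l x, of g w] by (intro mult_left_mono) (auto simp: G_def W_def)
    finally show ?thesis
      using p by (simp add: epow_le_iff mass_const F_def m_def)
  qed
  then have "HL f x \<le> epow (ennreal K * maxfun w g x) (1 / (p - 1))"
    by (rule maxfun_le)
  then show ?thesis using p by (simp add: epow_le_iff)
qed

text \<open>The pointwise bound is raised to the power p'; strong type is then used for the measure
  w with exponent p' and for the dual measure with exponent p. Both are doubling, with factors that
  depend only on K, p and the dimension.\<close>

lemma Muckenhoupt_maximal:
  assumes p: "1 < p" and K: "0 \<le> K"
  shows "\<exists>B\<ge>0. \<forall>(w :: real ^ 'n \<Rightarrow> ennreal) f. apw p K w \<longrightarrow> f \<in> borel_measurable lebesgue \<longrightarrow>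
     pint p w (HL f) \<le> ennreal B * pint p w f"
proof -
  let ?p' = "conj_exponent p"
  have p': "1 < ?p'" using p by (rule conj_exponent_gt_1)
  have pp': "(p - 1) * ?p' = p" using p by (simp add: conj_exponent_def)
  define K' where "K' = K powr (?p' - 1)"
  define Dw where "Dw = K * (3 ^ CARD('n)) powr p"
  define Ds where "Ds = K' * (3 ^ CARD('n)) powr ?p'"
  define B1 where "B1 = 2 powr ?p' * Dw * ?p' / (?p' - 1)"
  define B2 where "B2 = 2 powr p * Ds * p / (p - 1)"
  have K': "0 \<le> K'" by (simp add: K'_def)
  have B: "0 \<le> B1" "0 \<le> B2" using p p' K K' by (auto simp: B1_def B2_def Dw_def Ds_def)
  have "pint p w (HL f) \<le> ennreal (K powr ?p' * B1 * B2) * pint p w f"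
    if w: "apw p K w" and f[measurable]: "f \<in> borel_measurable lebesgue" for w f :: "real ^ 'n \<Rightarrow> ennreal"
  proof -
    note [measurable] = apw_measurable[OF w]
    let ?\<sigma> = "dual_weight p w"
    let ?h = "\<lambda>y. f y / ?\<sigma> y"
    let ?g = "\<lambda>y. epow (maxfun ?\<sigma> ?h y) (p - 1) / w y"
    have \<sigma>: "apw ?p' K' ?\<sigma>" unfolding K'_def by (rule apw_dual[OF p w])
    have "pint p w (HL f) \<le> (\<integral>\<^sup>+x. epow (ennreal K) ?p' * (epow (maxfun w ?g x) ?p' * w x) \<partial>lebesgue)"
    proof (intro nn_integral_mono)
      fix x
      have "epow (HL f x) p = epow (epow (HL f x) (p - 1)) ?p'" by (simp add: epow_epow pp')
      also have "\<dots> \<le> epow (ennreal K * maxfun w ?g x) ?p'"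
        using p' by (intro epow_mono HL_le_weighted p w f) auto
      also have "\<dots> = epow (ennreal K) ?p' * epow (maxfun w ?g x) ?p'" using p' by (intro epow_mult) auto
      finally show "epow (HL f x) p * w x \<le> epow (ennreal K) ?p' * (epow (maxfun w ?g x) ?p' * w x)"
        by (simp add: mult.assoc[symmetric] mult_right_mono)
    qed
    also have "\<dots> = epow (ennreal K) ?p' * pint ?p' w (maxfun w ?g)"
      by (rule nn_integral_cmult) measurable
    also have "\<dots> \<le> epow (ennreal K) ?p' * (ennreal B1 * pint ?p' w ?g)"
      unfolding B1_def Dw_def
      by (intro mult_left_mono maxfun_strong_type p' apw_doubling p K w) auto
    \<comment> \<open>The identities (p - 1) p' = p and 1 - p' = - 1 / (p - 1) convert w into its
      dual.\<close>
    also have "pint ?p' w ?g = pint p ?\<sigma> (maxfun ?\<sigma> ?h)"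
    proof (rule nn_integral_cong_AE)
      show "AE x in lebesgue. epow (?g x) ?p' * w x = epow (maxfun ?\<sigma> ?h x) p * ?\<sigma> x"
        using apw_AE[OF w]
      proof eventually_elim
        case (elim x)
        have "epow (?g x) ?p' = epow (maxfun ?\<sigma> ?h x) p / epow (w x) ?p'"
          using elim by (auto simp: epow_divide epow_epow pp')
        then have "epow (?g x) ?p' * w x = epow (maxfun ?\<sigma> ?h x) p * (inverse (epow (w x) ?p') * w x)"
          by (simp only: divide_ennreal_def mult.assoc)
        also have "inverse (epow (w x) ?p') * w x = epow (w x) (- ?p' + 1)"
          using elim by (subst epow_add_pos) (auto simp: epow_minus)
        also have "- ?p' + 1 = - 1 / (p - 1)" using p by (simp add: conj_exponent_def field_simps)
        finally show ?case by (simp only: dual_weight_def[of p w x])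
      qed
    qed
    also have "\<dots> \<le> ennreal B2 * pint p ?\<sigma> ?h"
      unfolding B2_def Ds_def
      by (intro maxfun_strong_type p apw_doubling p' K' \<sigma>) auto
    \<comment> \<open>The power 1 - p of the dual weight is w again.\<close>
    also have "pint p ?\<sigma> ?h = pint p w f"
    proof (rule nn_integral_cong_AE)
      show "AE x in lebesgue. epow (?h x) p * ?\<sigma> x = epow (f x) p * w x"
        using apw_AE[OF \<sigma>] 
      proof eventually_elim
        case (elim x)
        have "epow (?h x) p = epow (f x) p / epow (?\<sigma> x) p"
          using elim by (auto simp: epow_divide)
        then have "epow (?h x) p * ?\<sigma> x = epow (f x) p * (inverse (epow (?\<sigma> x) p) * ?\<sigma> x)"
          by (simp only: divide_ennreal_def mult.assoc)
        also have "inverse (epow (?\<sigma> x) p) * ?\<sigma> x = epow (?\<sigma> x) (- p + 1)"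
          using elim by (subst epow_add_pos) (auto simp: epow_minus)
        also have "\<dots> = w x"
        proof -
          have "- 1 / (p - 1) * (- p + 1) = 1" using p by (simp add: field_simps)
          then show ?thesis by (simp only: dual_weight_def epow_epow epow_exp_1)
        qed
        finally show ?case .
      qed
    qed
    finally have "pint p w (HL f) \<le> epow (ennreal K) ?p' * (ennreal B1 * (ennreal B2 * pint p w f))"
      by (simp add: mult_left_mono)
    also have "epow (ennreal K) ?p' = ennreal (K powr ?p')"
      using K p' by (cases "K = 0") auto
    also have "ennreal (K powr ?p') * (ennreal B1 * (ennreal B2 * pint p w f))
        = ennreal (K powr ?p' * B1 * B2) * pint p w f"
      using B by (simp add: ennreal_mult mult.assoc)
    finally show ?thesis .
  qed
  then show ?thesis using B by (intro exI[of _ "K powr ?p' * B1 * B2"]) auto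
qed

subsection \<open>The Rubio de Francia algorithm\<close>

text \<open>Averages are countably additive in the function, and each summand is bounded by its own
  maximal function.\<close>

lemma HL_suminf_le:
  assumes [measurable]: "\<And>k. f k \<in> borel_measurable lebesgue"
  shows "HL (\<lambda>y. \<Sum>k. c k * f k y) x \<le> (\<Sum>k. c k * HL (f k) x)"
proof (rule maxfun_le)
  fix a l assume l: "0 < l" "x \<in> ocube a l"
  have "mass (\<lambda>y. (\<Sum>k. c k * f k y) * 1) (cube a l) = (\<Sum>k. c k * mass (f k) (cube a l))"
    by (simp add: mass_suminf mass_cmult)
  then have "mass (\<lambda>y. (\<Sum>k. c k * f k y) * 1) (cube a l) / mass (\<lambda>_. 1) (cube a l) =
      (\<Sum>k. c k * (mass (f k) (cube a l) / mass (\<lambda>_. 1) (cube a l)))"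
    by (simp add: ennreal_times_divide)
  also have "\<dots> \<le> (\<Sum>k. c k * HL (f k) x)"
    using maxfun_ge[OF l, of "f k" "\<lambda>_. 1" for k]
    by (intro suminf_le mult_left_mono) auto
  finally show "mass (\<lambda>y. (\<Sum>k. c k * f k y) * 1) (cube a l) / mass (\<lambda>_. 1) (cube a l) \<le> (\<Sum>k. c k * HL (f k) x)" .
qed

lemma suminf_half_ennreal: "(\<Sum>k. ennreal ((1/2) ^ Suc k)) = 1"
proof -
  have "(\<Sum>k. ennreal ((1/2) ^ Suc k)) = ennreal 1"
    by (rule suminf_ennreal_eq[OF _ power_half_series]) auto
  then show ?thesis by simp
qed

text \<open>The last condition is A_1 in maximal function form, demanded at every point. The factor
  2 stems from the leading coefficient 1/2 of the series that will serve as
  \<open>R\<close>.\<close>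

definition A1_majorant :: "real \<Rightarrow> real \<Rightarrow> (real ^ 'n \<Rightarrow> ennreal) \<Rightarrow> (real ^ 'n \<Rightarrow> ennreal) \<Rightarrow> (real ^ 'n \<Rightarrow> ennreal) \<Rightarrow> bool" where
  "A1_majorant p A w g R \<longleftrightarrow> R \<in> borel_measurable lebesgue \<and> (\<forall>x. g x \<le> 2 * R x) \<and>
     pint p w R \<le> pint p w g \<and> (\<forall>x. HL R x \<le> ennreal A * R x)"

lemma A1_majorant_mono: "A1_majorant p A w g R \<Longrightarrow> A \<le> B \<Longrightarrow> A1_majorant p B w g R"
  unfolding A1_majorant_def by (meson ennreal_leI mult_right_mono order_trans zero_le)

text \<open>\<open>R\<close> is the series of the iterates of the maximal operator on g with
  coefficients 2^(-k-1) * \<beta>^(-k). Applying the operator shifts the series by one index, at the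
  cost of the factor 2 * \<beta>.\<close>

lemma Rubio_de_Francia:
  assumes p: "1 < p" and K: "0 \<le> K"
  shows "\<exists>A>0. \<forall>(w :: real ^ 'n \<Rightarrow> ennreal) g. apw p K w \<longrightarrow> g \<in> borel_measurable lebesgue \<longrightarrow>
     (\<exists>R. A1_majorant p A w g R)"
proof -
  obtain B where B: "0 \<le> B" "\<And>(w :: real ^ 'n \<Rightarrow> ennreal) f. apw p K w \<Longrightarrow> f \<in> borel_measurable lebesgue \<Longrightarrow>
     pint p w (HL f) \<le> ennreal B * pint p w f"
    using Muckenhoupt_maximal[OF p K] by blast
  \<comment> \<open>At least 1, so that \<beta>^p dominates B: each iteration multiplies the p-th
    power of the norm by at most \<beta>^p, which the coefficients absorb.\<close>
  define \<beta> where "\<beta> = 1 + B"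
  have \<beta>: "1 \<le> \<beta>" "0 < \<beta>" using B(1) by (auto simp: \<beta>_def)
  have "\<beta> powr 1 \<le> \<beta> powr p" using \<beta> p by (intro powr_mono) auto
  then have B\<beta>: "B \<le> \<beta> powr p" using \<beta> by (simp add: \<beta>_def)
  have "\<exists>R. A1_majorant p (2 * \<beta>) w g R"
    if w: "apw p K w" and g[measurable]: "g \<in> borel_measurable lebesgue" for w g :: "real ^ 'n \<Rightarrow> ennreal"
  proof -
    note [measurable] = apw_measurable[OF w]
    let ?H = "\<lambda>k. (HL ^^ k) g"
    have H[measurable]: "?H k \<in> borel_measurable lebesgue" for k
      by (cases k) auto
    define c where "c k = ennreal ((1/2) ^ Suc k / \<beta> ^ k)" for k
    define R where "R x = (\<Sum>k. c k * ?H k x)" for x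
    have [measurable]: "R \<in> borel_measurable lebesgue" unfolding R_def by measurable
    have c_Suc: "c k = ennreal (2 * \<beta>) * c (Suc k)" for k
      using \<beta> by (simp add: c_def ennreal_mult[symmetric])
    have "g x \<le> 2 * R x" for x
    proof -
      have "c 0 * ?H 0 x \<le> R x"
        unfolding R_def using sum_le_suminf[of "\<lambda>k. c k * ?H k x" "{0}"] by simp
      then have *: "2 * (c 0 * g x) \<le> 2 * R x" by (intro mult_left_mono) auto
      have "2 * c 0 = ennreal 2 * ennreal (1/2)" by (simp add: c_def del: ennreal_half)
      moreover have "ennreal 2 * ennreal (1/2) = ennreal (2 * (1/2))" by (rule ennreal_mult[symmetric]) auto
      ultimately have "2 * c 0 = 1" by simp
      with * show ?thesis by (simp add: mult.assoc[symmetric])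
    qed
    moreover have "HL R x \<le> ennreal (2 * \<beta>) * R x" for x
    proof -
      have "HL R x \<le> (\<Sum>k. c k * HL (?H k) x)"
        unfolding R_def by (rule HL_suminf_le) measurable
      also have "\<dots> = ennreal (2 * \<beta>) * (\<Sum>k. c (Suc k) * ?H (Suc k) x)"
      proof -
        have "c k * HL (?H k) x = ennreal (2 * \<beta>) * (c (Suc k) * ?H (Suc k) x)" for k
          unfolding c_Suc[of k] by (simp add: mult.assoc)
        then show ?thesis by simp
      qed
      also have "\<dots> \<le> ennreal (2 * \<beta>) * R x"
      proof (rule mult_left_mono)
        show "(\<Sum>k. c (Suc k) * ?H (Suc k) x) \<le> R x"
          unfolding R_def suminf_offset[of "\<lambda>k. c k * ?H k x" 1, OF summableI] by simp
      qed simp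
      finally show ?thesis .
    qed
    moreover have "pint p w R \<le> pint p w g"
    proof -
      let ?I = "\<integral>\<^sup>+x. epow (g x) p * w x \<partial>lebesgue"
      have Hk: "pint p w (?H k) \<le> ennreal ((\<beta> powr p) ^ k) * ?I" for k
      proof (induction k)
        case (Suc k)
        have "pint p w (?H (Suc k)) \<le> ennreal B * pint p w (?H k)"
          using B(2)[OF w H] by simp
        also have "\<dots> \<le> ennreal (\<beta> powr p) * (ennreal ((\<beta> powr p) ^ k) * ?I)"
          by (intro mult_mono Suc ennreal_leI B\<beta>) auto
        finally show ?case by (simp add: mult.assoc[symmetric] ennreal_mult[symmetric])
      qed simp
      \<comment> \<open>The numbers 2^(-k-1) sum to one, so Jensen moves the p-th power inside the
        series.\<close>
      have "pint p w R
         \<le> (\<integral>\<^sup>+x. (\<Sum>k. ennreal ((1/2) ^ Suc k) * (ennreal (1 / (\<beta> powr p) ^ k) * (epow (?H k x) p * w x))) \<partial>lebesgue)"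
      proof (intro nn_integral_mono)
        fix x
        have "R x = (\<Sum>k. ennreal ((1/2) ^ Suc k) * (ennreal (1 / \<beta> ^ k) * ?H k x))"
          unfolding R_def c_def using \<beta>
          by (simp add: mult.assoc[symmetric] ennreal_mult[symmetric])
        then have "epow (R x) p \<le> (\<Sum>k. ennreal ((1/2) ^ Suc k) * epow (ennreal (1 / \<beta> ^ k) * ?H k x) p)"
          using epow_suminf_le[OF p, of "\<lambda>k. ennreal ((1/2) ^ Suc k)" "\<lambda>k. ennreal (1 / \<beta> ^ k) * ?H k x"]
            suminf_half_ennreal by simp
        also have "\<dots> = (\<Sum>k. ennreal ((1/2) ^ Suc k) * (ennreal (1 / (\<beta> powr p) ^ k) * epow (?H k x) p))"
        proof -
          have "epow (ennreal (1 / \<beta> ^ k)) p = ennreal (1 / (\<beta> powr p) ^ k)" for k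
            using \<beta> by (simp add: powr_divide powr_realpow[symmetric] powr_powr mult.commute)
          then show ?thesis using p by (simp add: epow_mult)
        qed
        finally have "epow (R x) p * w x \<le> (\<Sum>k. ennreal ((1/2) ^ Suc k) * (ennreal (1 / (\<beta> powr p) ^ k) * epow (?H k x) p)) * w x"
          by (rule mult_right_mono) auto
        then show "epow (R x) p * w x \<le> (\<Sum>k. ennreal ((1/2) ^ Suc k) * (ennreal (1 / (\<beta> powr p) ^ k) * (epow (?H k x) p * w x)))"
          by (simp only: ennreal_suminf_multc[symmetric] mult.assoc)
      qed
      also have "\<dots> = (\<Sum>k. ennreal ((1/2) ^ Suc k) * (ennreal (1 / (\<beta> powr p) ^ k) * pint p w (?H k)))"
        by (subst nn_integral_suminf) (auto simp: nn_integral_cmult)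
      also have "\<dots> \<le> (\<Sum>k. ennreal ((1/2) ^ Suc k) * ?I)"
      proof (intro suminf_le mult_left_mono)
        fix k
        have "ennreal (1 / (\<beta> powr p) ^ k) * pint p w (?H k)
            \<le> ennreal (1 / (\<beta> powr p) ^ k) * (ennreal ((\<beta> powr p) ^ k) * ?I)"
          by (intro mult_left_mono Hk) auto
        also have "\<dots> = ?I" using \<beta> by (simp add: mult.assoc[symmetric] ennreal_mult[symmetric])
        finally show "ennreal (1 / (\<beta> powr p) ^ k) * pint p w (?H k) \<le> ?I" .
      qed auto
      also have "\<dots> = ?I" by (simp only: ennreal_suminf_multc suminf_half_ennreal mult_1)
      finally show ?thesis .
    qed
    ultimately show ?thesis by (intro exI[of _ R]) (auto simp: A1_majorant_def)
  qed
  then show ?thesis using \<beta> by (intro exI[of _ "2 * \<beta>"]) auto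
qed

subsection \<open>Averages and weights\<close>

lemma avg_mono_AE:
  "(AE x in lebesgue. x \<in> Q \<longrightarrow> f x \<le> g x) \<Longrightarrow> avg f Q \<le> avg g Q"
  unfolding avg_def by (intro divide_right_mono_ennreal mass_mono_AE)

lemma avg_cmult:
  "f \<in> borel_measurable lebesgue \<Longrightarrow> Q \<in> sets lebesgue \<Longrightarrow> avg (\<lambda>x. c * f x) Q = c * avg f Q"
  unfolding avg_def by (simp add: mass_cmult ennreal_times_divide)

lemma avg_const: "Q \<in> cubes \<Longrightarrow> avg (\<lambda>x. c) Q = c"
  unfolding avg_def
  by (simp add: mass_const ennreal_mult_divide_eq emeasure_cubes_pos[THEN less_imp_neq, symmetric]
      emeasure_cubes_finite[THEN less_imp_neq])

lemma mass_eq_avg: "Q \<in> cubes \<Longrightarrow> mass f Q = avg f Q * emeasure lebesgue Q"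
  using emeasure_cubes_pos[of Q] emeasure_cubes_finite[of Q]
  by (simp add: avg_def ennreal_divide_times)

lemma avg_finite_iff: "Q \<in> cubes \<Longrightarrow> avg f Q < top \<longleftrightarrow> mass f Q < top"
  using emeasure_cubes_pos[of Q] emeasure_cubes_finite[of Q]
  by (auto simp: avg_def less_top[symmetric] ennreal_divide_eq_top_iff)

lemma weightI:
  fixes u :: "real ^ 'n \<Rightarrow> real"
  assumes [measurable]: "u \<in> borel_measurable lebesgue" and nn: "\<And>x. 0 \<le> u x"
    and fin: "\<And>Q. Q \<in> cubes \<Longrightarrow> mass u Q < top"
  shows "weight u"
  unfolding weight_def
proof (intro conjI allI impI)
  fix k :: "(real ^ 'n) set" assume k: "compact k"
  obtain a l where al: "0 < l" "k \<subseteq> cube a l"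
    using bounded_subset_cube[OF compact_imp_bounded[OF k]] by blast
  have [measurable]: "k \<in> sets lebesgue" using k by (simp add: compact_imp_closed)
  have "(\<integral>\<^sup>+x. ennreal (indicator k x *\<^sub>R u x) \<partial>lebesgue) \<le> mass u (cube a l)"
    unfolding mass_def using al(2) nn by (intro nn_integral_mono) (auto split: split_indicator)
  also have "\<dots> < top" using al by (intro fin) auto
  finally show "set_integrable lebesgue k u"
    unfolding set_integrable_def using nn by (intro integrableI_nonneg) auto
qed (use assms in auto)

lemma weight_mass_finite:
  assumes "weight u" "Q \<in> cubes"
  shows "mass u Q < top"
proof -
  have "compact Q" using assms(2) by (auto elim!: cubesE simp: cube_def)
  then have "set_integrable lebesgue Q u" using assms(1) by (auto simp: weight_def)
  then have "(\<integral>\<^sup>+x. ennreal (norm (indicator Q x *\<^sub>R u x)) \<partial>lebesgue) < \<infinity>"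
    by (simp add: set_integrable_def integrable_iff_bounded)
  moreover have "(\<integral>\<^sup>+x. ennreal (norm (indicator Q x *\<^sub>R u x)) \<partial>lebesgue) = mass u Q"
    unfolding mass_def using assms(1)
    by (intro nn_integral_cong) (auto simp: weight_def split: split_indicator)
  ultimately show ?thesis by simp
qed

lemma one_muckenhoupt:
  assumes "1 \<le> s"
  shows "(\<lambda>x :: real ^ 'n. 1) \<in> muckenhoupt s" "Ap_const s (\<lambda>x :: real ^ 'n. 1) \<le> 1"
proof -
  show *: "Ap_const s (\<lambda>x :: real ^ 'n. 1) \<le> 1"
  proof (cases "s = 1")
    case True
    then show ?thesis
      unfolding Ap_const_def
      by (auto simp: avg_const intro!: Inf_lower exI[of _ 1])
  qed (auto simp: Ap_const_def avg_const SUP_le_iff)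
  have "weight (\<lambda>x :: real ^ 'n. 1)"
    by (rule weightI) (auto simp: mass_const emeasure_cubes_finite)
  then show "(\<lambda>x :: real ^ 'n. 1) \<in> muckenhoupt s"
    using * by (auto simp: muckenhoupt_def intro: le_less_trans)
qed

subsection \<open>Products of \<open>A\<^sub>1\<close> weights\<close>

text \<open>A zero x of V would force the maximal function to vanish at x, hence V to have integral
  0 over every cube around x, and these cubes exhaust the space.\<close>

lemma HL_bound_pos:
  fixes V :: "real ^ 'n \<Rightarrow> ennreal"
  assumes V: "\<And>x. HL V x \<le> ennreal A * V x" and [measurable]: "V \<in> borel_measurable lebesgue"
    and nz: "\<not> (AE x in lebesgue. V x = 0)"
  shows "0 < V x"
proof (rule ccontr)
  assume "\<not> 0 < V x"
  then have "HL V x = 0" using V[of x] by simp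
  have "AE y in lebesgue. y \<in> cube (\<chi> i. x $ i - real (Suc k)) (2 * real (Suc k)) \<longrightarrow> V y = 0" for k
  proof -
    let ?Q = "cube (\<chi> i. x $ i - real (Suc k)) (2 * real (Suc k))"
    have "mass V ?Q \<le> HL V x * emeasure lebesgue ?Q"
      by (rule HL_ge) (auto simp: mem_ocube)
    then have "mass V ?Q = 0" by (simp add: \<open>HL V x = 0\<close>)
    then have "AE y in lebesgue. V y * indicator ?Q y = 0"
      unfolding mass_def by (subst (asm) nn_integral_0_iff_AE) auto
    then show ?thesis by eventually_elim (auto split: split_indicator_asm)
  qed
  then have "AE y in lebesgue. \<forall>k. y \<in> cube (\<chi> i. x $ i - real (Suc k)) (2 * real (Suc k)) \<longrightarrow> V y = 0"
    unfolding AE_all_countable by blast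
  then have "AE y in lebesgue. V y = 0"
  proof eventually_elim
    case (elim y)
    obtain k where k: "norm (y - x) \<le> real k" using real_arch_simple by blast
    have "\<bar>y $ i - x $ i\<bar> \<le> real k" for i
      using component_le_norm_cart[of "y - x" i] k by simp
    then have "y \<in> cube (\<chi> i. x $ i - real (Suc k)) (2 * real (Suc k))"
      unfolding mem_cube by (simp add: abs_le_iff) (smt (verit))
    with elim show ?case by blast
  qed
  with nz show False by simp
qed

lemma HL_bound_avg:
  fixes V :: "real ^ 'n \<Rightarrow> ennreal"
  assumes V: "\<And>x. HL V x \<le> ennreal A * V x" and [measurable]: "V \<in> borel_measurable lebesgue"
    and nz: "\<not> (AE x in lebesgue. V x = 0)" and fin: "AE x in lebesgue. V x < top" and Q: "Q \<in> cubes"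
  shows "AE x in lebesgue. x \<in> Q \<longrightarrow> avg V Q \<le> ennreal A * V x"
    and "0 < avg V Q" and "avg V Q < top"
proof -
  obtain a l where al: "0 < l" "Q = cube a l" using Q by (rule cubesE)
  have m: "0 < emeasure lebesgue Q" "emeasure lebesgue Q < top"
    using Q by (auto simp: emeasure_cubes_pos emeasure_cubes_finite)
  have *: "avg V Q \<le> ennreal A * V x" if "x \<in> ocube a l" for x
  proof -
    have "avg V Q \<le> HL V x"
      using maxfun_ge[OF al(1) that, of V "\<lambda>_. 1"] by (simp add: avg_def al(2) mass_const)
    also have "\<dots> \<le> ennreal A * V x" by (rule V)
    finally show ?thesis .
  qed
  show "AE x in lebesgue. x \<in> Q \<longrightarrow> avg V Q \<le> ennreal A * V x"
    using AE_cube_ocube[of a l] unfolding al(2)[symmetric]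
    by eventually_elim (auto intro: *)
  have "0 < mass V Q"
    using HL_bound_pos[OF V _ nz] by (intro mass_pos Q) auto
  then show "0 < avg V Q" using m by (simp add: avg_def ennreal_zero_less_divide)
  \<comment> \<open>An infinite average would force V to be infinite almost everywhere on Q.\<close>
  show "avg V Q < top"
  proof (rule ccontr)
    assume "\<not> avg V Q < top"
    then have "avg V Q = top" by (simp add: less_top[symmetric])
    then have notin: "x \<notin> Q" if "V x < top" "x \<in> Q \<longrightarrow> x \<in> ocube a l" for x
      using *[of x] that by (auto simp: top_unique ennreal_mult_eq_top_iff)
    have "AE x in lebesgue. x \<notin> Q"
      using fin AE_cube_ocube[of a l] unfolding al(2)[symmetric] by eventually_elim (rule notin)
    then have "Q \<in> null_sets lebesgue" using Q by (simp add: AE_iff_null_sets)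
    then show False using m by auto
  qed
qed

text \<open>The elementary half of the Jones factorisation. On a cube each factor is at least its
  average divided by A; this is used where the factor carries a negative power, for
  \<open>V1\<close> in u and for \<open>V2\<close> in the dual of u, and the averages cancel. The
  losses A^(s-1) and A multiply to A^s. For s = 1 only \<open>V2\<close> remains.\<close>

lemma A1_product:
  fixes V1 V2 :: "real ^ 'n \<Rightarrow> ennreal"
  assumes s: "1 \<le> s" and A: "0 < A"
    and V1: "\<And>x. HL V1 x \<le> ennreal A * V1 x" and m1 [measurable]: "V1 \<in> borel_measurable lebesgue"
    and nz1: "\<not> (AE x in lebesgue. V1 x = 0)" and fin1: "AE x in lebesgue. V1 x < top"
    and V2: "\<And>x. HL V2 x \<le> ennreal A * V2 x" and m2 [measurable]: "V2 \<in> borel_measurable lebesgue"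
    and nz2: "\<not> (AE x in lebesgue. V2 x = 0)" and fin2: "AE x in lebesgue. V2 x < top"
  defines "u \<equiv> \<lambda>x. enn2real (epow (V1 x) (1 - s) * V2 x)"
  shows "u \<in> muckenhoupt s" "Ap_const s u \<le> ennreal (A powr s)"
    "AE x in lebesgue. ennreal (u x) = epow (V1 x) (1 - s) * V2 x"
proof -
  note pos1 = HL_bound_pos[OF V1 m1 nz1] and pos2 = HL_bound_pos[OF V2 m2 nz2]
  have [measurable]: "u \<in> borel_measurable lebesgue" unfolding u_def by measurable
  show ueq: "AE x in lebesgue. ennreal (u x) = epow (V1 x) (1 - s) * V2 x"
    using fin1 fin2
  proof eventually_elim
    case (elim x)
    then show ?case
      using epow_finite[OF pos1 elim(1), of "1 - s"] by (simp add: u_def ennreal_mult_less_top)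
  qed
  have upos: "AE x in lebesgue. 0 < u x"
    using fin1 fin2 ueq
  proof eventually_elim
    case (elim x)
    have "0 < ennreal (u x)"
      unfolding elim(3) using epow_pos[OF pos1 elim(1)] pos2 by (simp add: ennreal_zero_less_mult_iff)
    then show ?case by simp
  qed
  have avg_u: "avg u Q \<le> epow (avg V1 Q / ennreal A) (1 - s) * avg V2 Q" if Q: "Q \<in> cubes" for Q
  proof -
    have "avg u Q \<le> avg (\<lambda>x. epow (avg V1 Q / ennreal A) (1 - s) * V2 x) Q"
    proof (rule avg_mono_AE)
      show "AE x in lebesgue. x \<in> Q \<longrightarrow> ennreal (u x) \<le> epow (avg V1 Q / ennreal A) (1 - s) * V2 x"
        using ueq HL_bound_avg(1)[OF V1 m1 nz1 fin1 Q]
      proof eventually_elim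
        case (elim x)
        show ?case
        proof
          assume "x \<in> Q"
          with elim have "avg V1 Q \<le> ennreal A * V1 x" by simp
          then have "avg V1 Q / ennreal A \<le> V1 x"
            using A by (intro divide_le_posI_ennreal) (auto simp: mult.commute)
          then show "ennreal (u x) \<le> epow (avg V1 Q / ennreal A) (1 - s) * V2 x"
            unfolding elim(1) using s by (intro mult_right_mono epow_antimono) auto
        qed
      qed
    qed
    also have "\<dots> = epow (avg V1 Q / ennreal A) (1 - s) * avg V2 Q"
      using Q by (intro avg_cmult) auto
    finally show ?thesis .
  qed
  have weight: "weight u"
  proof (rule weightI)
    fix Q :: "(real ^ 'n) set" assume Q: "Q \<in> cubes"
    have "0 < avg V1 Q / ennreal A" "avg V1 Q / ennreal A < top"
      using HL_bound_avg(2,3)[OF V1 m1 nz1 fin1 Q] A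
      by (auto simp: ennreal_zero_less_divide less_top[symmetric] ennreal_divide_eq_top_iff)
    then have "epow (avg V1 Q / ennreal A) (1 - s) * avg V2 Q < top"
      using HL_bound_avg(3)[OF V2 m2 nz2 fin2 Q] by (simp add: ennreal_mult_less_top epow_finite)
    with avg_u[OF Q] have "avg u Q < top" by (rule le_less_trans)
    then show "mass u Q < top" using Q by (simp add: avg_finite_iff)
  qed (auto simp: u_def)
  show Ap: "Ap_const s u \<le> ennreal (A powr s)"
  proof (cases "s = 1")
    case True
    have "\<forall>Q\<in>cubes. AE x in lebesgue. x \<in> Q \<longrightarrow> avg u Q \<le> ennreal A * ennreal (u x)"
    proof
      fix Q :: "(real ^ 'n) set" assume Q: "Q \<in> cubes"
      have *: "avg u Q \<le> avg V2 Q" using avg_u[OF Q] True by simp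
      show "AE x in lebesgue. x \<in> Q \<longrightarrow> avg u Q \<le> ennreal A * ennreal (u x)"
        using ueq HL_bound_avg(1)[OF V2 m2 nz2 fin2 Q]
      proof eventually_elim
        case (elim x)
        then show ?case using * True by (auto intro: order_trans)
      qed
    qed
    then show ?thesis using True A by (auto simp: Ap_const_def intro!: Inf_lower exI[of _ A])
  next
    case False
    with s have s1: "1 < s" by simp
    let ?e = "1 - conj_exponent s"
    have e: "?e = - 1 / (s - 1)" using s1 by (simp add: conj_exponent_def field_simps)
    have e': "(1 - s) * ?e = 1" "?e * (s - 1) = -1" "?e \<le> 0" using s1 by (simp_all add: e field_simps)
    have "avg u Q * epow (avg (\<lambda>x. epow (u x) ?e) Q) (s - 1) \<le> ennreal (A powr s)" if Q: "Q \<in> cubes" for Q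
    proof -
      obtain a where a: "0 < a" "avg V1 Q = ennreal a"
        using HL_bound_avg(2,3)[OF V1 m1 nz1 fin1 Q] by (cases "avg V1 Q" rule: ennreal_pos_cases) auto
      obtain b where b: "0 < b" "avg V2 Q = ennreal b"
        using HL_bound_avg(2,3)[OF V2 m2 nz2 fin2 Q] by (cases "avg V2 Q" rule: ennreal_pos_cases) auto
      have "avg (\<lambda>x. epow (u x) ?e) Q \<le> avg (\<lambda>x. epow (avg V2 Q / ennreal A) ?e * V1 x) Q"
      proof (rule avg_mono_AE)
        show "AE x in lebesgue. x \<in> Q \<longrightarrow> epow (ennreal (u x)) ?e \<le> epow (avg V2 Q / ennreal A) ?e * V1 x"
          using ueq HL_bound_avg(1)[OF V2 m2 nz2 fin2 Q] fin1
        proof eventually_elim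
          case (elim x)
          show ?case
          proof
            assume "x \<in> Q"
            with elim have "avg V2 Q \<le> ennreal A * V2 x" by simp
            then have *: "avg V2 Q / ennreal A \<le> V2 x"
              using A by (intro divide_le_posI_ennreal) (auto simp: mult.commute)
            \<comment> \<open>In the dual power the roles are exchanged: \<open>V1\<close> has
              exponent 1 and \<open>V2\<close> the negative exponent 1 - s'.\<close>
            have "epow (ennreal (u x)) ?e = V1 x * epow (V2 x) ?e"
              unfolding elim(1) using epow_pos[OF pos1 elim(3)] epow_finite[OF pos1 elim(3)]
              by (simp only: epow_mult_pos epow_epow e' epow_exp_1)
            also have "\<dots> \<le> V1 x * epow (avg V2 Q / ennreal A) ?e"
              using * e' by (intro mult_left_mono epow_antimono) auto
            finally show "epow (ennreal (u x)) ?e \<le> epow (avg V2 Q / ennreal A) ?e * V1 x"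
              by (simp only: mult.commute)
          qed
        qed
      qed
      also have "\<dots> = epow (avg V2 Q / ennreal A) ?e * avg V1 Q"
        using Q by (intro avg_cmult) auto
      also have "\<dots> = ennreal ((b / A) powr ?e * a)"
        using a b A by (simp add: divide_ennreal ennreal_mult)
      finally have "epow (avg (\<lambda>x. epow (u x) ?e) Q) (s - 1) \<le> epow (ennreal ((b / A) powr ?e * a)) (s - 1)"
        using s1 by (intro epow_mono) auto
      also have "\<dots> = ennreal (A / b * a powr (s - 1))"
        using a b A by (simp add: powr_mult powr_powr e' powr_minus_divide)
      finally have 2: "epow (avg (\<lambda>x. epow (u x) ?e) Q) (s - 1) \<le> ennreal (A / b * a powr (s - 1))" .
      have 1: "avg u Q \<le> ennreal ((a / A) powr (1 - s) * b)"
        using avg_u[OF Q] a b A by (simp add: divide_ennreal ennreal_mult)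
      have "avg u Q * epow (avg (\<lambda>x. epow (u x) ?e) Q) (s - 1) \<le>
          ennreal ((a / A) powr (1 - s) * b) * ennreal (A / b * a powr (s - 1))"
        by (rule mult_mono[OF 1 2]) auto
      also have "\<dots> = ennreal (A powr s)"
      proof -
        have "(a / A) powr (1 - s) * b * (A / b * a powr (s - 1)) =
            (a powr (1 - s) * a powr (s - 1)) * (A / A powr (1 - s))"
          using a b A by (simp add: powr_divide field_simps)
        also have "a powr (1 - s) * a powr (s - 1) = 1" using a by (simp add: powr_add[symmetric])
        also have "A / A powr (1 - s) = A powr s"
          using A powr_diff[of A 1 "1 - s"] by simp
        finally show ?thesis using a b A by (simp add: ennreal_mult[symmetric])
      qed
      finally show ?thesis .
    qed
    then show ?thesis using False by (auto simp: Ap_const_def SUP_le_iff)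
  qed
  show "u \<in> muckenhoupt s"
    using weight upos le_less_trans[OF Ap ennreal_less_top] by (simp add: muckenhoupt_def)
qed

subsection \<open>Extrapolation\<close>

lemma AE_finite_of_weighted_norm:
  assumes w: "apw p K w" and p: "1 < p" and [measurable]: "R \<in> borel_measurable lebesgue"
    and fin: "pint p w R < top"
  shows "AE x in lebesgue. R x < top"
proof -
  note [measurable] = apw_measurable[OF w]
  have "AE x in lebesgue. epow (R x) p * w x \<noteq> \<infinity>"
    using fin by (intro nn_integral_PInf_AE) auto
  then show ?thesis
    using apw_AE[OF w]
  proof eventually_elim
    case (elim x)
    then show ?case using p by (cases "R x = top") (auto simp: less_top)
  qed
qed

lemma weighted_norm_eq_0_iff:
  assumes w: "apw p K w" and p: "1 < p" and [measurable]: "R \<in> borel_measurable lebesgue"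
  shows "pint p w R = 0 \<longleftrightarrow> (AE x in lebesgue. R x = 0)"
proof -
  note [measurable] = apw_measurable[OF w]
  have "pint p w R = 0 \<longleftrightarrow> (AE x in lebesgue. epow (R x) p * w x = 0)"
    by (rule nn_integral_0_iff_AE) measurable
  also have "\<dots> \<longleftrightarrow> (AE x in lebesgue. R x = 0)"
  proof (rule iffI)
    assume "AE x in lebesgue. epow (R x) p * w x = 0"
    then show "AE x in lebesgue. R x = 0"
      using apw_AE[OF w] by eventually_elim (use p in \<open>auto simp: epow_eq_0_iff\<close>)
  next
    assume "AE x in lebesgue. R x = 0"
    then show "AE x in lebesgue. epow (R x) p * w x = 0"
      by eventually_elim (use p in auto)
  qed
  finally show ?thesis .
qed

text \<open>The pairing is taken in Lebesgue measure; this is why the dual space carries the dual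
  weight.\<close>

lemma Hoelder_dual_weight:
  assumes w: "apw s K w" and s: "1 < s"
    and [measurable]: "R \<in> borel_measurable lebesgue" "V \<in> borel_measurable lebesgue"
  shows "(\<integral>\<^sup>+x. R x * V x \<partial>lebesgue) \<le> epow (pint s w R) (1/s) *
     epow (pint (conj_exponent s) (dual_weight s w) V) (1 - 1/s)"
proof -
  note [measurable] = apw_measurable[OF w]
  have s': "conj_exponent s * (1 - 1/s) = 1" using s by (simp add: conj_exponent_def field_simps)
  have "(\<integral>\<^sup>+x. R x * V x \<partial>lebesgue) =
     (\<integral>\<^sup>+x. epow (epow (R x) s * w x) (1/s) * epow (epow (V x) (conj_exponent s) * dual_weight s w x) (1 - 1/s) \<partial>lebesgue)"
  proof (rule nn_integral_cong_AE)
    show "AE x in lebesgue. R x * V x = epow (epow (R x) s * w x) (1/s) * epow (epow (V x) (conj_exponent s) * dual_weight s w x) (1 - 1/s)"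
      using apw_AE[OF w]
    proof eventually_elim
      case (elim x)
      have "epow (epow (R x) s * w x) (1/s) * epow (epow (V x) (conj_exponent s) * dual_weight s w x) (1 - 1/s)
         = (R x * epow (w x) (1/s)) * (V x * epow (dual_weight s w x) (1 - 1/s))"
        using s s' by (simp add: epow_mult epow_epow)
      also have "\<dots> = R x * V x * (epow (w x) (1/s) * epow (dual_weight s w x) (1 - 1/s))"
        by (simp only: mult_ac)
      finally show ?case using dual_weight_cancel[OF s, of w x] elim by simp
    qed
  qed
  also have "\<dots> \<le> epow (pint s w R) (1/s) *
     epow (pint (conj_exponent s) (dual_weight s w) V) (1 - 1/s)"
    using s by (intro Hoelder_nn_integral) auto
  finally show ?thesis .
qed

text \<open>The outcome of one weight construction: u does not depend on F, the norm of G in L_s(u)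
  is controlled by N, and every F pairs with the test function H as its norm in L_s(u)
  allows.\<close>

definition extrapolates :: "real \<Rightarrow> real \<Rightarrow> real \<Rightarrow> (real ^ 'n \<Rightarrow> ennreal) \<Rightarrow> ennreal \<Rightarrow> (real ^ 'n \<Rightarrow> ennreal) \<Rightarrow> bool" where
  "extrapolates s A B G N H \<longleftrightarrow> (\<exists>u\<in>muckenhoupt s. Ap_const s u \<le> ennreal A \<and>
     pint s u G \<le> ennreal B * N \<and> (\<forall>F\<in>borel_measurable lebesgue.
       (\<integral>\<^sup>+x. F x * H x \<partial>lebesgue) \<le> 2 * (epow (pint s u F) (1/s) * epow N (1 - 1/s))))"

text \<open>Let R majorise G for w and V majorise H for the dual weight. The weight u = R^(1 - s0) *
  V satisfies R^s0 * u = R * V, and for s0 > 1 the product F * V splits into (F^s0 * u)^(1/s0) and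
  (R * V)^(1 - 1/s0). The same weight covers s < s0 and s \<ge> s0.\<close>

lemma extrapolation_weight:
  assumes s0: "1 \<le> s0" and s: "1 < s" and K: "0 \<le> K"
  shows "\<exists>A\<ge>0. \<forall>(w :: real ^ 'n \<Rightarrow> ennreal) G H. apw s K w \<longrightarrow>
     G \<in> borel_measurable lebesgue \<longrightarrow> H \<in> borel_measurable lebesgue \<longrightarrow> pint s w G \<in> {0<..<top} \<longrightarrow>
     pint (conj_exponent s) (dual_weight s w) H \<in> {0<..<top} \<longrightarrow>
     extrapolates s0 A (2 powr s0) G
       (epow (pint s w G) (1/s) * epow (pint (conj_exponent s) (dual_weight s w) H) (1 - 1/s)) H"
proof -
  let ?s' = "conj_exponent s"
  define K' where "K' = K powr (?s' - 1)"
  have K': "0 \<le> K'" by (simp add: K'_def)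
  have s': "1 < ?s'" using s by (rule conj_exponent_gt_1)
  obtain A1 where A1: "0 < A1" "\<And>(w :: real ^ 'n \<Rightarrow> ennreal) g. apw s K w \<Longrightarrow> g \<in> borel_measurable lebesgue \<Longrightarrow>
     (\<exists>R. A1_majorant s A1 w g R)"
    using Rubio_de_Francia[OF s K, where 'n='n] by blast
  obtain A2 where A2: "0 < A2" "\<And>(w :: real ^ 'n \<Rightarrow> ennreal) g. apw ?s' K' w \<Longrightarrow> g \<in> borel_measurable lebesgue \<Longrightarrow>
     (\<exists>R. A1_majorant ?s' A2 w g R)"
    using Rubio_de_Francia[OF s' K', where 'n='n] by blast
  define A where "A = max A1 A2"
  have A: "0 < A" using A1(1) by (simp add: A_def)
  have "extrapolates s0 (A powr s0) (2 powr s0) G (epow (pint s w G) (1/s) * epow (pint ?s' (dual_weight s w) H) (1 - 1/s)) H"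
    if w: "apw s K w" and mG [measurable]: "G \<in> borel_measurable lebesgue" and mH [measurable]: "H \<in> borel_measurable lebesgue"
      and G: "0 < pint s w G" "pint s w G < top"
      and H: "0 < pint ?s' (dual_weight s w) H" "pint ?s' (dual_weight s w) H < top"
    for w G H :: "real ^ 'n \<Rightarrow> ennreal"
  proof -
    note [measurable] = apw_measurable[OF w]
    let ?\<sigma> = "dual_weight s w"
    define N where "N = epow (pint s w G) (1/s) * epow (pint ?s' ?\<sigma> H) (1 - 1/s)"
    have \<sigma>: "apw ?s' K' ?\<sigma>" unfolding K'_def by (rule apw_dual[OF s w])
    obtain R V where "A1_majorant s A w G R" "A1_majorant ?s' A ?\<sigma> H V"
      using A1(2)[OF w mG] A2(2)[OF \<sigma> mH] A1_majorant_mono unfolding A_def by (metis max.cobounded1 max.cobounded2)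
    then have R [measurable]: "R \<in> borel_measurable lebesgue" and V [measurable]: "V \<in> borel_measurable lebesgue"
      and GR: "\<And>x. G x \<le> 2 * R x" and HV: "\<And>x. H x \<le> 2 * V x"
      and RG: "pint s w R \<le> pint s w G" and VH: "pint ?s' ?\<sigma> V \<le> pint ?s' ?\<sigma> H"
      and RA: "\<And>x. HL R x \<le> ennreal A * R x" and VA: "\<And>x. HL V x \<le> ennreal A * V x"
      by (auto simp: A1_majorant_def)
    have Rnz: "\<not> (AE x in lebesgue. R x = 0)"
    proof
      assume "AE x in lebesgue. R x = 0"
      then have "AE x in lebesgue. G x = 0"
        by eventually_elim (use GR in \<open>metis le_zero_eq mult_zero_right\<close>)
      then show False using G(1) weighted_norm_eq_0_iff[OF w s mG] by simp
    qed
    have Vnz: "\<not> (AE x in lebesgue. V x = 0)"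
    proof
      assume "AE x in lebesgue. V x = 0"
      then have "AE x in lebesgue. H x = 0"
        by eventually_elim (use HV in \<open>metis le_zero_eq mult_zero_right\<close>)
      then show False using H(1) weighted_norm_eq_0_iff[OF \<sigma> s' mH] by simp
    qed
    have Rfin: "AE x in lebesgue. R x < top"
      using RG G by (intro AE_finite_of_weighted_norm[OF w s R]) auto
    have Vfin: "AE x in lebesgue. V x < top"
      using VH H by (intro AE_finite_of_weighted_norm[OF \<sigma> s' V]) auto
    define u where "u = (\<lambda>x. enn2real (epow (R x) (1 - s0) * V x))"
    note u = A1_product(1,2)[OF s0 A RA R Rnz Rfin VA V Vnz Vfin, folded u_def]
    have u3: "AE x in lebesgue. ennreal (u x) = epow (R x) (1 - s0) * V x"
      unfolding u_def by (rule A1_product(3)[OF s0 A RA R Rnz Rfin VA V Vnz Vfin])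
    have [measurable]: "u \<in> borel_measurable lebesgue" unfolding u_def by measurable
    note Rpos = HL_bound_pos[OF RA R Rnz] and Vpos = HL_bound_pos[OF VA V Vnz]
    have RV: "(\<integral>\<^sup>+x. R x * V x \<partial>lebesgue) \<le> N"
    proof -
      have "(\<integral>\<^sup>+x. R x * V x \<partial>lebesgue) \<le> epow (pint s w R) (1/s) *
         epow (pint ?s' ?\<sigma> V) (1 - 1/s)"
        by (rule Hoelder_dual_weight[OF w s R V])
      also have "\<dots> \<le> N"
        unfolding N_def using s by (intro mult_mono epow_mono RG VH) auto
      finally show ?thesis .
    qed
    have 1: "pint s0 u G \<le> ennreal (2 powr s0) * N"
    proof -
      have "pint s0 u G \<le> (\<integral>\<^sup>+x. ennreal (2 powr s0) * (R x * V x) \<partial>lebesgue)"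
      proof (rule nn_integral_mono_AE)
        show "AE x in lebesgue. epow (G x) s0 * ennreal (u x) \<le> ennreal (2 powr s0) * (R x * V x)"
          using u3 Rfin
        proof eventually_elim
          case (elim x)
          have "epow (G x) s0 * ennreal (u x) \<le> epow (2 * R x) s0 * ennreal (u x)"
            using s0 GR by (intro mult_right_mono epow_mono) auto
          also have "\<dots> = ennreal (2 powr s0) * (epow (R x) s0 * epow (R x) (1 - s0) * V x)"
            unfolding elim(1) using s0 epow_ennreal[of 2 s0] by (simp add: epow_mult mult.assoc)
          also have "epow (R x) s0 * epow (R x) (1 - s0) = R x"
            using epow_add_pos[OF Rpos elim(2), of s0 "1 - s0"] by simp
          finally show ?case .
        qed
      qed
      also have "\<dots> = ennreal (2 powr s0) * (\<integral>\<^sup>+x. R x * V x \<partial>lebesgue)"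
        by (rule nn_integral_cmult) measurable
      also have "\<dots> \<le> ennreal (2 powr s0) * N" by (intro mult_left_mono RV) auto
      finally show ?thesis .
    qed
    have 2: "(\<integral>\<^sup>+x. F x * H x \<partial>lebesgue) \<le>
        2 * (epow (pint s0 u F) (1/s0) * epow N (1 - 1/s0))"
      if [measurable]: "F \<in> borel_measurable lebesgue" for F
    proof -
      have "(\<integral>\<^sup>+x. F x * H x \<partial>lebesgue) \<le> (\<integral>\<^sup>+x. 2 * (F x * V x) \<partial>lebesgue)"
      proof (rule nn_integral_mono)
        fix x
        have "F x * H x \<le> F x * (2 * V x)" by (intro mult_left_mono HV) auto
        then show "F x * H x \<le> 2 * (F x * V x)" by (simp only: mult_ac)
      qed
      also have "\<dots> = 2 * (\<integral>\<^sup>+x. F x * V x \<partial>lebesgue)" by (rule nn_integral_cmult) measurable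
      also have "(\<integral>\<^sup>+x. F x * V x \<partial>lebesgue) \<le> epow (pint s0 u F) (1/s0) * epow N (1 - 1/s0)"
      proof (cases "s0 = 1")
        case True
        have "(\<integral>\<^sup>+x. F x * V x \<partial>lebesgue) = (\<integral>\<^sup>+x. F x * ennreal (u x) \<partial>lebesgue)"
          using u3 True by (intro nn_integral_cong_AE) (auto elim!: eventually_mono)
        then show ?thesis using True by simp
      next
        case False
        with s0 have s01: "1 < s0" by simp
        have "(\<integral>\<^sup>+x. F x * V x \<partial>lebesgue) =
            (\<integral>\<^sup>+x. epow (epow (F x) s0 * ennreal (u x)) (1/s0) * epow (R x * V x) (1 - 1/s0) \<partial>lebesgue)"
        proof (rule nn_integral_cong_AE)
          show "AE x in lebesgue. F x * V x = epow (epow (F x) s0 * ennreal (u x)) (1/s0) * epow (R x * V x) (1 - 1/s0)"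
            using u3 Rfin Vfin
          proof eventually_elim
            case (elim x)
            have "epow (epow (F x) s0 * ennreal (u x)) (1/s0) = F x * (epow (R x) ((1 - s0) * (1/s0)) * epow (V x) (1/s0))"
              unfolding elim(1) using s01 by (simp add: epow_mult epow_epow)
            moreover have "epow (R x * V x) (1 - 1/s0) = epow (R x) (1 - 1/s0) * epow (V x) (1 - 1/s0)"
              using s01 by (simp add: epow_mult)
            moreover have "epow (R x) ((1 - s0) * (1/s0)) * epow (R x) (1 - 1/s0) = 1"
            proof -
              have "(1 - s0) * (1/s0) + (1 - 1/s0) = 0" using s01 by (simp add: field_simps)
              then show ?thesis using epow_add_pos[OF Rpos elim(2), of "(1 - s0) * (1/s0)" "1 - 1/s0"] by simp
            qed
            moreover have "epow (V x) (1/s0) * epow (V x) (1 - 1/s0) = V x"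
              using epow_add_pos[OF Vpos elim(3), of "1/s0" "1 - 1/s0"] by simp
            moreover have "F x * (a * b) * (c * d) = F x * ((a * c) * (b * d))" for a b c d :: ennreal
              by (simp only: mult_ac)
            ultimately show ?case by simp
          qed
        qed
        also have "\<dots> \<le> epow (pint s0 u F) (1/s0) * epow (\<integral>\<^sup>+x. R x * V x \<partial>lebesgue) (1 - 1/s0)"
          using s01 by (intro Hoelder_nn_integral) auto
        also have "\<dots> \<le> epow (pint s0 u F) (1/s0) * epow N (1 - 1/s0)"
          using s01 by (intro mult_left_mono epow_mono RV) auto
        finally show ?thesis .
      qed
      finally show ?thesis by (simp add: mult_left_mono)
    qed
    show ?thesis
      unfolding N_def[symmetric] extrapolates_def using u(1,2) 1 2 by blast
  qed
  then show ?thesis by (intro exI[of _ "A powr s0"]) auto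
qed

text \<open>Truncation in height and in space gives finite norms, which the duality argument has to
  cancel; monotone convergence recovers F.\<close>

lemma truncation_norm_SUP:
  fixes F w :: "real ^ 'n \<Rightarrow> ennreal"
  assumes s: "0 < s" and [measurable]: "F \<in> borel_measurable lebesgue" "w \<in> borel_measurable lebesgue"
  defines "T \<equiv> \<lambda>k::nat. \<lambda>x. min (F x) (of_nat k) * indicator (cube (\<chi> i. - real k) (2 * real k)) x"
  shows "pint s w F = (SUP k. \<integral>\<^sup>+x. epow (T k x) s * w x \<partial>lebesgue)"
proof -
  have inc: "T j x \<le> T k x" if "j \<le> k" for j k x
  proof -
    have "of_nat j \<le> (of_nat k :: ennreal)" using that by simp
    moreover have "x \<in> cube (\<chi> i. - real j) (2 * real j) \<Longrightarrow> x \<in> cube (\<chi> i. - real k) (2 * real k)"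
      using that by (auto simp: mem_cube) (smt (verit) of_nat_mono)+
    ultimately show ?thesis
      unfolding T_def by (auto simp: indicator_def min_le_iff_disj)
  qed
  have [measurable]: "T k \<in> borel_measurable lebesgue" for k unfolding T_def by measurable
  have "(SUP k. epow (T k x) s * w x) = epow (F x) s * w x" for x
  proof -
    have "(SUP k. epow (T k x) s) = epow (F x) s"
    proof (rule antisym)
      have "T k x \<le> F x" for k by (simp add: T_def indicator_def min_le_iff_disj)
      then show "(SUP k. epow (T k x) s) \<le> epow (F x) s"
        using s by (intro SUP_least epow_mono) auto
      define Y where "Y = (SUP k. epow (T k x) s)"
      obtain k0 where k0: "norm x \<le> real k0" using real_arch_simple by blast
      have Y: "min (F x) (of_nat k) \<le> epow Y (1/s)" if "k0 \<le> k" for k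
      proof -
        have "\<bar>x $ i\<bar> \<le> real k" for i
          using component_le_norm_cart[of x i] k0 that by (meson le_trans of_nat_mono order_trans)
        then have "x \<in> cube (\<chi> i. - real k) (2 * real k)"
          by (auto simp: mem_cube abs_le_iff) (metis minus_le_iff)
        then have "T k x = min (F x) (of_nat k)" by (simp add: T_def)
        moreover have "epow (T k x) s \<le> Y" unfolding Y_def by (rule SUP_upper) simp
        ultimately show ?thesis using s by (simp add: epow_le_iff)
      qed
      have "F x \<le> epow Y (1/s)"
      proof (cases "F x = top")
        case True
        have "epow Y (1/s) = top"
        proof (rule ccontr)
          assume "epow Y (1/s) \<noteq> top"
          then obtain n where "epow Y (1/s) < of_nat n"
            using ennreal_Ex_less_of_nat less_top by blast
          also have "of_nat n \<le> (of_nat (max n k0) :: ennreal)" by (intro of_nat_mono) simp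
          also have "\<dots> \<le> epow Y (1/s)" using Y[of "max n k0"] True by simp
          finally show False by simp
        qed
        then show ?thesis by simp
      next
        case False
        then obtain n where "F x < of_nat n" using ennreal_Ex_less_of_nat less_top by blast
        also have "of_nat n \<le> (of_nat (max n k0) :: ennreal)" by (intro of_nat_mono) simp
        finally have "min (F x) (of_nat (max n k0)) = F x" by (intro min.absorb1 less_imp_le)
        then show ?thesis using Y[of "max n k0"] by simp
      qed
      then show "epow (F x) s \<le> Y" using s by (simp add: epow_le_iff)
    qed
    then show ?thesis by (simp add: SUP_mult_right_ennreal[symmetric])
  qed
  then have "pint s w F = (\<integral>\<^sup>+x. (SUP k. epow (T k x) s * w x) \<partial>lebesgue)" by simp
  also have "\<dots> = (SUP k. \<integral>\<^sup>+x. epow (T k x) s * w x \<partial>lebesgue)"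
    using s by (intro nn_integral_monotone_convergence_SUP)
      (auto simp: incseq_def le_fun_def intro!: mult_right_mono epow_mono inc)
  finally show ?thesis .
qed

text \<open>The hypothesis concerns a pair of functions instead of an operator. \<open>C\<close> is
  evaluated at any upper bound K of the constant, not at the constant itself.\<close>

definition muckenhoupt_bounded :: "real \<Rightarrow> (real \<Rightarrow> real) \<Rightarrow> (real ^ 'n \<Rightarrow> ennreal) \<Rightarrow> (real ^ 'n \<Rightarrow> ennreal) \<Rightarrow> bool" where
  "muckenhoupt_bounded s C F G \<longleftrightarrow> (\<forall>K\<ge>0. \<forall>u\<in>muckenhoupt s. Ap_const s u \<le> ennreal K \<longrightarrow>
     pint s u F \<le> ennreal (C K) * pint s u G)"

text \<open>A truncation of F is tested against the function that norms it; the constructed weight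
  transfers the pairing to exponent s0, and the surplus power of the norm is cancelled.\<close>

theorem extrapolation:
  fixes C :: "real \<Rightarrow> real"
  assumes s0: "1 \<le> s0" and s: "1 < s"
  shows "\<exists>C'. \<forall>F G :: real ^ 'n \<Rightarrow> ennreal. \<forall>K w. F \<in> borel_measurable lebesgue \<longrightarrow> G \<in> borel_measurable lebesgue \<longrightarrow>
     muckenhoupt_bounded s0 C F G \<longrightarrow> 0 \<le> K \<longrightarrow> apw s K w \<longrightarrow> pint s w F \<le> ennreal (C' K) * pint s w G"
proof -
  let ?s' = "conj_exponent s"
  have s': "1 < ?s'" using s by (rule conj_exponent_gt_1)
  let ?P = "\<lambda>K c. \<forall>F G w :: real ^ 'n \<Rightarrow> ennreal. F \<in> borel_measurable lebesgue \<longrightarrow> G \<in> borel_measurable lebesgue \<longrightarrow>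
      muckenhoupt_bounded s0 C F G \<longrightarrow> apw s K w \<longrightarrow> pint s w F \<le> ennreal c * pint s w G"
  have "\<exists>c. ?P K c" if K: "0 \<le> K" for K
  proof -
    obtain A where A: "0 \<le> A" and ext: "\<And>(w :: real ^ 'n \<Rightarrow> ennreal) G H. apw s K w \<Longrightarrow>
     G \<in> borel_measurable lebesgue \<Longrightarrow> H \<in> borel_measurable lebesgue \<Longrightarrow> pint s w G \<in> {0<..<top} \<Longrightarrow>
     pint ?s' (dual_weight s w) H \<in> {0<..<top} \<Longrightarrow> extrapolates s0 A (2 powr s0) G
       (epow (pint s w G) (1/s) * epow (pint ?s' (dual_weight s w) H) (1 - 1/s)) H"
      using extrapolation_weight[OF s0 s K, where 'n='n] by blast
    define c where "c = max 1 (C A)"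
    \<comment> \<open>One factor 2 comes from the pairing, the other from the s0-th root of 2^s0.
      The maximum in c keeps D positive for an arbitrary \<open>C\<close>.\<close>
    define D where "D = 4 * c powr (1/s0)"
    have c: "0 < c" by (simp add: c_def)
    have D: "0 < D" using c by (simp add: D_def)
    have main: "pint s w F \<le> ennreal (D powr s) * pint s w G"
      if mF [measurable]: "F \<in> borel_measurable lebesgue" and mG [measurable]: "G \<in> borel_measurable lebesgue"
        and FG: "muckenhoupt_bounded s0 C F G" and w: "apw s K w" for F G w :: "real ^ 'n \<Rightarrow> ennreal"
    proof -
      have hyp: "pint s0 u F \<le> ennreal (C K) * pint s0 u G"
        if "0 \<le> K" "u \<in> muckenhoupt s0" "Ap_const s0 u \<le> ennreal K" for K u
        by (rule FG[unfolded muckenhoupt_bounded_def, rule_format, OF that])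
      note [measurable] = apw_measurable[OF w]
      let ?\<sigma> = "dual_weight s w"
      let ?IG = "\<integral>\<^sup>+x. epow (G x) s * w x \<partial>lebesgue"
      consider "?IG = top" | "?IG = 0" | "0 < ?IG" "?IG < top"
        using less_top[of ?IG] not_gr_zero[of ?IG] by blast
      then show ?thesis
      proof cases
        case 1
        then show ?thesis using D by simp
      next
        case 2
        \<comment> \<open>For G = 0 the construction of u degenerates. The weight 1 shows instead
          that F vanishes almost everywhere, a statement that no longer involves a weight.\<close>
        then have G0: "AE x in lebesgue. G x = 0"
          using weighted_norm_eq_0_iff[OF w s mG] by simp
        have "(\<integral>\<^sup>+x. epow (F x) s0 * ennreal 1 \<partial>lebesgue) \<le> ennreal (C 1) * (\<integral>\<^sup>+x. epow (G x) s0 * ennreal 1 \<partial>lebesgue)"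
          using one_muckenhoupt[OF s0, where 'n='n] by (intro hyp) auto
        also have "(\<integral>\<^sup>+x. epow (G x) s0 * ennreal 1 \<partial>lebesgue) = (\<integral>\<^sup>+x. 0 \<partial>(lebesgue :: (real ^ 'n) measure))"
          using G0 s0 by (intro nn_integral_cong_AE) (auto elim!: eventually_mono)
        finally have "(\<integral>\<^sup>+x. epow (F x) s0 \<partial>lebesgue) = 0" by simp
        then have "AE x in lebesgue. epow (F x) s0 = 0"
          by (subst (asm) nn_integral_0_iff_AE) auto
        then have "AE x in lebesgue. F x = 0"
          by eventually_elim (use s0 in \<open>auto simp: epow_eq_0_iff\<close>)
        then show ?thesis using weighted_norm_eq_0_iff[OF w s mF] by simp
      next
        case 3
        define T where "T k x = min (F x) (of_nat k) * indicator (cube (\<chi> i. - real k) (2 * real k)) x" for k :: nat and x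
        have [measurable]: "T k \<in> borel_measurable lebesgue" for k unfolding T_def by measurable
        have TF: "T k x \<le> F x" for k x by (simp add: T_def indicator_def min_le_iff_disj)
        have "pint s w (T k) \<le> ennreal (D powr s) * ?IG" for k
        proof -
          define I where "I = pint s w (T k)"
          show ?thesis
          proof (cases "I = 0")
            case True
            then show ?thesis by (simp add: I_def)
          next
            case False
            have "k \<noteq> 0"
            proof
              assume "k = 0"
              then have "T k x = 0" for x by (simp add: T_def)
              then show False using False s by (simp add: I_def)
            qed
            have Ifin: "I < top"
            proof -
              have "I \<le> (\<integral>\<^sup>+x. epow (of_nat k) s * (w x * indicator (cube (\<chi> i. - real k) (2 * real k)) x) \<partial>lebesgue)"
                unfolding I_def using s
                by (intro nn_integral_mono) (auto simp: T_def split: split_indicator intro!: mult_right_mono epow_mono)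
              also have "\<dots> = epow (of_nat k) s * mass w (cube (\<chi> i. - real k) (2 * real k))"
                unfolding mass_def by (rule nn_integral_cmult) measurable
              also have "\<dots> < top"
                using \<open>k \<noteq> 0\<close> s apw_mass_finite[OF s w]
                by (simp add: ennreal_mult_less_top epow_less_top of_nat_less_top)
              finally show ?thesis .
            qed
            \<comment> \<open>The norming function: the integral of H^s' against the dual weight is
              again I, while F * H is at least the integrand of I.\<close>
            define H where "H x = epow (T k x) (s - 1) * w x" for x
            have mH [measurable]: "H \<in> borel_measurable lebesgue" unfolding H_def by measurable
            have IH: "pint ?s' ?\<sigma> H = I"
              unfolding I_def
            proof (rule nn_integral_cong_AE)
              show "AE x in lebesgue. epow (H x) ?s' * ?\<sigma> x = epow (T k x) s * w x"
                using apw_AE[OF w]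
              proof eventually_elim
                case (elim x)
                have e: "(s - 1) * ?s' = s" "?s' + - 1 / (s - 1) = 1"
                  using s by (auto simp: conj_exponent_def diff_divide_distrib[symmetric])
                have "epow (H x) ?s' * ?\<sigma> x = epow (T k x) s * (epow (w x) ?s' * ?\<sigma> x)"
                  using s' by (simp add: H_def epow_mult epow_epow e mult.assoc)
                also have "epow (w x) ?s' * ?\<sigma> x = epow (w x) (?s' + - 1 / (s - 1))"
                  using elim by (subst epow_add_pos) (auto simp: dual_weight_def)
                finally show ?case by (simp only: e epow_exp_1)
              qed
            qed
            define N where "N = epow ?IG (1/s) * epow I (1 - 1/s)"
            obtain u where u: "u \<in> muckenhoupt s0" "Ap_const s0 u \<le> ennreal A"
              and Gu: "pint s0 u G \<le> ennreal (2 powr s0) * N"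
              and Fu: "(\<integral>\<^sup>+x. F x * H x \<partial>lebesgue) \<le>
                2 * (epow (pint s0 u F) (1/s0) * epow N (1 - 1/s0))"
              using ext[OF w mG mH] 3 False Ifin mF unfolding IH N_def extrapolates_def
              by (auto simp: zero_less_iff_neq_zero)
            have "I \<le> (\<integral>\<^sup>+x. F x * H x \<partial>lebesgue)"
              unfolding I_def
            proof (rule nn_integral_mono)
              fix x
              have "epow (T k x) s = T k x * epow (T k x) (s - 1)"
                using epow_add[of 1 "s - 1" "T k x"] s by simp
              then show "epow (T k x) s * w x \<le> F x * H x"
                unfolding H_def using TF by (simp add: mult.assoc mult_right_mono)
            qed
            also have "\<dots> \<le> 2 * (epow (pint s0 u F) (1/s0) * epow N (1 - 1/s0))"
              by (rule Fu)
            also have "\<dots> \<le> 2 * (epow (ennreal c * (ennreal (2 powr s0) * N)) (1/s0) * epow N (1 - 1/s0))"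
            proof (intro mult_left_mono mult_right_mono epow_mono)
              have "pint s0 u F \<le> ennreal (C A) * pint s0 u G"
                by (rule hyp[OF A u])
              also have "\<dots> \<le> ennreal c * (ennreal (2 powr s0) * N)"
                by (intro mult_mono Gu ennreal_leI) (auto simp: c_def)
              finally show "pint s0 u F \<le> ennreal c * (ennreal (2 powr s0) * N)" .
            qed (use s0 in auto)
            also have "\<dots> = ennreal D * N"
            proof -
              have "epow (ennreal c * (ennreal (2 powr s0) * N)) (1/s0) = ennreal (c powr (1/s0)) * (2 * epow N (1/s0))"
                using s0 c by (simp add: epow_mult powr_powr)
              moreover have "epow N (1/s0) * epow N (1 - 1/s0) = N"
                using epow_add[of "1/s0" "1 - 1/s0" N] s0 by simp
              moreover have "2 * (ennreal (c powr (1/s0)) * (2 * epow N (1/s0)) * epow N (1 - 1/s0)) =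
                  2 * 2 * ennreal (c powr (1/s0)) * (epow N (1/s0) * epow N (1 - 1/s0))"
                by (simp only: mult_ac)
              moreover have "2 * 2 * ennreal (c powr (1/s0)) = ennreal D"
                using c by (simp add: D_def ennreal_mult')
              ultimately show ?thesis by simp
            qed
            finally have "I \<le> ennreal D * epow ?IG (1/s) * epow I (1 - 1/s)"
              by (simp add: N_def mult.assoc)
            moreover have "epow I (1/s) * epow I (1 - 1/s) = I"
              using epow_add[of "1/s" "1 - 1/s" I] s by simp
            \<comment> \<open>Cancelling I^(1 - 1/s) requires I to be positive and finite; hence the
              truncation and the separate case I = 0.\<close>
            ultimately have "epow I (1 - 1/s) * epow I (1/s) \<le> epow I (1 - 1/s) * (ennreal D * epow ?IG (1/s))"
              by (simp add: mult_ac)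
            moreover have "epow I (1 - 1/s) \<noteq> 0" "epow I (1 - 1/s) \<noteq> top"
              using False Ifin by (auto simp: epow_eq_0_iff epow_eq_top_iff)
            ultimately have "epow I (1/s) \<le> ennreal D * epow ?IG (1/s)"
              by (simp only: ennreal_mult_le_mult_iff not_False_eq_True)
            then have "I \<le> epow (ennreal D * epow ?IG (1/s)) s"
              using s by (simp add: epow_le_iff)
            also have "\<dots> = ennreal (D powr s) * ?IG"
              using s D by (simp add: epow_mult epow_epow)
            finally show ?thesis by (simp add: I_def)
          qed
        qed
        then show ?thesis
          using truncation_norm_SUP[of s F w] s unfolding T_def by (simp add: SUP_le_iff)
      qed
    qed
    show ?thesis by (intro exI[of _ "D powr s"] allI impI) (rule main)
  qed
  \<comment> \<open>For each K one constant serves all F, G and w; choice assembles these constants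
    into a function of K.\<close>
  then have "\<forall>K. \<exists>c. 0 \<le> K \<longrightarrow> ?P K c" by blast
  then obtain C' where C': "\<forall>K. 0 \<le> K \<longrightarrow> ?P K (C' K)" by (rule choice[THEN exE])
  show ?thesis by (intro exI[of _ C'] allI impI) (rule C'[rule_format])
qed

subsection \<open>Adjusting the constant of a weight\<close>

text \<open>The bound v \<le> b * u enters the average of v, and u \<le> a * v enters the remaining
  factor of the condition; each is used once, so only a * b is lost.\<close>

lemma Ap_const_comparable:
  fixes u v :: "real ^ 'n \<Rightarrow> real"
  assumes s: "1 \<le> s" and ab: "0 < a" "0 < b"
    and [measurable]: "u \<in> borel_measurable lebesgue" "v \<in> borel_measurable lebesgue"
    and u0: "\<And>x. 0 \<le> u x" and v0: "\<And>x. 0 \<le> v x"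
    and uv: "\<And>x. u x \<le> a * v x" and vu: "\<And>x. v x \<le> b * u x"
  shows "Ap_const s v \<le> ennreal (a * b) * Ap_const s u"
proof -
  have avg: "avg v Q \<le> ennreal b * avg u Q" if Q: "Q \<in> cubes" for Q
  proof -
    have "avg v Q \<le> avg (\<lambda>x. ennreal b * ennreal (u x)) Q"
      using vu ab u0 by (intro avg_mono_AE AE_I2 impI) (simp add: ennreal_mult[symmetric] ennreal_leI)
    also have "\<dots> = ennreal b * avg u Q" using Q by (intro avg_cmult) auto
    finally show ?thesis .
  qed
  show ?thesis
  proof (cases "s = 1")
    case True
    have "Ap_const s v / ennreal (a * b) \<le> Ap_const s u"
      unfolding Ap_const_def if_P[OF True]
    proof (rule Inf_greatest, clarify)
      fix c assume c: "0 \<le> c" "\<forall>Q\<in>cubes. AE x in lebesgue. x \<in> Q \<longrightarrow> avg u Q \<le> ennreal c * ennreal (u x)"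
      have "\<forall>Q\<in>cubes. AE x in lebesgue. x \<in> Q \<longrightarrow> avg v Q \<le> ennreal (a * b * c) * ennreal (v x)"
      proof
        fix Q :: "(real ^ 'n) set" assume Q: "Q \<in> cubes"
        then have "AE x in lebesgue. x \<in> Q \<longrightarrow> avg u Q \<le> ennreal c * ennreal (u x)" using c by blast
        then show "AE x in lebesgue. x \<in> Q \<longrightarrow> avg v Q \<le> ennreal (a * b * c) * ennreal (v x)"
        proof (rule eventually_mono, intro impI)
          fix x assume x: "x \<in> Q \<longrightarrow> avg u Q \<le> ennreal c * ennreal (u x)" "x \<in> Q"
          have "avg v Q \<le> ennreal b * (ennreal c * ennreal (a * v x))"
            using x by (intro order_trans[OF avg[OF Q]] mult_left_mono order_trans[OF x(1)[rule_format]] ennreal_leI uv) auto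
          also have "\<dots> = ennreal (a * b * c) * ennreal (v x)"
            using ab c v0 by (simp add: ennreal_mult mult_ac)
          finally show "avg v Q \<le> ennreal (a * b * c) * ennreal (v x)" .
        qed
      qed
      then have "Inf {ennreal c |c. 0 \<le> c \<and> (\<forall>Q\<in>cubes. AE x in lebesgue. x \<in> Q \<longrightarrow> avg v Q \<le> ennreal c * ennreal (v x))}
          \<le> ennreal (a * b * c)"
        using ab c by (intro Inf_lower) (auto intro!: exI[of _ "a * b * c"])
      also have "\<dots> = ennreal c * ennreal (a * b)"
        using ab c by (simp add: ennreal_mult mult_ac)
      finally show "Inf {ennreal c |c. 0 \<le> c \<and> (\<forall>Q\<in>cubes. AE x in lebesgue. x \<in> Q \<longrightarrow> avg v Q \<le> ennreal c * ennreal (v x))}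
          / ennreal (a * b) \<le> ennreal c"
        using ab by (intro divide_le_posI_ennreal) (auto simp: mult.commute)
    qed
    then have "Ap_const s v / ennreal (a * b) * ennreal (a * b) \<le> Ap_const s u * ennreal (a * b)"
      by (rule mult_right_mono) auto
    moreover have "Ap_const s v / ennreal (a * b) * ennreal (a * b) = Ap_const s v"
      using ab by (simp add: ennreal_divide_times)
    ultimately show ?thesis by (simp add: mult.commute)
  next
    case False
    with s have s1: "1 < s" by simp
    let ?e = "1 - conj_exponent s"
    have e: "?e * (s - 1) = -1" "?e < 0" using s1 by (simp_all add: conj_exponent_def field_simps)
    have "avg v Q * epow (avg (\<lambda>x. epow (v x) ?e) Q) (s - 1) \<le> ennreal (a * b) * Ap_const s u"
      if Q: "Q \<in> cubes" for Q
    proof -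
      have "avg (\<lambda>x. epow (v x) ?e) Q \<le> avg (\<lambda>x. epow (ennreal (1/a)) ?e * epow (u x) ?e) Q"
      proof (intro avg_mono_AE AE_I2 impI)
        fix x
        have "ennreal (1/a) * ennreal (u x) \<le> ennreal (v x)"
          using ab u0 v0 uv[of x] by (simp add: ennreal_mult[symmetric] field_simps)
        then have "epow (v x) ?e \<le> epow (ennreal (1/a) * ennreal (u x)) ?e"
          using e by (intro epow_antimono) auto
        also have "\<dots> = epow (ennreal (1/a)) ?e * epow (u x) ?e"
          using ab by (intro epow_mult_pos) auto
        finally show "epow (v x) ?e \<le> epow (ennreal (1/a)) ?e * epow (u x) ?e" .
      qed
      also have "\<dots> = epow (ennreal (1/a)) ?e * avg (\<lambda>x. epow (u x) ?e) Q"
        using Q by (intro avg_cmult) auto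
      finally have "epow (avg (\<lambda>x. epow (v x) ?e) Q) (s - 1) \<le> epow (epow (ennreal (1/a)) ?e * avg (\<lambda>x. epow (u x) ?e) Q) (s - 1)"
        using s1 by (intro epow_mono) auto
      also have "\<dots> = ennreal a * epow (avg (\<lambda>x. epow (u x) ?e) Q) (s - 1)"
      proof -
        have "epow (epow (ennreal (1/a)) ?e) (s - 1) = ennreal a"
          unfolding epow_epow e(1) using ab by (simp add: powr_minus_divide)
        then show ?thesis using s1 by (simp add: epow_mult)
      qed
      finally have "avg v Q * epow (avg (\<lambda>x. epow (v x) ?e) Q) (s - 1) \<le>
          (ennreal b * avg u Q) * (ennreal a * epow (avg (\<lambda>x. epow (u x) ?e) Q) (s - 1))"
        using avg[OF Q] by (intro mult_mono) auto
      also have "\<dots> = ennreal (a * b) * (avg u Q * epow (avg (\<lambda>x. epow (u x) ?e) Q) (s - 1))"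
        using ab by (simp add: ennreal_mult mult_ac)
      also have "\<dots> \<le> ennreal (a * b) * Ap_const s u"
        unfolding Ap_const_def if_not_P[OF False] using Q
        by (intro mult_left_mono SUP_upper) auto
      finally show ?thesis .
    qed
    then show ?thesis
      unfolding Ap_const_def[of s v] if_not_P[OF False] by (intro SUP_least)
  qed
qed

lemma muckenhoupt_comparable:
  fixes u v :: "real ^ 'n \<Rightarrow> real"
  assumes s: "1 \<le> s" and ab: "0 < a" "0 < b" and u: "u \<in> muckenhoupt s"
    and [measurable]: "v \<in> borel_measurable lebesgue"
    and uv: "\<And>x. u x \<le> a * v x" and vu: "\<And>x. v x \<le> b * u x"
  shows "v \<in> muckenhoupt s" "Ap_const s v \<le> ennreal (a * b) * Ap_const s u"
proof -
  have [measurable]: "u \<in> borel_measurable lebesgue" and u0: "0 \<le> u x" and w: "weight u" for x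
    using u by (auto simp: muckenhoupt_def weight_def)
  have v0: "0 \<le> v x" for x
    using order_trans[OF u0[of x] uv[of x]] ab by (simp add: zero_le_mult_iff)
  show Ap: "Ap_const s v \<le> ennreal (a * b) * Ap_const s u"
    by (rule Ap_const_comparable) (use assms u0 v0 in auto)
  have "weight v"
  proof (rule weightI)
    fix Q :: "(real ^ 'n) set" assume Q: "Q \<in> cubes"
    have "mass v Q \<le> mass (\<lambda>x. ennreal b * ennreal (u x)) Q"
      using vu ab u0 by (intro mass_mono) (simp add: ennreal_mult[symmetric] ennreal_leI)
    also have "\<dots> = ennreal b * mass u Q" using Q by (intro mass_cmult) auto
    also have "\<dots> < top" using weight_mass_finite[OF w Q] by (simp add: ennreal_mult_less_top)
    finally show "mass v Q < top" .
  qed (use v0 in auto)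
  moreover have "AE x in lebesgue. 0 < v x"
  proof -
    have "AE x in lebesgue. 0 < u x" using u by (simp add: muckenhoupt_def)
    then show ?thesis
    proof eventually_elim
      case (elim x)
      then show ?case using uv[of x] ab by (metis order_less_le_trans zero_less_mult_pos)
    qed
  qed
  moreover have "Ap_const s v < top"
    using Ap by (rule le_less_trans) (use u in \<open>simp add: muckenhoupt_def ennreal_mult_less_top\<close>)
  ultimately show "v \<in> muckenhoupt s" by (simp add: muckenhoupt_def)
qed

text \<open>Raising u on the heavier part E multiplies at least half of the mass of the cube by 1 +
  S. On E' the weight is unchanged, and there Hoelder bounds the dual mass from below. The constant
  of v therefore grows at least linearly in S, at a rate that does not depend on u.\<close>

lemma Ap_const_ge_split:
  fixes u v :: "real ^ 'n \<Rightarrow> real"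
  assumes s: "1 \<le> s" and u: "u \<in> muckenhoupt s" and v: "v \<in> muckenhoupt s" and S: "0 \<le> S"
    and Q: "Q \<in> cubes" and E [measurable]: "E \<in> sets lebesgue" "E' \<in> sets lebesgue" and EQ: "E \<union> E' = Q" "E \<inter> E' = {}"
    and big: "mass u E' \<le> mass u E"
    and vE: "\<And>x. x \<in> E \<Longrightarrow> v x = (1 + S) * u x" and vE': "\<And>x. x \<in> E' \<Longrightarrow> v x = u x"
    and k: "0 < k" "k \<le> 1" "ennreal k * emeasure lebesgue Q \<le> emeasure lebesgue E'"
  shows "ennreal ((1 + S) / 2 * k powr s) \<le> Ap_const s v"
proof -
  have [measurable]: "u \<in> borel_measurable lebesgue" and u0: "0 \<le> u x" and wu: "weight u" and upos: "AE x in lebesgue. 0 < u x" for x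
    using u by (auto simp: muckenhoupt_def weight_def)
  have [measurable]: "v \<in> borel_measurable lebesgue" and vpos: "AE x in lebesgue. 0 < v x"
    using v by (auto simp: muckenhoupt_def weight_def)
  define m where "m = emeasure lebesgue Q"
  have m: "0 < m" "m < top" using Q by (auto simp: m_def emeasure_cubes_pos emeasure_cubes_finite)
  define U where "U = mass u Q"
  have U: "0 < U" "U < top"
    using upos Q wu by (auto simp: U_def intro!: mass_pos weight_mass_finite)
  have UE: "U = mass u E + mass u E'"
    unfolding U_def EQ(1)[symmetric] using EQ(2) by (intro mass_Un) auto
  have "U \<le> 2 * mass u E" unfolding UE using big by (simp add: mult_2)
  have "ennreal ((1 + S) / 2) * U \<le> ennreal ((1 + S) / 2) * (2 * mass u E)"
    by (intro mult_left_mono \<open>U \<le> 2 * mass u E\<close>) auto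
  also have "\<dots> = ennreal (1 + S) * mass u E"
  proof -
    have "ennreal ((1 + S) / 2) * ennreal 2 = ennreal ((1 + S) / 2 * 2)"
      using S by (intro ennreal_mult[symmetric]) auto
    also have "(1 + S) / 2 * 2 = 1 + S" by simp
    finally have "ennreal ((1 + S) / 2) * 2 = ennreal (1 + S)" by simp
    then show ?thesis by (simp add: mult.assoc[symmetric])
  qed
  also have "\<dots> = mass v E"
    using S u0 vE by (subst mass_cmult[symmetric]) (auto simp: mass_def ennreal_mult indicator_def intro!: nn_integral_cong)
  also have "\<dots> \<le> mass v Q" using EQ by (intro mass_mono_set) auto
  finally have vU: "ennreal ((1 + S) / 2) * U \<le> mass v Q" .
  show ?thesis
  proof (cases "s = 1")
    case True
    show ?thesis
      unfolding Ap_const_def if_P[OF True]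
    proof (rule Inf_greatest, clarify)
      fix c assume c: "0 \<le> c" "\<forall>Q\<in>cubes. AE x in lebesgue. x \<in> Q \<longrightarrow> avg v Q \<le> ennreal c * ennreal (v x)"
      then have "AE x in lebesgue. x \<in> Q \<longrightarrow> avg v Q \<le> ennreal c * ennreal (v x)" using Q by blast
      then have "mass (\<lambda>_. avg v Q) E' \<le> mass (\<lambda>x. ennreal c * ennreal (u x)) E'"
        by (intro mass_mono_AE) (auto elim!: eventually_mono simp: vE' EQ(1)[symmetric])
      then have *: "avg v Q * emeasure lebesgue E' \<le> ennreal c * mass u E'"
        by (simp add: mass_const mass_cmult)
      have "ennreal ((1 + S) / 2) * U * ennreal k \<le> mass v Q * ennreal k"
        by (intro mult_right_mono vU) auto
      also have "\<dots> = avg v Q * (ennreal k * m)"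
        using mass_eq_avg[OF Q, of v] by (simp add: m_def mult_ac)
      also have "\<dots> \<le> avg v Q * emeasure lebesgue E'"
        using k by (intro mult_left_mono) (auto simp: m_def)
      also have "\<dots> \<le> ennreal c * mass u E'" by (rule *)
      also have "\<dots> \<le> ennreal c * U" unfolding UE by (intro mult_left_mono) auto
      finally have "U * (ennreal ((1 + S) / 2) * ennreal k) \<le> U * ennreal c"
        by (simp only: mult_ac)
      also have "ennreal ((1 + S) / 2) * ennreal k = ennreal ((1 + S) / 2 * k)"
        using S k by (intro ennreal_mult[symmetric]) auto
      finally have "U * ennreal ((1 + S) / 2 * k) \<le> U * ennreal c" .
      then have "ennreal ((1 + S) / 2 * k) \<le> ennreal c"
        using U by (subst (asm) ennreal_mult_le_mult_iff) auto
      then show "ennreal ((1 + S) / 2 * k powr s) \<le> ennreal c" using True k by simp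
    qed
  next
    case False
    with s have s1: "1 < s" by simp
    let ?e = "1 - conj_exponent s"
    have e: "?e = - 1 / (s - 1)" using s1 by (simp add: conj_exponent_def field_simps)
    let ?\<sigma> = "\<lambda>w :: real ^ 'n \<Rightarrow> real. dual_weight s (\<lambda>x. ennreal (w x))"
    have \<sigma>: "(\<lambda>x. epow (ennreal (v x)) ?e) = ?\<sigma> v" unfolding e dual_weight_def ..
    have mp: "0 < epow m s" "epow m s < top" using m by (auto simp: epow_pos epow_finite)
    have "ennreal (k powr s) * epow m s = epow (ennreal k * m) s"
      using s1 k by (simp add: epow_mult)
    also have "\<dots> \<le> epow (emeasure lebesgue E') s"
      using k s1 by (intro epow_mono) (auto simp: m_def)
    also have "\<dots> \<le> mass u E' * epow (mass (?\<sigma> u) E') (s - 1)"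
      using upos by (intro measure_le_mass_dual s1) (auto elim!: eventually_mono)
    also have "\<dots> \<le> U * epow (mass (?\<sigma> v) Q) (s - 1)"
    proof (intro mult_mono epow_mono)
      show "mass u E' \<le> U" unfolding UE by simp
      have "mass (?\<sigma> u) E' = mass (?\<sigma> v) E'"
        by (intro mass_cong_AE AE_I2) (simp add: dual_weight_def vE')
      also have "\<dots> \<le> mass (?\<sigma> v) Q" using EQ by (intro mass_mono_set) auto
      finally show "mass (?\<sigma> u) E' \<le> mass (?\<sigma> v) Q" .
    qed (use s1 in auto)
    finally have "ennreal ((1 + S) / 2) * (ennreal (k powr s) * epow m s) \<le> ennreal ((1 + S) / 2) * (U * epow (mass (?\<sigma> v) Q) (s - 1))"
      by (rule mult_left_mono) auto
    also have "\<dots> = ennreal ((1 + S) / 2) * U * epow (mass (?\<sigma> v) Q) (s - 1)" by (simp only: mult.assoc)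
    also have "\<dots> \<le> mass v Q * epow (mass (?\<sigma> v) Q) (s - 1)" by (intro mult_right_mono vU) auto
    also have "\<dots> = avg v Q * epow (avg (?\<sigma> v) Q) (s - 1) * epow m s"
    proof -
      have "m * epow m (s - 1) = epow m s" using epow_add[of 1 "s - 1" m] s1 by simp
      moreover have "mass v Q * epow (mass (?\<sigma> v) Q) (s - 1) = avg v Q * m * (epow (avg (?\<sigma> v) Q) (s - 1) * epow m (s - 1))"
        using s1 by (simp add: mass_eq_avg[OF Q] epow_mult m_def)
      moreover have "avg v Q * m * (x * y) = avg v Q * x * (m * y)" for x y by (simp only: mult_ac)
      ultimately show ?thesis by simp
    qed
    finally have "epow m s * (ennreal ((1 + S) / 2) * ennreal (k powr s)) \<le> epow m s * (avg v Q * epow (avg (?\<sigma> v) Q) (s - 1))"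
      by (simp only: mult_ac)
    also have "ennreal ((1 + S) / 2) * ennreal (k powr s) = ennreal ((1 + S) / 2 * k powr s)"
      using S by (intro ennreal_mult[symmetric]) auto
    finally have "epow m s * ennreal ((1 + S) / 2 * k powr s) \<le> epow m s * (avg v Q * epow (avg (?\<sigma> v) Q) (s - 1))" .
    then have "ennreal ((1 + S) / 2 * k powr s) \<le> avg v Q * epow (avg (?\<sigma> v) Q) (s - 1)"
      using mp by (subst (asm) ennreal_mult_le_mult_iff) auto
    also have "\<dots> \<le> Ap_const s v"
      unfolding Ap_const_def if_not_P[OF False] \<sigma> using Q by (intro SUP_upper) auto
    finally show ?thesis .
  qed
qed

text \<open>
  The bound \<open>c\<^sub>1\<close> in the hypothesis is an arbitrary function of the constant of the weight. Every
  weight with constant at most \<open>K\<close> is comparable to one whose constant is exactly \<open>K + 1\<close>, found by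
  the intermediate value theorem along a path of weights; so \<open>c\<^sub>1\<close> enters through a single value.
\<close>

lemma exists_comparable_weight:
  assumes s: "1 \<le> s" and K: "0 \<le> K"
  shows "\<exists>M>0. \<forall>u\<in>muckenhoupt s. Ap_const s (u :: real ^ 'n \<Rightarrow> real) \<le> ennreal K \<longrightarrow>
     (\<exists>v\<in>muckenhoupt s. Ap_const s v = ennreal (K + 1) \<and> (\<forall>x. u x \<le> v x \<and> v x \<le> M * u x))"
proof -
  \<comment> \<open>The volume share of a cube in its triple; the ring around the cube has at least
    this share too.\<close>
  define k :: real where "k = (1 / 3) ^ CARD('n)"
  have k: "0 < k" "k \<le> 1" by (auto simp: k_def power_le_one)
  \<comment> \<open>Large enough for the lower bound (1 + S1) / 2 * k^s to reach the target K + 1 at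
    the end of the path.\<close>
  define S1 where "S1 = 2 * (K + 1) / k powr s"
  have S1: "0 \<le> S1" using K by (simp add: S1_def)
  have S1k: "(1 + S1) / 2 * k powr s \<ge> K + 1"
    using k by (simp add: S1_def field_simps)
  have "\<exists>v\<in>muckenhoupt s. Ap_const s v = ennreal (K + 1) \<and> (\<forall>x. u x \<le> v x \<and> v x \<le> (1 + S1) * u x)"
    if u: "u \<in> muckenhoupt s" and uK: "Ap_const s u \<le> ennreal K" for u :: "real ^ 'n \<Rightarrow> real"
  proof -
    have [measurable]: "u \<in> borel_measurable lebesgue" and u0: "0 \<le> u x" for x
      using u by (auto simp: muckenhoupt_def weight_def)
    let ?Q1 = "cube (0 :: real ^ 'n) 1" and ?T = "triple (0 :: real ^ 'n) 1"
    let ?Q2 = "?T - ?Q1"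
    have sub: "?Q1 \<subseteq> ?T" by (rule cube_subset_triple) simp
    have m1: "ennreal k * emeasure lebesgue ?T \<le> emeasure lebesgue ?Q1"
      using k by (simp add: emeasure_cube emeasure_triple k_def ennreal_mult[symmetric] power_mult_distrib[symmetric])
    have m2: "ennreal k * emeasure lebesgue ?T \<le> emeasure lebesgue ?Q2"
    proof -
      have "emeasure lebesgue ?Q2 = emeasure lebesgue ?T - emeasure lebesgue ?Q1"
        using sub by (intro emeasure_Diff) (auto simp: emeasure_cube)
      also have "\<dots> = ennreal (3 ^ CARD('n) - 1)"
        using ennreal_minus[of 1 "3 ^ CARD('n)"] by (simp add: emeasure_cube emeasure_triple)
      finally have Q2: "emeasure lebesgue ?Q2 = ennreal (3 ^ CARD('n) - 1)" .
      have "(3::real) ^ 1 \<le> 3 ^ CARD('n)" by (rule power_increasing) (auto simp: Suc_le_eq)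
      then show ?thesis
        using k by (simp add: Q2 emeasure_triple k_def ennreal_mult[symmetric] power_mult_distrib[symmetric])
    qed
    \<comment> \<open>The heavier piece will be raised. Which one it is depends on u, but the share
      k does not.\<close>
    obtain E E' where E [measurable]: "E \<in> sets lebesgue" "E' \<in> sets lebesgue" and EQ: "E \<union> E' = ?T" "E \<inter> E' = {}"
      and big: "mass u E' \<le> mass u E" and kE: "ennreal k * emeasure lebesgue ?T \<le> emeasure lebesgue E'"
    proof (cases "mass u ?Q1 \<le> mass u ?Q2")
      case True
      then show ?thesis using sub m1 by (intro that[of ?Q2 ?Q1]) auto
    next
      case False
      then show ?thesis using sub m2 by (intro that[of ?Q1 ?Q2]) auto
    qed
    define v where "v S x = u x * (1 + S * indicator E x)" for S x
    have [measurable]: "v S \<in> borel_measurable lebesgue" for S unfolding v_def by measurable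
    have v_le: "v S x \<le> v S' x" if "S \<le> S'" for S S' x
      using that u0 by (auto simp: v_def indicator_def intro!: mult_left_mono)
    have v_ge: "v S' x \<le> (1 + (S' - S)) * v S x" if "0 \<le> S" "S \<le> S'" for S S' x
    proof -
      have "u x * (1 + S') \<le> (1 + (S' - S)) * (u x * (1 + S))"
      proof -
        have "1 + S' \<le> (1 + (S' - S)) * (1 + S)" using that mult_right_mono[of S S' S] by (simp add: algebra_simps)
        then have "u x * (1 + S') \<le> u x * ((1 + (S' - S)) * (1 + S))" by (intro mult_left_mono u0)
        then show ?thesis by (simp only: mult_ac)
      qed
      moreover have "u x \<le> (1 + (S' - S)) * u x"
        using mult_right_mono[OF that(2) u0[of x]] by (simp add: algebra_simps)
      ultimately show ?thesis by (auto simp: v_def indicator_def)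
    qed
    have v0: "v 0 = u" by (rule ext) (simp add: v_def)
    have vm: "v S \<in> muckenhoupt s" if "0 \<le> S" for S
    proof (rule muckenhoupt_comparable(1))
      show "u x \<le> 1 * v S x" for x using v_le[OF that, of x] by (simp add: v0)
      show "v S x \<le> (1 + S) * u x" for x using v_ge[OF order_refl that, of x] by (simp add: v0)
    qed (use that s u in auto)
    define f where "f S = enn2real (Ap_const s (v S))" for S
    have f: "Ap_const s (v S) = ennreal (f S)" "0 \<le> f S" if "0 \<le> S" for S
      using vm[OF that] by (auto simp: f_def muckenhoupt_def)
    have f1: "f S' \<le> (1 + (S' - S)) * f S" and f2: "f S \<le> (1 + (S' - S)) * f S'"
      if S: "0 \<le> S" "S \<le> S'" for S S'
    proof -
      have S': "0 \<le> S'" using S by simp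
      have "Ap_const s (v S') \<le> ennreal (1 * (1 + (S' - S))) * Ap_const s (v S)"
        using S s v_le[OF S(2)] v_ge[OF S] vm[OF S(1)] by (intro muckenhoupt_comparable(2)) auto
      then show "f S' \<le> (1 + (S' - S)) * f S"
        using f(2)[OF S(1)] S unfolding f(1)[OF S(1)] f(1)[OF S'] by (simp add: ennreal_mult[symmetric] del: ennreal_plus)
      have "Ap_const s (v S) \<le> ennreal ((1 + (S' - S)) * 1) * Ap_const s (v S')"
        using S s v_le[OF S(2)] v_ge[OF S] vm[OF S'] by (intro muckenhoupt_comparable(2)) auto
      then show "f S \<le> (1 + (S' - S)) * f S'"
        using f(2)[OF S'] S unfolding f(1)[OF S(1)] f(1)[OF S'] by (simp add: ennreal_mult[symmetric] del: ennreal_plus)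
    qed
    define L where "L = (1 + S1) * f 0"
    have L: "0 \<le> L" using S1 f(2)[of 0] by (simp add: L_def)
    have fL: "f S \<le> L" if "0 \<le> S" "S \<le> S1" for S
    proof -
      have "f S \<le> (1 + S) * f 0" using f1[of 0 S] that by simp
      also have "\<dots> \<le> L" unfolding L_def using that f(2)[of 0] by (intro mult_right_mono) auto
      finally show ?thesis .
    qed
    \<comment> \<open>Two weights on the path differ at most by the factor 1 + (S' - S), hence so do
      their constants; with the bound L this gives Lipschitz dependence on S.\<close>
    have lip: "\<bar>f S' - f S\<bar> \<le> L * (S' - S)" if S: "0 \<le> S" "S \<le> S'" "S' \<le> S1" for S S'
    proof -
      have "(S' - S) * f S \<le> (S' - S) * L" "(S' - S) * f S' \<le> (S' - S) * L"
        using S by (auto intro!: mult_left_mono fL)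
      then show ?thesis using f1[OF S(1,2)] f2[OF S(1,2)] by (simp add: algebra_simps abs_le_iff)
    qed
    have "L-lipschitz_on {0..S1} f"
    proof (rule lipschitz_onI)
      fix x y assume "x \<in> {0..S1}" "y \<in> {0..S1}"
      then show "dist (f x) (f y) \<le> L * dist x y"
        using lip[of x y] lip[of y x] by (cases "x \<le> y") (auto simp: dist_real_def abs_minus_commute)
    qed (rule L)
    then have cont: "continuous_on {0..S1} f" by (rule lipschitz_on_continuous_on)
    have "ennreal (f 0) \<le> ennreal K" using uK f(1)[of 0] by (simp add: v0)
    then have "f 0 \<le> K + 1" using K by simp
    moreover have "K + 1 \<le> f S1"
    proof -
      have "ennreal ((1 + S1) / 2 * k powr s) \<le> Ap_const s (v S1)"
        using EQ S1 by (intro Ap_const_ge_split[OF s u vm S1 triple_in_cubes[of 1 0] E EQ big _ _ k kE])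
          (auto simp: v_def indicator_def)
      then have "(1 + S1) / 2 * k powr s \<le> f S1" using f[OF S1] by simp
      then show ?thesis using S1k by simp
    qed
    ultimately obtain S where S: "0 \<le> S" "S \<le> S1" "f S = K + 1"
      using IVT'[OF _ _ S1 cont] by blast
    have "\<forall>x. u x \<le> v S x \<and> v S x \<le> (1 + S1) * u x"
    proof (intro allI conjI)
      fix x
      show "u x \<le> v S x" using v_le[of 0 S x] S by (simp add: v0)
      have "v S x \<le> (1 + S) * u x" using v_ge[of 0 S x] S by (simp add: v0)
      also have "\<dots> \<le> (1 + S1) * u x" using S u0 by (intro mult_right_mono) auto
      finally show "v S x \<le> (1 + S1) * u x" .
    qed
    then show ?thesis using vm[OF S(1)] f(1)[OF S(1)] S(3) by (intro bexI[of _ "v S"]) auto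
  qed
  then show ?thesis using S1 by (intro exI[of _ "1 + S1"]) auto
qed

subsection \<open>Weights adapted to a cube\<close>

definition dilate :: "real ^ 'n \<Rightarrow> real \<Rightarrow> nat \<Rightarrow> (real ^ 'n) set" where
  "dilate a l k = cube (\<chi> i. a $ i - (3 ^ k - 1) / 2 * l) (3 ^ k * l)"

lemma dilate_0 [simp]: "dilate a l 0 = cube a l"
  by (simp add: dilate_def)

lemma dilate_Suc: "dilate a l (Suc k) = triple (\<chi> i. a $ i - (3 ^ k - 1) / 2 * l) (3 ^ k * l)"
  unfolding dilate_def triple_def by (rule arg_cong2[where f=cube]) (auto simp: vec_eq_iff field_simps)

lemma dilate_in_cubes [simp, intro]: "0 < l \<Longrightarrow> dilate a l k \<in> cubes"
  by (simp add: dilate_def)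

lemma dilate_measurable [measurable, simp]: "dilate a l k \<in> sets lebesgue"
  by (simp add: dilate_def)

lemma mem_dilate: "x \<in> dilate a l k \<longleftrightarrow> (\<forall>i. \<bar>x $ i - (a $ i + l / 2)\<bar> \<le> 3 ^ k * l / 2)"
  unfolding dilate_def mem_cube abs_le_iff by (intro all_cong1) (auto simp: field_simps)

lemma dilate_mono: "0 \<le> l \<Longrightarrow> j \<le> k \<Longrightarrow> dilate a l j \<subseteq> dilate a l k"
proof
  fix x assume l: "0 \<le> l" "j \<le> k" "x \<in> dilate a l j"
  have "(3::real) ^ j * l / 2 \<le> 3 ^ k * l / 2"
    using l by (intro divide_right_mono mult_right_mono power_increasing) auto
  with l(3) show "x \<in> dilate a l k" unfolding mem_dilate by (meson order_trans)
qed

lemma emeasure_dilate: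
  fixes a :: "real ^ 'n"
  shows "0 < l \<Longrightarrow> emeasure lebesgue (dilate a l k) = ennreal ((3 ^ k * l) ^ CARD('n))"
  by (simp add: dilate_def emeasure_cube)

lemma bounded_subset_dilate:
  fixes S :: "(real ^ 'n) set"
  assumes l: "0 < l" and "bounded S"
  shows "\<exists>k. S \<subseteq> dilate a l k"
proof -
  define c :: "real ^ 'n" where "c = (\<chi> i. a $ i + l / 2)"
  have "bounded ((\<lambda>x. x - c) ` S)" using assms(2) by (rule bounded_translation_minus)
  then obtain B where B: "\<And>x. x \<in> S \<Longrightarrow> norm (x - c) \<le> B" by (auto simp: bounded_iff)
  obtain k where "B / (l / 2) < 3 ^ k" using real_arch_pow[of 3 "B / (l / 2)"] by auto
  then have k: "B < 3 ^ k * l / 2" using l by (simp add: field_simps)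
  have "S \<subseteq> dilate a l k"
    unfolding mem_dilate subset_eq
  proof (intro ballI allI)
    fix x i assume "x \<in> S"
    have "\<bar>(x - c) $ i\<bar> \<le> 3 ^ k * l / 2"
      using component_le_norm_cart[of "x - c" i] B[OF \<open>x \<in> S\<close>] k by linarith
    then show "\<bar>x $ i - (a $ i + l / 2)\<bar> \<le> 3 ^ k * l / 2" by (simp add: c_def)
  qed
  then show ?thesis ..
qed

text \<open>Let t be half the side of the k-th dilate. Points of the cube in that dilate and outside
  the next one lie more than 2 t apart in some coordinate, so h > 2 t. The larger dilate is then
  within 9 t + t + h / 2 < 11 h / 2 of the centre of the cube in each coordinate; this exceeds 9 h /
  2 but not 27 h / 2, whence the third dilate.\<close>

lemma dilate_subset_of_meets:
  assumes l: "0 < l" and h: "0 < h" and ne: "\<not> cube b h \<subseteq> dilate a l (Suc k)"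
    and meets: "cube b h \<inter> dilate a l k \<noteq> {}"
  shows "dilate a l (Suc (Suc k)) \<subseteq> dilate b h 3"
proof
  fix z assume z: "z \<in> dilate a l (Suc (Suc k))"
  define t where "t = 3 ^ k * l / 2"
  obtain x where x: "x \<in> cube b h" "x \<notin> dilate a l (Suc k)" using ne by blast
  obtain y where y: "y \<in> cube b h" "y \<in> dilate a l k" using meets by blast
  have y': "\<bar>y $ j - (a $ j + l / 2)\<bar> \<le> t" for j
    using y(2) unfolding mem_dilate t_def by (simp add: mult.assoc)
  have z': "\<bar>z $ j - (a $ j + l / 2)\<bar> \<le> 9 * t" for j
    using z unfolding mem_dilate t_def by (simp add: mult.assoc)
  have "\<exists>i. \<not> \<bar>x $ i - (a $ i + l / 2)\<bar> \<le> 3 * t"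
    using x(2) unfolding mem_dilate t_def by (simp add: mult.assoc)
  then obtain i where i: "3 * t < \<bar>x $ i - (a $ i + l / 2)\<bar>" by (auto simp: not_le)
  have xb: "b $ j \<le> x $ j" "x $ j \<le> b $ j + h" and yb: "b $ j \<le> y $ j" "y $ j \<le> b $ j + h" for j
    using x(1) y(1) by (auto simp: mem_cube)
  have "2 * t < h" using i y'[of i] xb[of i] yb[of i] by linarith
  then show "z \<in> dilate b h 3"
    unfolding mem_dilate
  proof (intro allI)
    fix j
    have e: "(3::real) ^ 3 * h / 2 = 27 * h / 2" by simp
    show "\<bar>z $ j - (b $ j + h / 2)\<bar> \<le> 3 ^ 3 * h / 2"
      unfolding e using \<open>2 * t < h\<close> h y'[of j] z'[of j] yb[of j] unfolding abs_le_iff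
      by (intro conjI; linarith)
  qed
qed

lemma doubling_dilate:
  assumes D: "doubling D w" and l: "0 < l"
  shows "mass w (dilate a l k) \<le> ennreal (D ^ k) * mass w (cube a l)"
proof (induction k)
  case (Suc k)
  have "mass w (dilate a l (Suc k)) \<le> ennreal D * mass w (dilate a l k)"
    unfolding dilate_Suc dilate_def[of a l k] using l by (intro doublingD(5)[OF D]) auto
  also have "\<dots> \<le> ennreal D * (ennreal (D ^ k) * mass w (cube a l))"
    by (intro mult_left_mono Suc) auto
  finally show ?case using doublingD(2)[OF D] by (simp add: ennreal_mult mult.assoc)
qed simp

text \<open>Outside the dilate of index m - 1 and inside that of index m, the multiplier is the tail
  sum of \<phi> from m on, comparable to \<phi> m under geometric decay. Writing it with full cubes
  instead of rings turns integrals against it into sums of integrals over cubes.\<close>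

definition annular_weight :: "real ^ 'n \<Rightarrow> real \<Rightarrow> (nat \<Rightarrow> real) \<Rightarrow> (real ^ 'n \<Rightarrow> ennreal) \<Rightarrow> real ^ 'n \<Rightarrow> ennreal" where
  "annular_weight a l \<phi> w x = w x * (\<Sum>k. ennreal (\<phi> k) * indicator (dilate a l k) x)"

lemma annular_weight_measurable [measurable (raw)]:
  assumes [measurable]: "w \<in> borel_measurable lebesgue"
  shows "annular_weight a l \<phi> w \<in> borel_measurable lebesgue"
  unfolding annular_weight_def by measurable

lemma annular_weight_ge:
  assumes "x \<in> dilate a l m"
  shows "ennreal (\<phi> m) * w x \<le> annular_weight a l \<phi> w x"
proof -
  have "ennreal (\<phi> m) \<le> (\<Sum>k. ennreal (\<phi> k) * indicator (dilate a l k) x)"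
    using sum_le_suminf[of "\<lambda>k. ennreal (\<phi> k) * indicator (dilate a l k) x" "{m}"] assms by simp
  then show ?thesis by (simp add: annular_weight_def mult.commute[of _ "w x"] mult_left_mono)
qed

lemma mass_annular_weight:
  assumes [measurable]: "w \<in> borel_measurable lebesgue" "g \<in> borel_measurable lebesgue" "A \<in> sets lebesgue"
  shows "mass (\<lambda>x. g x * annular_weight a l \<phi> w x) A =
    (\<Sum>k. ennreal (\<phi> k) * mass (\<lambda>x. g x * w x) (A \<inter> dilate a l k))"
proof -
  have "mass (\<lambda>x. g x * annular_weight a l \<phi> w x) A =
      mass (\<lambda>x. \<Sum>k. ennreal (\<phi> k) * (g x * w x * indicator (dilate a l k) x)) A"
    unfolding annular_weight_def by (intro mass_cong_AE) (simp add: ennreal_suminf_cmult[symmetric] mult_ac del: ennreal_suminf_cmult)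
  also have "\<dots> = (\<Sum>k. ennreal (\<phi> k) * mass (\<lambda>x. g x * w x * indicator (dilate a l k) x) A)"
    by (simp add: mass_suminf mass_cmult)
  also have "\<dots> = (\<Sum>k. ennreal (\<phi> k) * mass (\<lambda>x. g x * w x) (A \<inter> dilate a l k))"
    unfolding mass_def by (simp add: indicator_inter_arith mult.assoc mult.commute[of "indicator A _"])
  finally show ?thesis .
qed

text \<open>The multiplier of \<open>w\<close> is an \<open>A\<^sub>1\<close> weight with respect to the measure \<open>w dx\<close>.\<close>

lemma apw_annular_weight:
  fixes w :: "real ^ 'n \<Rightarrow> ennreal"
  assumes p: "1 < p" and K: "0 \<le> K" and w: "apw p K w" and l: "0 < l"
    and \<phi>: "\<And>k. 0 < \<phi> k" and C: "0 \<le> C"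
    and tail: "\<And>m. (\<Sum>k. ennreal (\<phi> (k + m))) \<le> ennreal (C * \<phi> m)"
    and step: "\<And>k. \<phi> k \<le> C * \<phi> (Suc k)"
    and head: "\<And>m. (\<Sum>k\<le>m. ennreal (\<phi> k) * mass w (dilate a l k)) \<le> ennreal (C * \<phi> m) * mass w (dilate a l m)"
  shows "apw p ((2 * C + C * (K * (3 ^ CARD('n)) powr p) ^ 3) * K) (annular_weight a l \<phi> w)"
proof -
  note [measurable] = apw_measurable[OF w]
  let ?W = "annular_weight a l \<phi> w"
  define D where "D = K * (3 ^ CARD('n)) powr p"
  have D: "doubling D w" unfolding D_def by (rule apw_doubling[OF p K w])
  have D0: "0 \<le> D" by (rule doublingD(2)[OF D])
  define C' where "C' = 2 * C + C * D ^ 3"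
  have C': "0 \<le> C'" using C D0 by (simp add: C'_def)
  have pos: "AE x in lebesgue. 0 < ?W x \<and> ?W x < top"
    using apw_AE[OF w]
  proof eventually_elim
    case (elim x)
    have "(\<Sum>k. ennreal (\<phi> k) * indicator (dilate a l k) x) \<le> (\<Sum>k. ennreal (\<phi> (k + 0)))"
      by (intro suminf_le) (auto simp: indicator_def)
    also have "\<dots> \<le> ennreal (C * \<phi> 0)" by (rule tail)
    also have "\<dots> < top" by simp
    finally have fin: "?W x < top" using elim by (simp add: annular_weight_def ennreal_mult_less_top)
    obtain k where "x \<in> dilate a l k" using bounded_subset_dilate[OF l, of "{x}" a] by auto
    then have "ennreal (\<phi> k) * w x \<le> ?W x" by (rule annular_weight_ge)
    moreover have "0 < ennreal (\<phi> k) * w x" using elim \<phi> by (simp add: ennreal_zero_less_mult_iff)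
    ultimately show ?case using fin by (auto intro: less_le_trans)
  qed
  \<comment> \<open>For the least m with R inside the m-th dilate, the multiplier is at least \<phi>
    m on R. What remains is that its average over R in the measure w dx is at most a constant times
    \<phi> m.\<close>
  have main: "\<exists>m. R \<subseteq> dilate a l m \<and> mass ?W R \<le> ennreal (C' * \<phi> m) * mass w R" if R: "R \<in> cubes" for R
  proof -
    obtain b h where bh: "0 < h" "R = cube b h" using R by (rule cubesE)
    have "bounded R" unfolding bh(2) cube_def by (rule bounded_cbox)
    then obtain m0 where "R \<subseteq> dilate a l m0" using bounded_subset_dilate[OF l] by blast
    define m where "m = (LEAST m. R \<subseteq> dilate a l m)"
    have m: "R \<subseteq> dilate a l m" unfolding m_def using \<open>R \<subseteq> dilate a l m0\<close> by (rule LeastI)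
    have least: "\<not> R \<subseteq> dilate a l j" if "j < m" for j
      using not_less_Least that unfolding m_def by blast
    define M where "M k = mass w (R \<inter> dilate a l k)" for k
    have M1: "M k \<le> mass w R" "M k \<le> mass w (dilate a l k)" for k
      unfolding M_def by (auto intro!: mass_mono_set)
    have "(\<Sum>k<m. ennreal (\<phi> k) * M k) \<le> ennreal ((C + C * D ^ 3) * \<phi> m) * mass w R"
    proof (cases m)
      case 0
      then show ?thesis by simp
    next
      case (Suc j)
      \<comment> \<open>The index m - 1 is split off by \<open>step\<close>. For smaller indices a
        full ring separates the dilate of index m - 2 from the outside of the next one, so R is
        large as soon as it meets the former.\<close>
      have 1: "ennreal (\<phi> j) * M j \<le> ennreal (C * \<phi> m) * mass w R"
        unfolding Suc by (intro mult_mono ennreal_leI step M1) auto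
      have 2: "(\<Sum>k<j. ennreal (\<phi> k) * M k) \<le> ennreal (C * D ^ 3 * \<phi> m) * mass w R"
      proof (cases j)
        case 0
        then show ?thesis by simp
      next
        case (Suc i)
        have m2: "m = Suc (Suc i)" by (simp add: Suc \<open>m = Suc j\<close>)
        show ?thesis
        proof (cases "R \<inter> dilate a l i = {}")
          case True
          have "M k = 0" if "k < j" for k
          proof -
            have "R \<inter> dilate a l k = {}" using True dilate_mono[of l k i a] that l Suc by fastforce
            then show ?thesis by (simp add: M_def mass_def)
          qed
          then show ?thesis by simp
        next
          case False
          \<comment> \<open>R is now comparable to the m-th dilate or larger, so three doublings
            bound the mass of the dilate by that of R, and the head condition applies.\<close>
          have "dilate a l m \<subseteq> dilate b h 3"
            unfolding m2 using False least[of "Suc i"] m2 l bh by (intro dilate_subset_of_meets) auto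
          then have "mass w (dilate a l m) \<le> mass w (dilate b h 3)" by (rule mass_mono_set)
          also have "\<dots> \<le> ennreal (D ^ 3) * mass w R"
            unfolding bh(2) by (rule doubling_dilate[OF D bh(1)])
          finally have 3: "mass w (dilate a l m) \<le> ennreal (D ^ 3) * mass w R" .
          have "(\<Sum>k<j. ennreal (\<phi> k) * M k) \<le> (\<Sum>k\<le>m. ennreal (\<phi> k) * mass w (dilate a l k))"
            using Suc m2 by (intro order_trans[OF sum_mono sum_mono2] mult_left_mono M1) auto
          also have "\<dots> \<le> ennreal (C * \<phi> m) * mass w (dilate a l m)" by (rule head)
          also have "\<dots> \<le> ennreal (C * \<phi> m) * (ennreal (D ^ 3) * mass w R)"
            by (intro mult_left_mono 3) auto
          also have "\<dots> = ennreal (C * D ^ 3 * \<phi> m) * mass w R"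
            using C D0 \<phi>[of m] by (simp add: ennreal_mult mult_ac)
          finally show ?thesis .
        qed
      qed
      have "(\<Sum>k<m. ennreal (\<phi> k) * M k) = (\<Sum>k<j. ennreal (\<phi> k) * M k) + ennreal (\<phi> j) * M j"
        by (simp add: Suc)
      also have "\<dots> \<le> ennreal (C * D ^ 3 * \<phi> m) * mass w R + ennreal (C * \<phi> m) * mass w R"
        by (intro add_mono 1 2)
      also have "\<dots> = ennreal ((C + C * D ^ 3) * \<phi> m) * mass w R"
      proof -
        have "ennreal (C * D ^ 3 * \<phi> m) + ennreal (C * \<phi> m) = ennreal ((C + C * D ^ 3) * \<phi> m)"
          using C D0 \<phi>[of m] by (simp add: ennreal_plus[symmetric] algebra_simps del: ennreal_plus)
        then show ?thesis by (simp only: distrib_right[symmetric])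
      qed
      finally show ?thesis .
    qed
    moreover have "(\<Sum>k. ennreal (\<phi> (k + m)) * M (k + m)) \<le> ennreal (C * \<phi> m) * mass w R"
    proof -
      have "(\<Sum>k. ennreal (\<phi> (k + m)) * M (k + m)) \<le> (\<Sum>k. ennreal (\<phi> (k + m)) * mass w R)"
        by (intro suminf_le mult_left_mono M1) auto
      also have "\<dots> = (\<Sum>k. ennreal (\<phi> (k + m))) * mass w R" by simp
      also have "\<dots> \<le> ennreal (C * \<phi> m) * mass w R" by (intro mult_right_mono tail) auto
      finally show ?thesis .
    qed
    moreover have "mass ?W R = (\<Sum>k. ennreal (\<phi> (k + m)) * M (k + m)) + (\<Sum>k<m. ennreal (\<phi> k) * M k)"
      using mass_annular_weight[of w "\<lambda>_. 1" R a l \<phi>] R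
      by (simp add: M_def suminf_offset[of "\<lambda>k. ennreal (\<phi> k) * mass w (R \<inter> dilate a l k)" m] add.commute)
    ultimately have "mass ?W R \<le> ennreal (C * \<phi> m) * mass w R + ennreal ((C + C * D ^ 3) * \<phi> m) * mass w R"
      by (simp add: add_mono)
    also have "\<dots> = ennreal (C' * \<phi> m) * mass w R"
    proof -
      have "ennreal (C * \<phi> m) + ennreal ((C + C * D ^ 3) * \<phi> m) = ennreal (C' * \<phi> m)"
        using C D0 \<phi>[of m] by (simp add: C'_def ennreal_plus[symmetric] algebra_simps del: ennreal_plus)
      then show ?thesis by (simp only: distrib_right[symmetric])
    qed
    finally show ?thesis using m by blast
  qed
  have "mass ?W R * epow (mass (dual_weight p ?W) R) (p - 1) \<le> ennreal (C' * K) * epow (emeasure lebesgue R) p"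
    if R: "R \<in> cubes" for R
  proof -
    obtain m where m: "R \<subseteq> dilate a l m" "mass ?W R \<le> ennreal (C' * \<phi> m) * mass w R" using main[OF R] by blast
    let ?e = "- 1 / (p - 1)"
    \<comment> \<open>The lower bound \<phi> m of the multiplier yields a factor that becomes 1 /
      \<phi> m after the power p - 1 and cancels the \<phi> m in the bound for the mass of
      R.\<close>
    have "mass (dual_weight p ?W) R \<le> mass (\<lambda>x. epow (ennreal (\<phi> m)) ?e * dual_weight p w x) R"
    proof (rule mass_mono)
      fix x assume "x \<in> R"
      then have "ennreal (\<phi> m) * w x \<le> ?W x" using m by (intro annular_weight_ge) auto
      then have "epow (?W x) ?e \<le> epow (ennreal (\<phi> m) * w x) ?e" using p by (intro epow_antimono) auto
      also have "\<dots> = epow (ennreal (\<phi> m)) ?e * epow (w x) ?e" using \<phi> by (intro epow_mult_pos) auto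
      finally show "dual_weight p ?W x \<le> epow (ennreal (\<phi> m)) ?e * dual_weight p w x"
        by (simp add: dual_weight_def)
    qed
    also have "\<dots> = epow (ennreal (\<phi> m)) ?e * mass (dual_weight p w) R"
      using R by (intro mass_cmult) auto
    finally have "epow (mass (dual_weight p ?W) R) (p - 1) \<le> epow (epow (ennreal (\<phi> m)) ?e * mass (dual_weight p w) R) (p - 1)"
      using p by (intro epow_mono) auto
    also have "\<dots> = ennreal (1 / \<phi> m) * epow (mass (dual_weight p w) R) (p - 1)"
    proof -
      have "?e * (p - 1) = - 1" using p by simp
      then have "epow (epow (ennreal (\<phi> m)) ?e) (p - 1) = ennreal (1 / \<phi> m)"
        unfolding epow_epow using \<phi>[of m] by (simp add: powr_minus_divide)
      then show ?thesis using p by (simp add: epow_mult)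
    qed
    finally have "mass ?W R * epow (mass (dual_weight p ?W) R) (p - 1) \<le>
        (ennreal (C' * \<phi> m) * mass w R) * (ennreal (1 / \<phi> m) * epow (mass (dual_weight p w) R) (p - 1))"
      using m(2) by (intro mult_mono) auto
    also have "\<dots> = ennreal (C' * \<phi> m) * ennreal (1 / \<phi> m) * (mass w R * epow (mass (dual_weight p w) R) (p - 1))"
      by (simp only: mult_ac)
    also have "ennreal (C' * \<phi> m) * ennreal (1 / \<phi> m) = ennreal C'"
      using C' \<phi>[of m] by (simp add: ennreal_mult[symmetric])
    also have "ennreal C' * (mass w R * epow (mass (dual_weight p w) R) (p - 1)) \<le> ennreal C' * (ennreal K * epow (emeasure lebesgue R) p)"
      by (intro mult_left_mono apwD w R) auto
    also have "\<dots> = ennreal (C' * K) * epow (emeasure lebesgue R) p"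
      using C' K by (simp add: ennreal_mult mult.assoc)
    finally show ?thesis .
  qed
  then show ?thesis
    using pos unfolding apw_def C'_def D_def by auto
qed

lemma annular_weight_morrey:
  fixes w g :: "real ^ 'n \<Rightarrow> ennreal"
  assumes [measurable]: "w \<in> borel_measurable lebesgue" "g \<in> borel_measurable lebesgue"
    and bound: "\<And>k. mass (\<lambda>x. g x * w x) (dilate a l k) \<le> b k * X"
    and sum: "(\<Sum>k. ennreal (\<phi> k) * b k) \<le> ennreal C * b 0"
  shows "(\<integral>\<^sup>+x. g x * annular_weight a l \<phi> w x \<partial>lebesgue) \<le> ennreal C * b 0 * X"
proof -
  have "(\<integral>\<^sup>+x. g x * annular_weight a l \<phi> w x \<partial>lebesgue) = mass (\<lambda>x. g x * annular_weight a l \<phi> w x) UNIV"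
    by (simp add: mass_def)
  also have "\<dots> = (\<Sum>k. ennreal (\<phi> k) * mass (\<lambda>x. g x * w x) (dilate a l k))"
    by (subst mass_annular_weight) auto
  also have "\<dots> \<le> (\<Sum>k. ennreal (\<phi> k) * b k * X)"
    using bound by (intro suminf_le) (auto simp: mult.assoc intro: mult_left_mono)
  also have "\<dots> = (\<Sum>k. ennreal (\<phi> k) * b k) * X" by simp
  also have "\<dots> \<le> ennreal C * b 0 * X" by (intro mult_right_mono sum) auto
  finally show ?thesis .
qed

section \<open>Sums of geometrically controlled sequences\<close>

lemma geometric_tail:
  fixes x :: "nat \<Rightarrow> real"
  assumes pos: "\<And>k. 0 \<le> x k" and r: "0 \<le> r" "r < 1" and step: "\<And>k. x (Suc k) \<le> r * x k"
  shows "(\<Sum>k. ennreal (x (k + m))) \<le> ennreal (1 / (1 - r) * x m)"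
proof -
  have "x (k + m) \<le> r ^ k * x m" for k
  proof (induction k)
    case (Suc k)
    have "x (Suc k + m) \<le> r * x (k + m)" using step[of "k + m"] by simp
    also have "\<dots> \<le> r * (r ^ k * x m)" by (intro mult_left_mono Suc r)
    finally show ?case by (simp add: mult.assoc)
  qed simp
  then have "(\<Sum>k. ennreal (x (k + m))) \<le> (\<Sum>k. ennreal (r ^ k * x m))"
    by (intro suminf_le ennreal_leI) auto
  also have "\<dots> = ennreal (1 / (1 - r) * x m)"
  proof (rule suminf_ennreal_eq)
    show "(\<lambda>k. r ^ k * x m) sums (1 / (1 - r) * x m)"
      using r by (intro sums_mult2 geometric_sums) auto
  qed (use pos r in auto)
  finally show ?thesis .
qed

lemma geometric_head:
  fixes x :: "nat \<Rightarrow> real"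
  assumes pos: "\<And>k. 0 \<le> x k" and r: "0 \<le> r" "r < 1" and step: "\<And>k. x k \<le> r * x (Suc k)"
  shows "(\<Sum>k\<le>m. x k) \<le> 1 / (1 - r) * x m"
proof (induction m)
  case 0
  show ?case using pos[of 0] r by (simp add: field_simps mult_left_mono)
next
  case (Suc m)
  have "1 / (1 - r) * x m \<le> 1 / (1 - r) * (r * x (Suc m))"
    using step[of m] r by (intro mult_left_mono) auto
  then have "(\<Sum>k\<le>Suc m. x k) \<le> 1 / (1 - r) * (r * x (Suc m)) + x (Suc m)"
    unfolding sum.atMost_Suc using Suc by linarith
  also have "\<dots> = 1 / (1 - r) * x (Suc m)" using r by (simp add: field_simps)
  finally show ?case .
qed

subsection \<open>Localising weights for the two Morrey norms\<close>

text \<open>In the application g is the p-th power of a function, X the p-th power of its Morrey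
  norm, \<mu> the gauge of that norm, and the exponent of \<open>apw\<close> is p / \<gamma>.
  \<open>K\<close> and \<open>C\<close> are parameters because they must be common to all
  cubes.\<close>

definition localising ::
  "real \<Rightarrow> real \<Rightarrow> real \<Rightarrow> real \<Rightarrow> ((real ^ 'n) set \<Rightarrow> ennreal) \<Rightarrow> (real ^ 'n \<Rightarrow> ennreal) \<Rightarrow> (real ^ 'n) set \<Rightarrow> bool" where
  "localising p K C \<kappa> \<mu> w Q \<longleftrightarrow> (\<exists>W. apw p K W \<and> (\<forall>x\<in>Q. w x \<le> W x) \<and>
     (\<forall>g\<in>borel_measurable lebesgue. \<forall>X. (\<forall>R\<in>cubes. mass (\<lambda>x. g x * w x) R \<le> epow (\<mu> R) \<kappa> * X) \<longrightarrow>
        (\<integral>\<^sup>+x. g x * W x \<partial>lebesgue) \<le> ennreal C * epow (\<mu> Q) \<kappa> * X))"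

text \<open>\<open>M\<close> and \<open>m\<close> are the values of w and of the gauge on the
  dilates. Two demands compete: \<phi> k * y k must grow geometrically, for the Muckenhoupt
  condition, and \<phi> k * (m k)^\<kappa> must decay geometrically, for the Morrey sum. The
  sequence \<open>y\<close> is a substitute for \<open>M\<close>, comparable to it, whose growth can
  be controlled at every single step.\<close>

lemma localising_annular:
  fixes w :: "real ^ 'n \<Rightarrow> ennreal"
  assumes p: "1 < p" and K: "0 \<le> K" and w: "apw p K w" and l: "0 < l"
    and r: "0 < r" "r < 1" and B: "0 \<le> B" and c: "0 \<le> c"
    and \<phi>: "\<And>k. 0 < \<phi> k" "\<phi> 0 = 1" "\<And>k. \<phi> (Suc k) \<le> r * \<phi> k" "\<And>k. \<phi> k \<le> B * \<phi> (Suc k)"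
    and M: "\<And>k. 0 < M k" "\<And>k. mass w (dilate a l k) = ennreal (M k)"
    and y: "\<And>k. M k \<le> y k" "\<And>k. y k \<le> c * M k" "\<And>k. \<phi> k * y k \<le> r * (\<phi> (Suc k) * y (Suc k))"
    and m: "\<And>k. 0 < m k" "\<And>k. \<mu> (dilate a l k) = ennreal (m k)"
      "\<And>k. \<phi> (Suc k) * m (Suc k) powr \<kappa> \<le> r * (\<phi> k * m k powr \<kappa>)"
    and C: "C = (1 + c) / (1 - r) + B"
    and K': "K' = (2 * C + C * (K * (3 ^ CARD('n)) powr p) ^ 3) * K"
  shows "localising p K' C \<kappa> \<mu> w (cube a l)"
proof -
  note [measurable] = apw_measurable[OF w]
  have "0 \<le> 1 / (1 - r)" "0 \<le> c / (1 - r)" using r c by auto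
  then have C': "0 \<le> C" "1 / (1 - r) \<le> C" "c / (1 - r) \<le> C" "B \<le> C"
    using B by (auto simp: C add_divide_distrib)
  have \<phi>' [simp]: "0 \<le> \<phi> k" for k using \<phi>(1)[of k] by simp
  have yp: "0 \<le> y k" for k using y(1)[of k] M(1)[of k] by linarith
  have tail: "(\<Sum>k. ennreal (\<phi> (k + j))) \<le> ennreal (C * \<phi> j)" for j
  proof -
    have "(\<Sum>k. ennreal (\<phi> (k + j))) \<le> ennreal (1 / (1 - r) * \<phi> j)"
      using r \<phi>(3) by (intro geometric_tail) auto
    also have "\<dots> \<le> ennreal (C * \<phi> j)" by (intro ennreal_leI mult_right_mono C') simp
    finally show ?thesis .
  qed
  have step: "\<phi> k \<le> C * \<phi> (Suc k)" for k
    using \<phi>(4)[of k] mult_right_mono[OF C'(4) \<phi>'[of "Suc k"]] by linarith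
  \<comment> \<open>Growth is assumed for y only; passing from M to y and back costs the factor
    c.\<close>
  have head: "(\<Sum>k\<le>j. ennreal (\<phi> k) * mass w (dilate a l k)) \<le> ennreal (C * \<phi> j) * mass w (dilate a l j)" for j
  proof -
    have "(\<Sum>k\<le>j. \<phi> k * M k) \<le> (\<Sum>k\<le>j. \<phi> k * y k)" by (intro sum_mono mult_left_mono y) simp
    also have "\<dots> \<le> 1 / (1 - r) * (\<phi> j * y j)"
      using yp r y(3) by (intro geometric_head) auto
    also have "\<dots> \<le> 1 / (1 - r) * (\<phi> j * (c * M j))"
      using r by (intro mult_left_mono y) auto
    also have "\<dots> = c / (1 - r) * (\<phi> j * M j)" by simp
    also have "\<dots> \<le> C * (\<phi> j * M j)" using M(1)[of j] by (intro mult_right_mono C') auto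
    finally have "ennreal (\<Sum>k\<le>j. \<phi> k * M k) \<le> ennreal (C * (\<phi> j * M j))" by (rule ennreal_leI)
    also have "ennreal (C * (\<phi> j * M j)) = ennreal (C * \<phi> j) * mass w (dilate a l j)"
      using C'(1) M[of j] by (simp add: ennreal_mult[symmetric] mult.assoc)
    also have "ennreal (\<Sum>k\<le>j. \<phi> k * M k) = (\<Sum>k\<le>j. ennreal (\<phi> k) * mass w (dilate a l k))"
      using M by (simp add: sum_ennreal[symmetric] ennreal_mult less_imp_le)
    finally show ?thesis .
  qed
  let ?W = "annular_weight a l \<phi> w"
  have "apw p K' ?W"
    unfolding K' by (rule apw_annular_weight[OF p K w l \<phi>(1) C'(1) tail step head])
  moreover have "w x \<le> ?W x" if "x \<in> cube a l" for x
    using annular_weight_ge[of x a l 0 \<phi> w] that by (simp add: \<phi>(2))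
  moreover have "(\<integral>\<^sup>+x. g x * ?W x \<partial>lebesgue) \<le> ennreal C * epow (\<mu> (cube a l)) \<kappa> * X"
    if [measurable]: "g \<in> borel_measurable lebesgue" and X: "\<forall>R\<in>cubes. mass (\<lambda>x. g x * w x) R \<le> epow (\<mu> R) \<kappa> * X" for g X
  proof -
    have "(\<integral>\<^sup>+x. g x * ?W x \<partial>lebesgue) \<le> ennreal C * epow (\<mu> (dilate a l 0)) \<kappa> * X"
    proof (rule annular_weight_morrey)
      show "mass (\<lambda>x. g x * w x) (dilate a l k) \<le> epow (\<mu> (dilate a l k)) \<kappa> * X" for k
        using X l by simp
      have "(\<Sum>k. ennreal (\<phi> (k + 0) * m (k + 0) powr \<kappa>)) \<le> ennreal (1 / (1 - r) * (\<phi> 0 * m 0 powr \<kappa>))"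
        using r m(3) by (intro geometric_tail[where x="\<lambda>k. \<phi> k * m k powr \<kappa>"]) auto
      also have "\<dots> \<le> ennreal (C * m 0 powr \<kappa>)"
        using mult_right_mono[OF C'(2), of "m 0 powr \<kappa>"] by (intro ennreal_leI) (simp add: \<phi>(2))
      finally show "(\<Sum>k. ennreal (\<phi> k) * epow (\<mu> (dilate a l k)) \<kappa>) \<le> ennreal C * epow (\<mu> (dilate a l 0)) \<kappa>"
        unfolding m(2) using m(1) C'(1) by (simp add: ennreal_mult[symmetric])
    qed measurable
    then show ?thesis by simp
  qed
  ultimately show ?thesis unfolding localising_def by blast
qed

lemma apw_mass_dilate:
  assumes p: "1 < p" and w: "apw p K w" and l: "0 < l"
  shows "0 < enn2real (mass w (dilate a l k))" "mass w (dilate a l k) = ennreal (enn2real (mass w (dilate a l k)))"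
  using apw_mass_pos[OF w, of "dilate a l k"] apw_mass_finite[OF p w, of "dilate a l k"] l
  by (simp_all add: enn2real_positive_iff)

text \<open>With \<phi> k = (M 0 / M k)^\<theta>, the product \<phi> k * M k is a multiple of (M
  k)^(1 - \<theta>), and \<phi> k * (M k)^\<kappa> one of (M k)^(\<kappa> - \<theta>). For \<kappa>
  < \<theta> < 1 reverse doubling makes the first grow and the second decay; doubling limits the
  decay of \<phi>.\<close>

lemma localising_mass:
  assumes p: "1 < p" and K: "0 \<le> K" and \<kappa>: "0 \<le> \<kappa>" "\<kappa> < 1"
  shows "\<exists>K'\<ge>0. \<exists>C\<ge>0. \<forall>(w :: real ^ 'n \<Rightarrow> ennreal) a l. apw p K w \<longrightarrow> 0 < l \<longrightarrow>
    localising p K' C \<kappa> (mass w) w (cube a l)"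
proof -
  define D where "D = K * (3 ^ CARD('n)) powr p"
  obtain \<rho> where \<rho>: "0 < \<rho>" "\<rho> < 1" and rev: "\<And>(w :: real ^ 'n \<Rightarrow> ennreal) a l. apw p K w \<Longrightarrow> 0 < l \<Longrightarrow>
      mass w (cube a l) \<le> ennreal \<rho> * mass w (triple a l)"
    using apw_reverse_doubling[OF p K, where 'n='n] by blast
  \<comment> \<open>The midpoint makes both gaps equal to 1 - \<theta>, so one ratio r serves both
    sequences; 1 - \<theta> \<le> \<theta> covers the decay of \<phi> itself.\<close>
  define \<theta> where "\<theta> = (1 + \<kappa>) / 2"
  have \<theta>: "\<kappa> < \<theta>" "\<theta> < 1" "0 < \<theta>" "\<theta> - \<kappa> = 1 - \<theta>" "1 - \<theta> \<le> \<theta>" using \<kappa> by (auto simp: \<theta>_def field_simps)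
  define r where "r = \<rho> powr (1 - \<theta>)"
  have r: "0 < r" "r < 1" using \<rho> \<theta> powr_less_mono2[of "1 - \<theta>" \<rho> 1] by (auto simp: r_def)
  have r\<theta>: "\<rho> powr \<theta> \<le> r" unfolding r_def using \<rho> \<theta> by (intro powr_mono') auto
  \<comment> \<open>The numerator is 1 + c with c = 1, since M serves as its own comparison
    sequence.\<close>
  define C where "C = (1 + 1) / (1 - r) + D powr \<theta>"
  define K' where "K' = (2 * C + C * (K * (3 ^ CARD('n)) powr p) ^ 3) * K"
  have D0: "0 \<le> D" using K by (simp add: D_def)
  have C: "0 \<le> C" using r by (simp add: C_def)
  then have K': "0 \<le> K'" using K by (simp add: K'_def)
  have "localising p K' C \<kappa> (mass w) w (cube a l)"
    if w: "apw p K w" and l: "0 < l" for w :: "real ^ 'n \<Rightarrow> ennreal" and a l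
  proof -
    define M where "M k = enn2real (mass w (dilate a l k))" for k
    note M = apw_mass_dilate[OF p w l, of a, folded M_def]
    have M_rev: "M k \<le> \<rho> * M (Suc k)" for k
    proof -
      have "mass w (dilate a l k) \<le> ennreal \<rho> * mass w (dilate a l (Suc k))"
        unfolding dilate_Suc dilate_def[of a l k] using l by (intro rev w) auto
      then show ?thesis unfolding M(2) using M(1) \<rho> by (simp add: ennreal_mult[symmetric] less_imp_le)
    qed
    have M_dbl: "M (Suc k) \<le> D * M k" for k
    proof -
      have "mass w (dilate a l (Suc k)) \<le> ennreal D * mass w (dilate a l k)"
        unfolding dilate_Suc dilate_def[of a l k] D_def using l by (intro doublingD(5)[OF apw_doubling[OF p K w]]) auto
      then show ?thesis unfolding M(2) using M(1) D0 by (simp add: ennreal_mult[symmetric] less_imp_le)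
    qed
    define \<phi> where "\<phi> k = M 0 powr \<theta> * M k powr (- \<theta>)" for k
    have \<phi>: "0 < \<phi> k" for k using M(1)[of 0] M(1)[of k] by (simp add: \<phi>_def)
    have neg: "M (Suc k) powr (- e) \<le> \<rho> powr e * M k powr (- e)" if e: "0 < e" for e k
    proof -
      have "M k / \<rho> \<le> M (Suc k)" using M_rev[of k] \<rho> by (simp add: field_simps)
      then have "M (Suc k) powr (- e) \<le> (M k / \<rho>) powr (- e)"
        using M(1)[of k] \<rho> e by (intro powr_mono2') auto
      also have "\<dots> = \<rho> powr e * M k powr (- e)"
        using M(1)[of k] \<rho> by (simp add: powr_divide powr_minus field_simps)
      finally show ?thesis .
    qed
    show ?thesis
    proof (rule localising_annular[where \<phi>=\<phi> and M=M and y=M and m=M and \<mu>="mass w",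
          OF p K w l r _ _ \<phi> _ _ _ M _ _ _ M _ C_def K'_def])
      show "\<phi> 0 = 1" using M(1)[of 0] by (simp add: \<phi>_def powr_minus)
      show "\<phi> (Suc k) \<le> r * \<phi> k" for k
      proof -
        have "M (Suc k) powr (- \<theta>) \<le> r * M k powr (- \<theta>)"
          using neg[OF \<theta>(3), of k] mult_right_mono[OF r\<theta>, of "M k powr (- \<theta>)"] by simp
        then have "M 0 powr \<theta> * M (Suc k) powr (- \<theta>) \<le> M 0 powr \<theta> * (r * M k powr (- \<theta>))"
          by (rule mult_left_mono) simp
        then show ?thesis by (simp add: \<phi>_def mult_ac)
      qed
      show "\<phi> k \<le> D powr \<theta> * \<phi> (Suc k)" for k
      proof -
        have "M (Suc k) powr \<theta> \<le> (D * M k) powr \<theta>"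
          using M_dbl[of k] M(1)[of "Suc k"] \<theta> by (intro powr_mono2) auto
        also have "\<dots> = D powr \<theta> * M k powr \<theta>" using D0 M(1)[of k] by (intro powr_mult)
        finally have "M k powr (- \<theta>) \<le> D powr \<theta> * M (Suc k) powr (- \<theta>)"
          using M(1)[of k] M(1)[of "Suc k"] by (simp add: powr_minus field_simps)
        then have "M 0 powr \<theta> * M k powr (- \<theta>) \<le> M 0 powr \<theta> * (D powr \<theta> * M (Suc k) powr (- \<theta>))"
          by (rule mult_left_mono) simp
        then show ?thesis by (simp add: \<phi>_def mult_ac)
      qed
      show "\<phi> k * M k \<le> r * (\<phi> (Suc k) * M (Suc k))" for k
      proof -
        have eq: "\<phi> k * M k = M 0 powr \<theta> * M k powr (1 - \<theta>)" for k
          using M(1)[of k] by (simp add: \<phi>_def powr_diff powr_minus_divide)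
        have "M k powr (1 - \<theta>) \<le> (\<rho> * M (Suc k)) powr (1 - \<theta>)"
          using M_rev[of k] M(1)[of k] \<theta> by (intro powr_mono2) auto
        also have "\<dots> = r * M (Suc k) powr (1 - \<theta>)"
          unfolding r_def using \<rho> M(1)[of "Suc k"] by (intro powr_mult)
        finally have "M 0 powr \<theta> * M k powr (1 - \<theta>) \<le> M 0 powr \<theta> * (r * M (Suc k) powr (1 - \<theta>))"
          by (intro mult_left_mono) auto
        then show ?thesis unfolding eq by (simp add: mult_ac)
      qed
      show "\<phi> (Suc k) * M (Suc k) powr \<kappa> \<le> r * (\<phi> k * M k powr \<kappa>)" for k
      proof -
        have eq: "\<phi> k * M k powr \<kappa> = M 0 powr \<theta> * M k powr (- (\<theta> - \<kappa>))" for k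
          using M(1)[of k] by (simp add: \<phi>_def powr_add[symmetric])
        have "M 0 powr \<theta> * M (Suc k) powr (- (\<theta> - \<kappa>)) \<le> M 0 powr \<theta> * (\<rho> powr (\<theta> - \<kappa>) * M k powr (- (\<theta> - \<kappa>)))"
          using \<theta> by (intro mult_left_mono neg) auto
        then show ?thesis unfolding eq r_def \<theta>(4) by (simp add: mult_ac)
      qed
    qed auto
  qed
  then show ?thesis using K' C by blast
qed

section \<open>The gauge |Q| and reverse Hoelder weights\<close>

lemma mass_le_power_mass:
  assumes \<sigma>: "1 < \<sigma>" and [measurable]: "w \<in> borel_measurable lebesgue" "Q \<in> sets lebesgue"
  shows "mass w Q \<le> epow (emeasure lebesgue Q) (1 - 1 / \<sigma>) * epow (mass (\<lambda>x. epow (w x) \<sigma>) Q) (1 / \<sigma>)"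
proof -
  have "mass w Q = (\<integral>\<^sup>+x. epow (epow (w x) \<sigma> * indicator Q x) (1 / \<sigma>) * epow (indicator Q x) (1 - 1 / \<sigma>) \<partial>lebesgue)"
    unfolding mass_def using \<sigma> by (intro nn_integral_cong) (auto simp: indicator_def epow_epow)
  also have "\<dots> \<le> epow (\<integral>\<^sup>+x. epow (w x) \<sigma> * indicator Q x \<partial>lebesgue) (1 / \<sigma>) * epow (\<integral>\<^sup>+x. indicator Q x \<partial>lebesgue) (1 - 1 / \<sigma>)"
    using \<sigma> by (intro Hoelder_nn_integral) auto
  finally show ?thesis by (simp add: mass_def mult.commute)
qed

text \<open>
  For \<open>w \<in> A\<^sub>p \<inter> RH\<^sub>\<sigma>\<close> the power \<open>w\<^sup>\<sigma>\<close> is again a Muckenhoupt weight. Its reverse doubling provides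
  the gain that is needed at the endpoint \<open>r = - n / (p \<sigma>)\<close>, in place of Gehring's lemma.
\<close>

lemma apw_power:
  fixes w :: "real ^ 'n \<Rightarrow> ennreal"
  assumes p: "1 < p" and K: "0 \<le> K" and \<sigma>: "1 < \<sigma>" and c: "0 \<le> c" and w: "apw p K w"
    and RH: "\<And>Q. Q \<in> cubes \<Longrightarrow> epow (avg (\<lambda>x. epow (w x) \<sigma>) Q) (1 / \<sigma>) \<le> ennreal c * avg w Q"
  shows "apw (\<sigma> * (p - 1) + 1) ((c * K) powr \<sigma>) (\<lambda>x. epow (w x) \<sigma>)"
proof -
  note [measurable] = apw_measurable[OF w]
  let ?s = "\<sigma> * (p - 1) + 1"
  \<comment> \<open>The new exponent minus 1 is \<sigma> (p - 1); this makes the dual weight of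
    w^\<sigma> coincide with that of w.\<close>
  have dual: "dual_weight ?s (\<lambda>x. epow (w x) \<sigma>) = dual_weight p w"
  proof
    fix x
    have "\<sigma> * (- 1 / (?s - 1)) = - 1 / (p - 1)" using p \<sigma> by (simp add: field_simps)
    then show "dual_weight ?s (\<lambda>x. epow (w x) \<sigma>) x = dual_weight p w x"
      by (simp only: dual_weight_def epow_epow)
  qed
  have "mass (\<lambda>x. epow (w x) \<sigma>) Q * epow (mass (dual_weight p w) Q) (?s - 1) \<le>
      ennreal ((c * K) powr \<sigma>) * epow (emeasure lebesgue Q) ?s" if Q: "Q \<in> cubes" for Q
  proof -
    define m where "m = emeasure lebesgue Q"
    have m: "0 < m" "m < top" using Q by (auto simp: m_def emeasure_cubes_pos emeasure_cubes_finite)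
    let ?S = "epow (mass (dual_weight p w) Q) (p - 1)"
    have "avg (\<lambda>x. epow (w x) \<sigma>) Q = epow (epow (avg (\<lambda>x. epow (w x) \<sigma>) Q) (1 / \<sigma>)) \<sigma>"
      using \<sigma> by (simp add: epow_epow)
    also have "\<dots> \<le> epow (ennreal c * avg w Q) \<sigma>" using \<sigma> by (intro epow_mono RH Q) auto
    finally have "mass (\<lambda>x. epow (w x) \<sigma>) Q \<le> epow (ennreal c * avg w Q) \<sigma> * m"
      unfolding mass_eq_avg[OF Q, of "\<lambda>x. epow (w x) \<sigma>"] m_def by (rule mult_right_mono) auto
    then have "mass (\<lambda>x. epow (w x) \<sigma>) Q * epow (mass (dual_weight p w) Q) (?s - 1)
        \<le> epow (ennreal c * avg w Q) \<sigma> * m * epow ?S \<sigma>"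
      by (simp add: epow_epow mult.commute[of "p - 1"] mult_right_mono)
    also have "\<dots> = epow (ennreal c * (avg w Q * ?S)) \<sigma> * m"
      using \<sigma> by (simp add: epow_mult mult_ac)
    also have "\<dots> \<le> epow (ennreal c * (ennreal K * epow m (p - 1))) \<sigma> * m"
    proof (intro mult_right_mono epow_mono mult_left_mono)
      have "avg w Q * ?S * m \<le> ennreal K * epow m p"
        using apwD[OF w Q] by (simp add: mass_eq_avg[OF Q, of w] m_def mult_ac)
      also have "epow m p = m * epow m (p - 1)" using epow_add[of 1 "p - 1" m] p by simp
      finally have "m * (avg w Q * ?S) \<le> m * (ennreal K * epow m (p - 1))"
        by (simp only: mult_ac)
      then show "avg w Q * ?S \<le> ennreal K * epow m (p - 1)"
        using m by (subst (asm) ennreal_mult_le_mult_iff) auto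
    qed (use \<sigma> in auto)
    also have "\<dots> = epow (ennreal (c * K)) \<sigma> * (epow m (\<sigma> * (p - 1)) * epow m 1)"
      using \<sigma> c K by (simp add: epow_mult epow_epow ennreal_mult mult_ac)
    also have "epow m (\<sigma> * (p - 1)) * epow m 1 = epow m ?s"
      using m by (intro epow_add_pos[symmetric])
    also have "epow (ennreal (c * K)) \<sigma> \<le> ennreal ((c * K) powr \<sigma>)"
      using c K \<sigma> by (cases "c * K = 0") auto
    finally show ?thesis by (simp add: m_def mult_right_mono)
  qed
  moreover have "AE x in lebesgue. 0 < epow (w x) \<sigma> \<and> epow (w x) \<sigma> < top"
    using apw_AE[OF w] by eventually_elim (simp add: epow_pos epow_finite)
  ultimately show ?thesis unfolding apw_def dual by simp
qed

text \<open>Volume grows exactly by N per dilation, so \<phi> can be geometric. The mass of w is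
  replaced by y k = (m k)^\<tau> * (V k)^(1/\<sigma>), with V the mass of w^\<sigma>: Hoelder gives
  M \<le> y, reverse Hoelder y \<le> c * M, and reverse doubling of w^\<sigma> makes y grow by more
  than N^\<tau> at each step.\<close>

lemma localising_volume:
  assumes p: "1 < p" and K: "0 \<le> K" and \<sigma>: "1 < \<sigma>" and c: "0 \<le> c" and \<kappa>: "0 \<le> \<kappa>" "\<kappa> \<le> 1 - 1 / \<sigma>"
  shows "\<exists>K'\<ge>0. \<exists>C\<ge>0. \<forall>(w :: real ^ 'n \<Rightarrow> ennreal) a l. apw p K w \<longrightarrow>
    (\<forall>Q\<in>cubes. epow (avg (\<lambda>x. epow (w x) \<sigma>) Q) (1 / \<sigma>) \<le> ennreal c * avg w Q) \<longrightarrow> 0 < l \<longrightarrow>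
    localising p K' C \<kappa> (emeasure lebesgue) w (cube a l)"
proof -
  define s where "s = \<sigma> * (p - 1) + 1"
  have s: "1 < s" using p \<sigma> by (simp add: s_def)
  define \<tau> where "\<tau> = 1 - 1 / \<sigma>"
  have \<tau>: "0 < \<tau>" using \<sigma> by (simp add: \<tau>_def)
  define N :: real where "N = 3 ^ CARD('n)"
  have N: "1 < N" unfolding N_def by (rule one_less_power) auto
  obtain \<delta> where \<delta>: "0 < \<delta>" "\<delta> < 1" and rev: "\<And>(w :: real ^ 'n \<Rightarrow> ennreal) a l. apw s ((c * K) powr \<sigma>) w \<Longrightarrow> 0 < l \<Longrightarrow>
      mass w (cube a l) \<le> ennreal \<delta> * mass w (triple a l)"
    using apw_reverse_doubling[OF s, of "(c * K) powr \<sigma>", where 'n='n] by auto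
  \<comment> \<open>The gain \<delta>^(1/\<sigma>) is split into two equal factors \<eta>: one makes
    \<phi> k * (m k)^\<kappa> decay even for \<kappa> = \<tau>, the other makes \<phi> k * y k
    grow.\<close>
  define \<eta> where "\<eta> = \<delta> powr (1 / (2 * \<sigma>))"
  have \<eta>: "0 < \<eta>" "\<eta> < 1" "\<delta> powr (1 / \<sigma>) = \<eta> * \<eta>"
    using \<delta> \<sigma> powr_less_mono2[of "1 / (2 * \<sigma>)" \<delta> 1] by (auto simp: \<eta>_def powr_add[symmetric])
  define g where "g = N powr (- \<tau>) * \<eta>"
  have "N powr (- \<tau>) \<le> N powr 0" using N \<tau> by (intro powr_mono) auto
  then have g: "0 < g" "g \<le> \<eta>" using N \<eta> by (auto simp: g_def mult_le_cancel_right1)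
  define C where "C = (1 + c) / (1 - \<eta>) + 1 / g"
  define K' where "K' = (2 * C + C * (K * (3 ^ CARD('n)) powr p) ^ 3) * K"
  have C: "0 \<le> C" using g \<eta> c by (simp add: C_def)
  then have K': "0 \<le> K'" using K by (simp add: K'_def)
  define \<phi> where "\<phi> k = g ^ k" for k :: nat
  have \<phi>: "0 < \<phi> k" for k using g by (simp add: \<phi>_def)
  have main: "localising p K' C \<kappa> (emeasure lebesgue) w (cube a l)"
    if w: "apw p K w" and RH: "\<And>Q. Q \<in> cubes \<Longrightarrow> epow (avg (\<lambda>x. epow (w x) \<sigma>) Q) (1 / \<sigma>) \<le> ennreal c * avg w Q"
      and l: "0 < l" for w :: "real ^ 'n \<Rightarrow> ennreal" and a l
  proof -
    note [measurable] = apw_measurable[OF w]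
    let ?v = "\<lambda>x. epow (w x) \<sigma>"
    have v: "apw s ((c * K) powr \<sigma>) ?v" unfolding s_def by (rule apw_power[OF p K \<sigma> c w RH])
    define m where "m k = N ^ k * l ^ CARD('n)" for k
    have m: "0 < m k" "emeasure lebesgue (dilate a l k) = ennreal (m k)" and m_Suc: "m (Suc k) = N * m k" for k
      using l N by (auto simp: m_def emeasure_dilate N_def power_mult_distrib power_mult[symmetric] mult.commute)
    define M where "M k = enn2real (mass w (dilate a l k))" for k
    note M = apw_mass_dilate[OF p w l, of a, folded M_def]
    define V where "V k = enn2real (mass ?v (dilate a l k))" for k
    note V = apw_mass_dilate[OF s v l, of a, folded V_def]
    have V_rev: "V k \<le> \<delta> * V (Suc k)" for k
    proof -
      have "mass ?v (dilate a l k) \<le> ennreal \<delta> * mass ?v (dilate a l (Suc k))"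
        unfolding dilate_Suc dilate_def[of a l k] using l by (intro rev v) auto
      then show ?thesis unfolding V(2) using V(1) \<delta> by (simp add: ennreal_mult[symmetric] less_imp_le)
    qed
    define y where "y k = m k powr \<tau> * V k powr (1 / \<sigma>)" for k
    have My: "M k \<le> y k" for k
    proof -
      have "ennreal (M k) \<le> epow (ennreal (m k)) \<tau> * epow (ennreal (V k)) (1 / \<sigma>)"
        unfolding m(2)[symmetric] V(2)[symmetric] M(2)[symmetric] \<tau>_def by (rule mass_le_power_mass[OF \<sigma>]) auto
      then show ?thesis using m(1)[of k] V(1)[of k] by (simp add: y_def ennreal_mult[symmetric])
    qed
    have yM: "y k \<le> c * M k" for k
    proof -
      have "epow (ennreal (V k) / ennreal (m k)) (1 / \<sigma>) \<le> ennreal c * (ennreal (M k) / ennreal (m k))"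
        unfolding m(2)[symmetric] V(2)[symmetric] M(2)[symmetric] avg_def[symmetric] using RH[of "dilate a l k"] l by simp
      then have "(V k / m k) powr (1 / \<sigma>) \<le> c * (M k / m k)"
        using V(1)[of k] m(1)[of k] M(1)[of k] c by (simp add: divide_ennreal less_imp_le ennreal_mult[symmetric])
      then have "m k * (V k / m k) powr (1 / \<sigma>) \<le> m k * (c * (M k / m k))"
        using m(1)[of k] by (intro mult_left_mono) auto
      moreover have "m k * (V k / m k) powr (1 / \<sigma>) = y k"
        using V(1)[of k] m(1)[of k] by (simp add: y_def \<tau>_def powr_divide powr_diff)
      ultimately show ?thesis using m(1)[of k] by simp
    qed
    have y_rev: "y k \<le> \<eta> * g * y (Suc k)" for k
    proof -
      have "V k powr (1 / \<sigma>) \<le> (\<delta> * V (Suc k)) powr (1 / \<sigma>)"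
        using V_rev[of k] V(1)[of k] \<sigma> by (intro powr_mono2) auto
      also have "\<dots> = \<eta> * \<eta> * V (Suc k) powr (1 / \<sigma>)"
        using \<delta> V(1)[of "Suc k"] \<eta>(3) by (simp add: powr_mult)
      finally have "y k \<le> m k powr \<tau> * (\<eta> * \<eta> * V (Suc k) powr (1 / \<sigma>))"
        unfolding y_def by (intro mult_left_mono) auto
      also have "m k powr \<tau> = N powr (- \<tau>) * m (Suc k) powr \<tau>"
        using N m(1)[of k] by (simp add: m_Suc powr_mult powr_minus field_simps)
      finally show ?thesis by (simp add: g_def y_def mult_ac)
    qed
    show ?thesis
    proof (rule localising_annular[where \<phi>=\<phi> and M=M and y=y and m=m and \<mu>="emeasure lebesgue",
          OF p K w l \<eta>(1,2) _ c \<phi> _ _ _ M My yM _ m _ C_def K'_def])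
      show "\<phi> (Suc k) \<le> \<eta> * \<phi> k" for k using g \<phi>[of k] by (simp add: \<phi>_def mult_right_mono)
      show "\<phi> k \<le> 1 / g * \<phi> (Suc k)" for k using g by (simp add: \<phi>_def)
      show "\<phi> k * y k \<le> \<eta> * (\<phi> (Suc k) * y (Suc k))" for k
        using mult_left_mono[OF y_rev, of "\<phi> k" k] \<phi>[of k] by (simp add: \<phi>_def mult_ac)
      show "\<phi> (Suc k) * m (Suc k) powr \<kappa> \<le> \<eta> * (\<phi> k * m k powr \<kappa>)" for k
      proof -
        \<comment> \<open>Here \<kappa> \<le> 1 - 1 / \<sigma> enters: the growth of the gauge term
          does not exceed the factor N^\<tau> built into g.\<close>
        have "N powr (\<kappa> - \<tau>) \<le> N powr 0" using N \<kappa> by (intro powr_mono) (auto simp: \<tau>_def)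
        then have "N powr (- \<tau>) * N powr \<kappa> \<le> 1" using N by (simp add: powr_add[symmetric])
        then have "g * N powr \<kappa> \<le> \<eta>" using \<eta> mult_right_mono[of "N powr (- \<tau>) * N powr \<kappa>" 1 \<eta>] by (simp add: g_def mult_ac)
        then have "g * N powr \<kappa> * (\<phi> k * m k powr \<kappa>) \<le> \<eta> * (\<phi> k * m k powr \<kappa>)"
          using \<phi>[of k] by (intro mult_right_mono) auto
        moreover have "\<phi> (Suc k) * m (Suc k) powr \<kappa> = g * N powr \<kappa> * (\<phi> k * m k powr \<kappa>)"
          using N m(1)[of k] by (simp add: \<phi>_def m_Suc powr_mult)
        ultimately show ?thesis by simp
      qed
    qed (use g in \<open>auto simp: \<phi>_def\<close>)
  qed
  show ?thesis
    by (intro exI[of _ K'] exI[of _ C] conjI allI impI K' C) (rule main, auto)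
qed

subsection \<open>Domain and vector-valued inequalities\<close>

text \<open>The function G = |f|^\<gamma> has finite norm in L_{p/\<gamma>}(W). The extrapolation
  weight u makes its norm in L_{p0/\<gamma>}(u) finite as well, which says that f lies in
  L_{p0}(u).\<close>

lemma muckenhoupt_Lp_space_of_apw:
  fixes f :: "real ^ 'n \<Rightarrow> complex"
  assumes \<gamma>: "0 < \<gamma>" "\<gamma> \<le> p0" "\<gamma> < p" and K: "0 \<le> K" and W: "apw (p / \<gamma>) K W"
    and mf [measurable]: "f \<in> borel_measurable lebesgue"
    and fin: "pint p W (\<lambda>x. cmod (f x)) < top"
  shows "f \<in> (\<Union>w\<in>muckenhoupt (p0 / \<gamma>). Lp_space p0 w)"
proof -
  note [measurable] = apw_measurable[OF W]
  let ?P = "p / \<gamma>" and ?s0 = "p0 / \<gamma>"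
  have P: "1 < ?P" and s0: "1 \<le> ?s0" using \<gamma> by auto
  define G where "G x = epow (cmod (f x)) \<gamma>" for x
  have mG [measurable]: "G \<in> borel_measurable lebesgue" unfolding G_def by measurable
  have GP: "epow (G x) ?P = epow (cmod (f x)) p" and Gs: "epow (G x) ?s0 = epow (cmod (f x)) p0" for x
    using \<gamma> by (auto simp: G_def epow_epow)
  have mem: "f \<in> Lp_space p0 u" if "pint p0 u (\<lambda>x. cmod (f x)) < top" for u
    using that \<gamma> by (simp add: Lp_space_def Lp_norm_def epow_less_top)
  show ?thesis
  proof (cases "pint ?P W G = 0")
    case True
    then have "AE x in lebesgue. G x = 0" by (simp add: weighted_norm_eq_0_iff[OF W P mG])
    then have "AE x in lebesgue. epow (cmod (f x)) p0 * ennreal 1 = 0"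
      unfolding Gs[symmetric] by eventually_elim (use s0 in auto)
    then have "(\<integral>\<^sup>+x. epow (cmod (f x)) p0 * ennreal 1 \<partial>lebesgue) = 0"
      by (subst nn_integral_0_iff_AE) auto
    then have "f \<in> Lp_space p0 (\<lambda>_. 1)" by (intro mem) simp
    then show ?thesis using one_muckenhoupt(1)[OF s0] by blast
  next
    case False
    \<comment> \<open>The construction asks for a test function of positive finite dual norm; the
      dual weight has positive finite mass on every cube.\<close>
    let ?H = "indicator (cube 0 1) :: real ^ 'n \<Rightarrow> ennreal"
    have "pint (conj_exponent ?P) (dual_weight ?P W) ?H = mass (dual_weight ?P W) (cube 0 1)"
      unfolding mass_def using conj_exponent_gt_1[OF P]
      by (intro nn_integral_cong) (auto simp: indicator_def)
    moreover have "0 < mass (dual_weight ?P W) (cube 0 1)" "mass (dual_weight ?P W) (cube 0 1) < top"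
      using apw_mass_pos[OF apw_dual[OF P W]] apw_mass_finite[OF conj_exponent_gt_1[OF P] apw_dual[OF P W]] by auto
    ultimately have H: "pint (conj_exponent ?P) (dual_weight ?P W) ?H \<in> {0<..<top}" by simp
    have G: "pint ?P W G \<in> {0<..<top}"
      using False fin by (auto simp: GP zero_less_iff_neq_zero)
    have mH: "?H \<in> borel_measurable lebesgue" by measurable
    define N where "N = epow (pint ?P W G) (1/?P) *
          epow (pint (conj_exponent ?P) (dual_weight ?P W) ?H) (1 - 1/?P)"
    obtain A where "extrapolates ?s0 A (2 powr ?s0) G N ?H"
      using extrapolation_weight[OF s0 P K, where 'n='n] W mG mH G H unfolding N_def by blast
    then obtain u where u: "u \<in> muckenhoupt ?s0" "pint ?s0 u G \<le> ennreal (2 powr ?s0) * N"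
      unfolding extrapolates_def by blast
    have "N < top" unfolding N_def using G H by (simp add: ennreal_mult_less_top epow_finite)
    then have "ennreal (2 powr ?s0) * N < top" by (simp add: ennreal_mult_less_top)
    with u(2) have "pint p0 u (\<lambda>x. cmod (f x)) < top"
      unfolding Gs by (rule le_less_trans)
    then show ?thesis using mem u(1) by blast
  qed
qed

text \<open>Passing to a comparable weight with constant exactly K + 1 turns a bound that depends on
  the exact constant into one that depends on the upper bound K, at the cost of the factor
  \<open>M K\<close>.\<close>

lemma operator_weighted_bound:
  fixes T :: "nat \<Rightarrow> (real ^ 'n \<Rightarrow> complex) \<Rightarrow> (real ^ 'n \<Rightarrow> complex)" and c1 :: "ennreal \<Rightarrow> real"
  assumes \<gamma>: "0 < \<gamma>" "\<gamma> \<le> p0"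
    and bound: "\<forall>j. \<forall>w\<in>muckenhoupt (p0 / \<gamma>). \<forall>f\<in>Lp_space p0 w.
           Lp_norm p0 w UNIV (\<lambda>x. cmod (T j f x))
             \<le> ennreal (c1 (Ap_const (p0 / \<gamma>) w)) * Lp_norm p0 w UNIV (\<lambda>x. cmod (f x))"
  shows "\<exists>C. \<forall>j. \<forall>f\<in>borel_measurable lebesgue. \<forall>K\<ge>0. \<forall>u\<in>muckenhoupt (p0 / \<gamma>). Ap_const (p0 / \<gamma>) u \<le> ennreal K \<longrightarrow>
     pint p0 u (\<lambda>x. cmod (T j f x)) \<le> ennreal (C K) * pint p0 u (\<lambda>x. cmod (f x))"
proof -
  let ?s0 = "p0 / \<gamma>"
  have s0: "1 \<le> ?s0" and p0: "0 < p0" using \<gamma> by auto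
  have "\<exists>M>0. \<forall>u\<in>muckenhoupt ?s0. Ap_const ?s0 (u :: real ^ 'n \<Rightarrow> real) \<le> ennreal K \<longrightarrow>
     (\<exists>v\<in>muckenhoupt ?s0. Ap_const ?s0 v = ennreal (K + 1) \<and> (\<forall>x. u x \<le> v x \<and> v x \<le> M * u x))"
    if "0 \<le> K" for K
    by (rule exists_comparable_weight[OF s0 that])
  then obtain M where M: "\<And>K. 0 \<le> K \<Longrightarrow> 0 < M K" "\<And>K u. 0 \<le> K \<Longrightarrow> u \<in> muckenhoupt ?s0 \<Longrightarrow>
      Ap_const ?s0 (u :: real ^ 'n \<Rightarrow> real) \<le> ennreal K \<Longrightarrow>
      \<exists>v\<in>muckenhoupt ?s0. Ap_const ?s0 v = ennreal (K + 1) \<and> (\<forall>x. u x \<le> v x \<and> v x \<le> M K * u x)"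
    by metis
  \<comment> \<open>\<open>c1\<close> may take any real value. The maximum keeps the factor
    positive, which matters when the norm on the right is infinite.\<close>
  define c where "c K = max 1 (c1 (ennreal (K + 1)))" for K
  have c: "0 < c K" for K by (simp add: c_def)
  have "pint p0 u (\<lambda>x. cmod (T j f x))
       \<le> ennreal (c K powr p0 * M K) * pint p0 u (\<lambda>x. cmod (f x))"
    if [measurable]: "f \<in> borel_measurable lebesgue" and K: "0 \<le> K"
      and u: "u \<in> muckenhoupt ?s0" "Ap_const ?s0 u \<le> ennreal K" for j f K u
  proof -
    obtain v where v: "v \<in> muckenhoupt ?s0" "Ap_const ?s0 v = ennreal (K + 1)"
      and uv: "\<And>x. u x \<le> v x" "\<And>x. v x \<le> M K * u x"
      using M(2)[OF K u] by blast
    have [measurable]: "u \<in> borel_measurable lebesgue" and u0: "0 \<le> u x" for x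
      using u by (auto simp: muckenhoupt_def weight_def)
    have vf: "pint p0 v (\<lambda>x. cmod (f x)) \<le> ennreal (M K) * pint p0 u (\<lambda>x. cmod (f x))"
    proof -
      have "pint p0 v (\<lambda>x. cmod (f x)) \<le> (\<integral>\<^sup>+x. ennreal (M K) * (epow (cmod (f x)) p0 * ennreal (u x)) \<partial>lebesgue)"
      proof (rule nn_integral_mono)
        fix x
        have "ennreal (v x) \<le> ennreal (M K) * ennreal (u x)"
          using uv(2)[of x] M(1)[OF K] u0[of x] by (simp add: ennreal_mult[symmetric] ennreal_leI)
        then have "epow (cmod (f x)) p0 * ennreal (v x) \<le> epow (cmod (f x)) p0 * (ennreal (M K) * ennreal (u x))"
          by (rule mult_left_mono) auto
        then show "epow (cmod (f x)) p0 * ennreal (v x) \<le> ennreal (M K) * (epow (cmod (f x)) p0 * ennreal (u x))"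
          by (simp only: mult_ac)
      qed
      then show ?thesis by (subst (asm) nn_integral_cmult) auto
    qed
    show ?thesis
    proof (cases "pint p0 u (\<lambda>x. cmod (f x)) = top")
      case True
      then show ?thesis using c[of K] M(1)[OF K] by (simp add: ennreal_mult_top)
    next
      case False
      then have "pint p0 v (\<lambda>x. cmod (f x)) < top"
        by (intro le_less_trans[OF vf]) (simp add: ennreal_mult_less_top less_top)
      then have "f \<in> Lp_space p0 v" using p0 by (simp add: Lp_space_def Lp_norm_def epow_less_top)
      from bound[rule_format, OF v(1) this, of j]
      have "Lp_norm p0 v UNIV (\<lambda>x. cmod (T j f x)) \<le> ennreal (c K) * Lp_norm p0 v UNIV (\<lambda>x. cmod (f x))"
        unfolding v(2) by (rule order_trans) (auto intro!: mult_right_mono ennreal_leI simp: c_def)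
      then have "pint p0 v (\<lambda>x. cmod (T j f x)) \<le>
          epow (ennreal (c K) * epow (pint p0 v (\<lambda>x. cmod (f x))) (1 / p0)) p0"
        using p0 by (simp add: Lp_norm_def epow_le_iff)
      also have "\<dots> = ennreal (c K powr p0) * pint p0 v (\<lambda>x. cmod (f x))"
        using p0 c[of K] by (simp add: epow_mult epow_epow)
      also have "\<dots> \<le> ennreal (c K powr p0) * (ennreal (M K) * pint p0 u (\<lambda>x. cmod (f x)))"
        by (intro mult_left_mono vf) auto
      also have "\<dots> = ennreal (c K powr p0 * M K) * pint p0 u (\<lambda>x. cmod (f x))"
        using M(1)[OF K] by (simp add: ennreal_mult mult.assoc)
      finally have "pint p0 v (\<lambda>x. cmod (T j f x))
         \<le> ennreal (c K powr p0 * M K) * pint p0 u (\<lambda>x. cmod (f x))" .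
      moreover have "pint p0 u (\<lambda>x. cmod (T j f x)) \<le> pint p0 v (\<lambda>x. cmod (T j f x))"
        using uv(1) by (intro nn_integral_mono mult_left_mono ennreal_leI) auto
      ultimately show ?thesis by (rule order_trans[rotated])
    qed
  qed
  then show ?thesis by (intro exI[of _ "\<lambda>K. c K powr p0 * M K"]) blast
qed

text \<open>The exponents are p0 / \<gamma>, q / \<gamma> and p / \<gamma>. At the middle one the
  weighted integral of the q-th power of the sequence norm is the sum of those of the components,
  and the scalar bounds share one constant for all j, so they add up. The sums form the pair for the
  second extrapolation.\<close>

lemma vector_valued_extrapolation:
  fixes T :: "nat \<Rightarrow> (real ^ 'n \<Rightarrow> complex) \<Rightarrow> (real ^ 'n \<Rightarrow> complex)" and c1 :: "ennreal \<Rightarrow> real"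
  assumes \<gamma>: "0 < \<gamma>" "\<gamma> \<le> p0" "\<gamma> < q" "\<gamma> < p"
    and oper: "\<And>j. operator_on (\<Union>w\<in>muckenhoupt (p0 / \<gamma>). Lp_space p0 w) (T j)"
    and bound: "\<forall>j. \<forall>w\<in>muckenhoupt (p0 / \<gamma>). \<forall>f\<in>Lp_space p0 w.
           Lp_norm p0 w UNIV (\<lambda>x. cmod (T j f x))
             \<le> ennreal (c1 (Ap_const (p0 / \<gamma>) w)) * Lp_norm p0 w UNIV (\<lambda>x. cmod (f x))"
  shows "\<exists>C. \<forall>f. (\<forall>j. f j \<in> (\<Union>w\<in>muckenhoupt (p0 / \<gamma>). Lp_space p0 w)) \<longrightarrow> (\<forall>K\<ge>0. \<forall>W. apw (p / \<gamma>) K W \<longrightarrow>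
     pint p W (lq_sum q (\<lambda>j. T j (f j))) \<le> ennreal (C K) * pint p W (lq_sum q f))"
proof -
  let ?s0 = "p0 / \<gamma>" and ?Q = "q / \<gamma>" and ?P = "p / \<gamma>"
  let ?D = "\<Union>w\<in>muckenhoupt (p0 / \<gamma>). Lp_space p0 w"
  have s0: "1 \<le> ?s0" and Q: "1 < ?Q" and P: "1 < ?P" using \<gamma> by auto
  have qs: "0 < q" "0 < p" "0 < p0" using \<gamma> by auto
  obtain C0 where C0: "\<And>j f K (u :: real ^ 'n \<Rightarrow> real). f \<in> borel_measurable lebesgue \<Longrightarrow> 0 \<le> K \<Longrightarrow> u \<in> muckenhoupt ?s0 \<Longrightarrow> Ap_const ?s0 u \<le> ennreal K \<Longrightarrow>
     pint p0 u (\<lambda>x. cmod (T j f x)) \<le> ennreal (C0 K) * pint p0 u (\<lambda>x. cmod (f x))"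
    using operator_weighted_bound[OF \<gamma>(1,2) bound] by blast
  have D1 [measurable_dest]: "f \<in> borel_measurable lebesgue" if "f \<in> ?D" for f
    using that by (auto simp: Lp_space_def)
  have D2: "T j f \<in> borel_measurable lebesgue" if "f \<in> ?D" for j f
    using oper[of j] that by (auto simp: operator_on_def)
  obtain C1 where C1: "\<And>(F :: real ^ 'n \<Rightarrow> ennreal) G K w. F \<in> borel_measurable lebesgue \<Longrightarrow> G \<in> borel_measurable lebesgue \<Longrightarrow>
     muckenhoupt_bounded ?s0 C0 F G \<Longrightarrow> 0 \<le> K \<Longrightarrow> apw ?Q K w \<Longrightarrow> pint ?Q w F \<le> ennreal (C1 K) * pint ?Q w G"
    using extrapolation[OF s0 Q, of C0, where 'n='n] by blast
  have scalar: "pint q w (\<lambda>x. cmod (T j f x)) \<le> ennreal (C1 K) * pint q w (\<lambda>x. cmod (f x))"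
    if f: "f \<in> ?D" and K: "0 \<le> K" and w: "apw ?Q K w" for j f K w
  proof -
    note [measurable] = D1[OF f] D2[OF f]
    have e: "epow (epow x \<gamma>) (r / \<gamma>) = epow x r" for x r using \<gamma> by (simp add: epow_epow)
    have "muckenhoupt_bounded ?s0 C0 (\<lambda>x. epow (cmod (T j f x)) \<gamma>) (\<lambda>x. epow (cmod (f x)) \<gamma>)"
      unfolding muckenhoupt_bounded_def
    proof (intro allI ballI impI)
      fix K and u :: "real ^ 'n \<Rightarrow> real" assume "0 \<le> K" "u \<in> muckenhoupt ?s0" "Ap_const ?s0 u \<le> ennreal K"
      then show "pint ?s0 u (\<lambda>x. epow (cmod (T j f x)) \<gamma>)
          \<le> ennreal (C0 K) * pint ?s0 u (\<lambda>x. epow (cmod (f x)) \<gamma>)"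
        unfolding e using C0 D1[OF f] by blast
    qed
    from C1[OF _ _ this K w] show ?thesis unfolding e by simp
  qed
  obtain C2 where C2: "\<And>(F :: real ^ 'n \<Rightarrow> ennreal) G K w. F \<in> borel_measurable lebesgue \<Longrightarrow> G \<in> borel_measurable lebesgue \<Longrightarrow>
     muckenhoupt_bounded ?Q C1 F G \<Longrightarrow> 0 \<le> K \<Longrightarrow> apw ?P K w \<Longrightarrow> pint ?P w F \<le> ennreal (C2 K) * pint ?P w G"
    using extrapolation[OF less_imp_le[OF Q] P, of C1, where 'n='n] by blast
  have "pint p W (lq_sum q (\<lambda>j. T j (f j))) \<le> ennreal (C2 K) * pint p W (lq_sum q f)"
    if f: "\<And>j. f j \<in> ?D" and K: "0 \<le> K" and W: "apw ?P K W" for f K W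
  proof -
    note [measurable] = D1[OF f] D2[OF f]
    have lq [measurable]: "lq_sum q f \<in> borel_measurable lebesgue" "lq_sum q (\<lambda>j. T j (f j)) \<in> borel_measurable lebesgue"
      unfolding lq_sum_def by measurable
    have eP: "epow (epow x \<gamma>) ?P = epow x p" for x using \<gamma> by (simp add: epow_epow)
    have eQ: "epow (epow (lq_sum q h x) \<gamma>) ?Q = (\<Sum>j. epow (cmod (h j x)) q)" for h and x :: "real ^ 'n"
      using \<gamma> qs by (simp add: lq_sum_def epow_epow)
    have "muckenhoupt_bounded ?Q C1 (\<lambda>x. epow (lq_sum q (\<lambda>j. T j (f j)) x) \<gamma>) (\<lambda>x. epow (lq_sum q f x) \<gamma>)"
      unfolding muckenhoupt_bounded_def
    proof (intro allI ballI impI)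
      fix K and u :: "real ^ 'n \<Rightarrow> real" assume K: "0 \<le> K" and u: "u \<in> muckenhoupt ?Q" "Ap_const ?Q u \<le> ennreal K"
      have [measurable]: "u \<in> borel_measurable lebesgue" using u by (auto simp: muckenhoupt_def weight_def)
      have apw: "apw ?Q K (\<lambda>x. ennreal (u x))" by (rule apw_of_muckenhoupt[OF Q u])
      have "(\<integral>\<^sup>+x. (\<Sum>j. epow (cmod (T j (f j) x)) q) * ennreal (u x) \<partial>lebesgue)
          = (\<Sum>j. \<integral>\<^sup>+x. epow (cmod (T j (f j) x)) q * ennreal (u x) \<partial>lebesgue)"
        unfolding ennreal_suminf_multc[symmetric] by (rule nn_integral_suminf) measurable
      also have "\<dots> \<le> (\<Sum>j. ennreal (C1 K) * pint q u (\<lambda>x. cmod (f j x)))"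
        by (intro suminf_le scalar f K apw) auto
      also have "\<dots> = ennreal (C1 K) * (\<integral>\<^sup>+x. (\<Sum>j. epow (cmod (f j x)) q) * ennreal (u x) \<partial>lebesgue)"
        unfolding ennreal_suminf_multc[symmetric] by (subst nn_integral_suminf) auto
      finally show "pint ?Q u (\<lambda>x. epow (lq_sum q (\<lambda>j. T j (f j)) x) \<gamma>)
          \<le> ennreal (C1 K) * pint ?Q u (\<lambda>x. epow (lq_sum q f x) \<gamma>)"
        unfolding eQ .
    qed
    from C2[OF _ _ this K W] show ?thesis unfolding eP by simp
  qed
  then show ?thesis by blast
qed

subsection \<open>Morrey norms\<close>

text \<open>Both Morrey norms are instances, with \<open>\<mu>(Q) = w(Q)\<close> and \<open>\<mu>(Q) = |Q|\<close>.\<close>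

definition gauge_norm ::
  "((real ^ 'n) set \<Rightarrow> ennreal) \<Rightarrow> real \<Rightarrow> real \<Rightarrow> (real ^ 'n \<Rightarrow> real) \<Rightarrow> (real ^ 'n \<Rightarrow> ennreal) \<Rightarrow> ennreal" where
  "gauge_norm \<mu> p r w g = (SUP Q\<in>cubes. epow (\<mu> Q) (- (1 / p + r / CARD('n))) * Lp_norm p w Q g)"

lemma gauge_norm_bound:
  fixes w :: "real ^ 'n \<Rightarrow> real"
  assumes p: "0 < p" and Q: "Q \<in> cubes" and \<mu>: "0 < \<mu> Q" "\<mu> Q < top"
  shows "mass (\<lambda>x. epow (g x) p * ennreal (w x)) Q \<le> epow (\<mu> Q) (1 + r * p / CARD('n)) * epow (gauge_norm \<mu> p r w g) p"
proof -
  let ?e = "1 / p + r / CARD('n)"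
  have "epow (\<mu> Q) (- ?e) * Lp_norm p w Q g \<le> gauge_norm \<mu> p r w g"
    unfolding gauge_norm_def using Q by (rule SUP_upper)
  then have "epow (\<mu> Q) ?e * (epow (\<mu> Q) (- ?e) * Lp_norm p w Q g) \<le> epow (\<mu> Q) ?e * gauge_norm \<mu> p r w g"
    by (rule mult_left_mono) auto
  moreover have "epow (\<mu> Q) ?e * epow (\<mu> Q) (- ?e) = 1"
    using epow_minus_mult[OF \<mu>, of ?e] by (simp add: mult.commute)
  ultimately have "Lp_norm p w Q g \<le> epow (\<mu> Q) ?e * gauge_norm \<mu> p r w g"
    by (simp add: mult.assoc[symmetric])
  then have "mass (\<lambda>x. epow (g x) p * ennreal (w x)) Q \<le> epow (epow (\<mu> Q) ?e * gauge_norm \<mu> p r w g) p"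
    using p by (simp add: Lp_norm_def mass_def epow_le_iff)
  also have "\<dots> = epow (\<mu> Q) (?e * p) * epow (gauge_norm \<mu> p r w g) p"
    using p by (simp add: epow_mult epow_epow)
  also have "?e * p = 1 + r * p / CARD('n)" using p by (simp add: field_simps)
  finally show ?thesis .
qed

lemma gauge_norm_le:
  fixes w :: "real ^ 'n \<Rightarrow> real"
  assumes p: "0 < p" and \<mu>: "\<And>Q. Q \<in> cubes \<Longrightarrow> 0 < \<mu> Q \<and> \<mu> Q < top"
    and bound: "\<And>Q. Q \<in> cubes \<Longrightarrow> mass (\<lambda>x. epow (g x) p * ennreal (w x)) Q \<le> B * epow (\<mu> Q) (1 + r * p / CARD('n)) * epow Y p"
  shows "gauge_norm \<mu> p r w g \<le> epow B (1 / p) * Y"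
  unfolding gauge_norm_def
proof (rule SUP_least)
  fix Q :: "(real ^ 'n) set" assume Q: "Q \<in> cubes"
  let ?e = "1 / p + r / CARD('n)"
  have "Lp_norm p w Q g \<le> epow (B * epow (\<mu> Q) (1 + r * p / CARD('n)) * epow Y p) (1 / p)"
    using p bound[OF Q] unfolding Lp_norm_def mass_def by (intro epow_mono) auto
  also have "\<dots> = epow B (1 / p) * epow (\<mu> Q) ?e * Y"
  proof -
    have "(1 + r * p / CARD('n)) * (1 / p) = ?e" using p by (simp add: field_simps)
    then show ?thesis using p by (simp only: epow_mult epow_epow zero_le_divide_1_iff less_imp_le) simp
  qed
  finally have "epow (\<mu> Q) (- ?e) * Lp_norm p w Q g \<le> epow (\<mu> Q) (- ?e) * (epow B (1 / p) * epow (\<mu> Q) ?e * Y)"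
    by (rule mult_left_mono) auto
  also have "\<dots> = (epow (\<mu> Q) (- ?e) * epow (\<mu> Q) ?e) * (epow B (1 / p) * Y)"
    by (simp only: mult_ac)
  also have "epow (\<mu> Q) (- ?e) * epow (\<mu> Q) ?e = 1" using \<mu>[OF Q] by (intro epow_minus_mult) auto
  finally show "epow (\<mu> Q) (- ?e) * Lp_norm p w Q g \<le> epow B (1 / p) * Y" by simp
qed

text \<open>For each cube Q the global bound with the weight adapted to Q is restricted to Q on the
  left, where the weight dominates w, and evaluated by the Morrey bounds on the right. The constants
  do not depend on Q, so the supremum can be taken.\<close>

lemma gauge_norm_vector_valued:
  fixes T :: "nat \<Rightarrow> (real ^ 'n \<Rightarrow> complex) \<Rightarrow> (real ^ 'n \<Rightarrow> complex)" and c1 :: "ennreal \<Rightarrow> real"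
    and w :: "real ^ 'n \<Rightarrow> real"
  assumes \<gamma>: "0 < \<gamma>" "\<gamma> \<le> p0" "\<gamma> < q" "\<gamma> < p"
    and oper: "\<And>j. operator_on (\<Union>w\<in>muckenhoupt (p0 / \<gamma>). Lp_space p0 w) (T j)"
    and bound: "\<forall>j. \<forall>w\<in>muckenhoupt (p0 / \<gamma>). \<forall>f\<in>Lp_space p0 w.
           Lp_norm p0 w UNIV (\<lambda>x. cmod (T j f x))
             \<le> ennreal (c1 (Ap_const (p0 / \<gamma>) w)) * Lp_norm p0 w UNIV (\<lambda>x. cmod (f x))"
    and \<mu>: "\<And>Q. Q \<in> cubes \<Longrightarrow> 0 < \<mu> Q \<and> \<mu> Q < top" and K: "0 \<le> K" and C: "0 \<le> C"
    and W: "\<And>a l. 0 < l \<Longrightarrow> localising (p / \<gamma>) K C (1 + r * p / CARD('n)) \<mu> (\<lambda>x. ennreal (w x)) (cube a l)"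
  shows "\<exists>c\<ge>0. \<forall>f. (\<forall>j. f j \<in> borel_measurable lebesgue \<and> gauge_norm \<mu> p r w (\<lambda>x. cmod (f j x)) < top) \<longrightarrow>
     gauge_norm \<mu> p r w (lq_sum q (\<lambda>j. T j (f j))) \<le> ennreal c * gauge_norm \<mu> p r w (lq_sum q f)"
proof -
  let ?\<kappa> = "1 + r * p / CARD('n)"
  have p: "0 < p" using \<gamma> by simp
  obtain C' where C': "\<And>f K W. (\<forall>j. f j \<in> (\<Union>w\<in>muckenhoupt (p0 / \<gamma>). Lp_space p0 w)) \<Longrightarrow> 0 \<le> K \<Longrightarrow> apw (p / \<gamma>) K W \<Longrightarrow>
     pint p W (lq_sum q (\<lambda>j. T j (f j))) \<le> ennreal (C' K) * pint p W (lq_sum q f)"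
    using vector_valued_extrapolation[OF \<gamma> oper bound] by blast
  define B where "B = max 1 (C' K) * max 1 C"
  have B: "0 < B" by (simp add: B_def)
  have "gauge_norm \<mu> p r w (lq_sum q (\<lambda>j. T j (f j))) \<le> ennreal (B powr (1 / p)) * gauge_norm \<mu> p r w (lq_sum q f)"
    if f: "\<And>j. f j \<in> borel_measurable lebesgue" "\<And>j. gauge_norm \<mu> p r w (\<lambda>x. cmod (f j x)) < top" for f
  proof -
    note [measurable] = f(1)
    have [measurable]: "lq_sum q f \<in> borel_measurable lebesgue" unfolding lq_sum_def by measurable
    let ?Y = "gauge_norm \<mu> p r w (lq_sum q f)"
    \<comment> \<open>Membership in the domain takes a single weight; the one adapted to the unit
      cube serves.\<close>
    have dom: "f j \<in> (\<Union>w\<in>muckenhoupt (p0 / \<gamma>). Lp_space p0 w)" for j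
    proof -
      obtain W' where W': "apw (p / \<gamma>) K W'" and W'2: "\<And>g X. g\<in>borel_measurable lebesgue \<Longrightarrow>
          (\<forall>Q\<in>cubes. mass (\<lambda>x. g x * ennreal (w x)) Q \<le> epow (\<mu> Q) ?\<kappa> * X) \<Longrightarrow>
         (\<integral>\<^sup>+x. g x * W' x \<partial>lebesgue) \<le> ennreal C * epow (\<mu> (cube 0 1)) ?\<kappa> * X"
        using W[of 1 0] unfolding localising_def by auto
      have "pint p W' (\<lambda>x. cmod (f j x)) \<le>
          ennreal C * epow (\<mu> (cube 0 1)) ?\<kappa> * epow (gauge_norm \<mu> p r w (\<lambda>x. cmod (f j x))) p"
        using \<mu> p by (intro W'2 ballI gauge_norm_bound) auto
      also have "\<dots> < top"
        using \<mu>[of "cube 0 1"] f(2)[of j] p by (simp add: ennreal_mult_less_top epow_finite epow_less_top)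
      finally show ?thesis
        using W' by (intro muckenhoupt_Lp_space_of_apw[OF \<gamma>(1,2,4) K]) (auto simp: f(1))
    qed
    have "gauge_norm \<mu> p r w (lq_sum q (\<lambda>j. T j (f j))) \<le> epow (ennreal B) (1 / p) * ?Y"
    proof (rule gauge_norm_le[OF p \<mu>])
      fix Q :: "(real ^ 'n) set" assume "Q \<in> cubes"
      then obtain a l where al: "0 < l" "Q = cube a l" by (rule cubesE)
      obtain W' where W': "apw (p / \<gamma>) K W'" "\<And>x. x \<in> Q \<Longrightarrow> ennreal (w x) \<le> W' x" and W'2: "\<And>g X. g\<in>borel_measurable lebesgue \<Longrightarrow>
          (\<forall>Q\<in>cubes. mass (\<lambda>x. g x * ennreal (w x)) Q \<le> epow (\<mu> Q) ?\<kappa> * X) \<Longrightarrow>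
         (\<integral>\<^sup>+x. g x * W' x \<partial>lebesgue) \<le> ennreal C * epow (\<mu> Q) ?\<kappa> * X"
        using W[OF al(1), of a] unfolding al(2) localising_def by auto
      let ?F = "lq_sum q (\<lambda>j. T j (f j))"
      have "mass (\<lambda>x. epow (?F x) p * ennreal (w x)) Q \<le> pint p W' ?F"
        unfolding mass_def using W'(2) by (intro nn_integral_mono) (auto split: split_indicator intro: mult_left_mono)
      also have "\<dots> \<le> ennreal (C' K) * pint p W' (lq_sum q f)"
        by (rule C'[OF _ K W'(1)]) (use dom in blast)
      also have "\<dots> \<le> ennreal (C' K) * (ennreal C * epow (\<mu> Q) ?\<kappa> * epow ?Y p)"
        using \<mu> p by (intro mult_left_mono W'2 ballI gauge_norm_bound) auto
      also have "\<dots> = ennreal (C' K) * ennreal C * (epow (\<mu> Q) ?\<kappa> * epow ?Y p)" by (simp only: mult.assoc)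
      also have "\<dots> \<le> ennreal B * (epow (\<mu> Q) ?\<kappa> * epow ?Y p)"
        unfolding B_def by (intro mult_right_mono, subst ennreal_mult) (auto intro!: mult_mono ennreal_leI)
      finally show "mass (\<lambda>x. epow (?F x) p * ennreal (w x)) Q \<le> ennreal B * epow (\<mu> Q) ?\<kappa> * epow ?Y p"
        by (simp only: mult.assoc)
    qed
    then show ?thesis using B by simp
  qed
  then show ?thesis by (intro exI[of _ "B powr (1 / p)"]) auto
qed

theorem corollary4p7:
  fixes T :: "nat \<Rightarrow> (real ^ 'n \<Rightarrow> complex) \<Rightarrow> (real ^ 'n \<Rightarrow> complex)"
    and \<gamma> p\<^sub>0 p q :: real
    and c\<^sub>1 :: "ennreal \<Rightarrow> real"
  assumes "1 \<le> \<gamma>" and "\<gamma> \<le> p\<^sub>0"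
    and "\<And>j. operator_on (\<Union>w\<in>muckenhoupt (p\<^sub>0 / \<gamma>). Lp_space p\<^sub>0 w) (T j)"
    and "\<And>j w f. w \<in> muckenhoupt (p\<^sub>0 / \<gamma>) \<Longrightarrow> f \<in> Lp_space p\<^sub>0 w \<Longrightarrow>
           Lp_norm p\<^sub>0 w UNIV (\<lambda>x. cmod (T j f x))
             \<le> ennreal (c\<^sub>1 (Ap_const (p\<^sub>0 / \<gamma>) w)) * Lp_norm p\<^sub>0 w UNIV (\<lambda>x. cmod (f x))"
    and "\<gamma> < q" and "\<gamma> < p"
  shows "(\<forall>w r. w \<in> muckenhoupt (p / \<gamma>) \<and> - real CARD('n) / p \<le> r \<and> r < 0 \<longrightarrow>
            (\<exists>c\<^sub>4::real. 0 \<le> c\<^sub>4 \<and>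
              (\<forall>f. (\<forall>j. f j \<in> morrey_space p r w) \<longrightarrow>
                 morrey_norm p r w (lq_sum q (\<lambda>j. T j (f j)))
                   \<le> ennreal c\<^sub>4 * morrey_norm p r w (lq_sum q f)))) \<and>
         (\<forall>w \<sigma> r. 1 < \<sigma> \<and> w \<in> muckenhoupt (p / \<gamma>) \<inter> reverse_hoelder \<sigma> \<and>
            - real CARD('n) / p \<le> r \<and> r \<le> - real CARD('n) / (p * \<sigma>) \<longrightarrow>
            (\<exists>c\<^sub>5::real. 0 \<le> c\<^sub>5 \<and>
              (\<forall>f. (\<forall>j. f j \<in> lmorrey_space p r w) \<longrightarrow>
                 lmorrey_norm p r w (lq_sum q (\<lambda>j. T j (f j)))
                   \<le> ennreal c\<^sub>5 * lmorrey_norm p r w (lq_sum q f))))"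
proof (intro conjI allI impI)
  have \<gamma>: "0 < \<gamma>" "\<gamma> \<le> p\<^sub>0" "\<gamma> < q" "\<gamma> < p" and p: "0 < p" using assms by auto
  have P: "1 < p / \<gamma>" using \<gamma> by simp
  have bound: "\<forall>j. \<forall>w\<in>muckenhoupt (p\<^sub>0 / \<gamma>). \<forall>f\<in>Lp_space p\<^sub>0 w.
      Lp_norm p\<^sub>0 w UNIV (\<lambda>x. cmod (T j f x))
        \<le> ennreal (c\<^sub>1 (Ap_const (p\<^sub>0 / \<gamma>) w)) * Lp_norm p\<^sub>0 w UNIV (\<lambda>x. cmod (f x))"
    using assms(4) by blast
  note vector_valued = gauge_norm_vector_valued[OF \<gamma> assms(3) bound]
  have apw: "\<exists>K\<ge>0. apw (p / \<gamma>) K (\<lambda>x. ennreal (w x))" if "w \<in> muckenhoupt (p / \<gamma>)" for w :: "real ^ 'n \<Rightarrow> real"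
  proof -
    have "Ap_const (p / \<gamma>) w \<le> ennreal (enn2real (Ap_const (p / \<gamma>) w))"
      using that by (simp add: muckenhoupt_def)
    then show ?thesis using apw_of_muckenhoupt[OF P that] by (intro exI[of _ "enn2real (Ap_const (p / \<gamma>) w)"]) auto
  qed
  have \<kappa>0: "0 \<le> 1 + r * p / CARD('n)" if "- real CARD('n) / p \<le> r" for r
    using that p by (simp add: field_simps)
  {
    fix w :: "real ^ 'n \<Rightarrow> real" and r
    assume *: "w \<in> muckenhoupt (p / \<gamma>) \<and> - real CARD('n) / p \<le> r \<and> r < 0"
    then obtain K where K: "0 \<le> K" "apw (p / \<gamma>) K (\<lambda>x. ennreal (w x))" using apw by blast
    \<comment> \<open>The strict inequality r < 0 leaves room for an exponent between \<kappa> and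
      1.\<close>
    have \<kappa>: "0 \<le> 1 + r * p / CARD('n)" "1 + r * p / CARD('n) < 1"
      using * \<kappa>0 p by (auto simp: divide_less_0_iff mult_less_0_iff)
    have norm: "morrey_norm p r w g = gauge_norm (mass w) p r w g" for g
      by (simp add: morrey_norm_def gauge_norm_def)
    have \<mu>: "0 < mass w Q \<and> mass w Q < top" if "Q \<in> cubes" for Q
      using apw_mass_pos[OF K(2) that] apw_mass_finite[OF P K(2) that] by simp
    obtain K' C where "0 \<le> K'" "0 \<le> C"
      and "\<And>a l. 0 < l \<Longrightarrow> localising (p / \<gamma>) K' C (1 + r * p / CARD('n)) (mass w) (\<lambda>x. ennreal (w x)) (cube a l)"
      using localising_mass[OF P K(1) \<kappa>, where 'n='n] K(2) by blast
    from vector_valued[OF \<mu> this]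
    show "\<exists>c\<^sub>4::real. 0 \<le> c\<^sub>4 \<and> (\<forall>f. (\<forall>j. f j \<in> morrey_space p r w) \<longrightarrow>
                 morrey_norm p r w (lq_sum q (\<lambda>j. T j (f j))) \<le> ennreal c\<^sub>4 * morrey_norm p r w (lq_sum q f))"
      by (simp add: morrey_space_def norm)
  }
  {
    fix w :: "real ^ 'n \<Rightarrow> real" and \<sigma> r
    assume *: "1 < \<sigma> \<and> w \<in> muckenhoupt (p / \<gamma>) \<inter> reverse_hoelder \<sigma> \<and>
            - real CARD('n) / p \<le> r \<and> r \<le> - real CARD('n) / (p * \<sigma>)"
    then obtain K where K: "0 \<le> K" "apw (p / \<gamma>) K (\<lambda>x. ennreal (w x))" using apw by blast
    from * obtain c where c: "0 \<le> c" "\<forall>Q\<in>cubes. epow (avg (\<lambda>x. epow (w x) \<sigma>) Q) (1 / \<sigma>) \<le> ennreal c * avg w Q"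
      by (auto simp: reverse_hoelder_def)
    have \<sigma>: "1 < \<sigma>" using * by simp
    \<comment> \<open>The endpoint r = - n / (p \<sigma>) corresponds to \<kappa> = 1 - 1 /
      \<sigma>.\<close>
    have \<kappa>: "0 \<le> 1 + r * p / CARD('n)" "1 + r * p / CARD('n) \<le> 1 - 1 / \<sigma>"
    proof -
      have "r * p \<le> - real CARD('n) / (p * \<sigma>) * p" using * p by (intro mult_right_mono) auto
      also have "\<dots> = - real CARD('n) / \<sigma>" using p by simp
      finally have "r * p / CARD('n) \<le> - real CARD('n) / \<sigma> / CARD('n)" by (rule divide_right_mono) simp
      then show "1 + r * p / CARD('n) \<le> 1 - 1 / \<sigma>" by simp
    qed (use * \<kappa>0 in auto)
    have norm: "lmorrey_norm p r w g = gauge_norm (emeasure lebesgue) p r w g" for g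
      by (simp add: lmorrey_norm_def gauge_norm_def)
    have \<mu>: "0 < emeasure lebesgue Q \<and> emeasure lebesgue Q < top" if "Q \<in> cubes" for Q :: "(real ^ 'n) set"
      using that by (simp add: emeasure_cubes_pos emeasure_cubes_finite)
    obtain K' C where "0 \<le> K'" "0 \<le> C"
      and "\<And>a l. 0 < l \<Longrightarrow> localising (p / \<gamma>) K' C (1 + r * p / CARD('n)) (emeasure lebesgue) (\<lambda>x. ennreal (w x)) (cube a l)"
      using localising_volume[OF P K(1) \<sigma> c(1) \<kappa>, where 'n='n] K(2) c(2) by blast
    from vector_valued[OF \<mu> this]
    show "\<exists>c\<^sub>5::real. 0 \<le> c\<^sub>5 \<and> (\<forall>f. (\<forall>j. f j \<in> lmorrey_space p r w) \<longrightarrow>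
                 lmorrey_norm p r w (lq_sum q (\<lambda>j. T j (f j))) \<le> ennreal c\<^sub>5 * lmorrey_norm p r w (lq_sum q f))"
      by (simp add: lmorrey_space_def norm)
  }
qed

end
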